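(* Let $B$ be a standard Brownian motion on $[0,1]$ with $B(0)=0$, let $h=\max_{0\le s\le 1}B(s)$, let $\theta$ be the smallest $s\in[0,1]$ with $B(s)=h$, and let $c=B(1)$. Fix a time $t\in(0,1)$. For $0<\theta<1$, $h>\max(0,c)$ and $x<h$, the conditional density of $B(t)$ at $x$ given $(c,\theta,h)$ is, for $t<\theta$, $$p(B(t)=x\mid c,\theta,h)=g_{t}(h-x,h)\,\frac{\theta^{3/2}(h-x)}{(\theta-t)^{3/2}h}\,\exp\!\Big(\frac{h^2}{2\theta}\Big)\exp\!\Big(-\frac{(h-x)^2}{2(\theta-t)}\Big),$$ and, for $t>\theta$, $$p(B(t)=x\mid c,\theta,h)=g_{1-t}(h-x,h-c)\,\frac{(h-x)(1-\theta)^{3/2}}{(h-c)(t-\theta)^{3/2}}\,\exp\!\Big(-\frac{(h-x)^2}{2(t-\theta)}\Big)\exp\!\Big(\frac{(h-c)^2}{2(1-\theta)}\Big).$$ Moreover the joint density of $B(t)$, the argmax, the maximum and the final value satisfies, for $t<\theta$, $$p(B(t)=x,\theta,h,c)=\frac{(h-c)(h-x)}{\pi(1-\theta)^{3/2}(\theta-t)^{3/2}}\,g_{t}(h-x,h)\,\exp\!\Big(-\frac{(h-x)^2}{2(\theta-t)}-\frac{(h-c)^2}{2(1-\theta)}\Big),$$ and, for $t>\theta$, $$p(B(t)=x,\theta,h,c)=\frac{h(h-x)}{\pi\,\theta^{3/2}(t-\theta)^{3/2}}\,g_{1-t}(h-x,h-c)\,\exp\!\Big(-\frac{(h-x)^2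}{2(t-\theta)}-\frac{h^2}{2\theta}\Big).$$
   Context: Notation: $\phi_\sigma(x)=(2\pi\sigma)^{-1/2}e^{-x^2/(2\sigma)}$ and $g_\sigma(x,y)=\phi_\sigma(y-x)-\phi_\sigma(y+x)$. The letters $c,\theta,h$ denote both the random variables $B(1)$, first argmax, and maximum of $B$ on $[0,1]$, and their values. Conditional densities are understood in the sense of regular conditional distributions given $(B(1),\text{first argmax},\max)=(c,\theta,h)$; the formulas give a version (valid for Lebesgue-almost every $(c,\theta,h)$), and all densities vanish for $x\ge h$. The known joint density of (final value, first argmax, maximum) is $$p(c,\theta,h)=\frac{h(h-c)}{\pi\theta^{3/2}(1-\theta)^{3/2}}\exp\Big(-\frac{h^2}{2\theta}-\frac{(h-c)^2}{2(1-\theta)}\Big),\qquad 0<\theta<1,\ h\ge0,\ h\ge c.$$ *)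

theory Defs
  imports "HOL-Probability.Probability"
begin

text \<open>
  Standard Brownian motion on the time interval from 0 to 1, started at 0. Only the random
  variables with time index in that interval are constrained, and every path (not just almost
  every path) starts at 0 and is continuous. The second argument of \<^const>\<open>normal_density\<close> is the
  standard deviation.
\<close>

definition brownian_motion01 :: "'a measure \<Rightarrow> (real \<Rightarrow> 'a \<Rightarrow> real) \<Rightarrow> bool" where
  "brownian_motion01 M B \<longleftrightarrow>
     prob_space M \<and>
     (\<forall>t\<in>{0..1}. B t \<in> borel_measurable M) \<and>
     (\<forall>\<omega>\<in>space M. B 0 \<omega> = 0) \<and>
     (\<forall>\<omega>\<in>space M. continuous_on {0..1} (\<lambda>t. B t \<omega>)) \<and>
     (\<forall>(n::nat) (u::nat \<Rightarrow> real).
        (\<forall>i\<le>n. u i \<in> {0..1}) \<and> (\<forall>i<n. u i \<le> u (Suc i)) \<longrightarrow>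
        prob_space.indep_vars M (\<lambda>_. borel) (\<lambda>i \<omega>. B (u (Suc i)) \<omega> - B (u i) \<omega>) {..<n}) \<and>
     (\<forall>s t. 0 \<le> s \<and> s < t \<and> t \<le> 1 \<longrightarrow>
        distributed M lborel (\<lambda>\<omega>. B t \<omega> - B s \<omega>)
          (\<lambda>x. ennreal (normal_density 0 (sqrt (t - s)) x)))"

definition path_max :: "(real \<Rightarrow> 'a \<Rightarrow> real) \<Rightarrow> 'a \<Rightarrow> real" where
  "path_max B \<omega> = (SUP s\<in>{0..1}. B s \<omega>)"

definition first_argmax :: "(real \<Rightarrow> 'a \<Rightarrow> real) \<Rightarrow> 'a \<Rightarrow> real" where
  "first_argmax B \<omega> = (LEAST s. s \<in> {0..1} \<and> B s \<omega> = path_max B \<omega>)"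

text \<open>
  \<open>\<kappa>\<close> is a regular conditional distribution of \<open>X\<close> (with values in \<open>S\<close>) given \<open>Y\<close> (with values
  in \<open>N\<close>): a probability kernel that disintegrates the joint law of \<open>X\<close> and \<open>Y\<close> along the law
  of \<open>Y\<close>.
\<close>

definition regular_cond_distr ::
  "'a measure \<Rightarrow> 'b measure \<Rightarrow> ('a \<Rightarrow> 'b) \<Rightarrow> 'c measure \<Rightarrow> ('a \<Rightarrow> 'c) \<Rightarrow> ('c \<Rightarrow> 'b measure) \<Rightarrow> bool"
where
  "regular_cond_distr M S X N Y \<kappa> \<longleftrightarrow>
     X \<in> measurable M S \<and> Y \<in> measurable M N \<and> \<kappa> \<in> measurable N (prob_algebra S) \<and>
     (\<forall>A\<in>sets S. \<forall>D\<in>sets N.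
        emeasure M {\<omega> \<in> space M. X \<omega> \<in> A \<and> Y \<omega> \<in> D} =
        (\<integral>\<^sup>+y\<in>D. emeasure (\<kappa> y) A \<partial>distr M N Y))"

text \<open>The parameter \<open>\<sigma>\<close> is the variance.\<close>

definition phi :: "real \<Rightarrow> real \<Rightarrow> real" where
  "phi \<sigma> x = 1 / sqrt (2 * pi * \<sigma>) * exp (- x\<^sup>2 / (2 * \<sigma>))"

definition g :: "real \<Rightarrow> real \<Rightarrow> real \<Rightarrow> real" where
  "g \<sigma> x y = phi \<sigma> (y - x) - phi \<sigma> (y + x)"

text \<open>
  Both densities are set to 0 on the null set where the argmax \<open>\<theta>\<close> equals \<open>t\<close>, and outside the
  range \<open>0 < \<theta> < 1\<close>, \<open>h > max 0 c\<close>, \<open>x < h\<close>.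
\<close>

definition cond_density :: "real \<Rightarrow> real \<Rightarrow> real \<Rightarrow> real \<Rightarrow> real \<Rightarrow> real" where
  "cond_density t c \<theta> h x =
     (if 0 < \<theta> \<and> \<theta> < 1 \<and> h > max 0 c \<and> x < h then
        if t < \<theta> then
          g t (h - x) h * ((\<theta> powr (3/2) * (h - x)) / ((\<theta> - t) powr (3/2) * h))
            * exp (h\<^sup>2 / (2 * \<theta>)) * exp (- (h - x)\<^sup>2 / (2 * (\<theta> - t)))
        else if \<theta> < t then
          g (1 - t) (h - x) (h - c)
            * (((h - x) * (1 - \<theta>) powr (3/2)) / ((h - c) * (t - \<theta>) powr (3/2)))
            * exp (- (h - x)\<^sup>2 / (2 * (t - \<theta>))) * exp ((h - c)\<^sup>2 / (2 * (1 - \<theta>)))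
        else 0
      else 0)"

definition joint_density :: "real \<Rightarrow> real \<Rightarrow> real \<Rightarrow> real \<Rightarrow> real \<Rightarrow> real" where
  "joint_density t x \<theta> h c =
     (if 0 < \<theta> \<and> \<theta> < 1 \<and> h > max 0 c \<and> x < h then
        if t < \<theta> then
          ((h - c) * (h - x)) / (pi * (1 - \<theta>) powr (3/2) * (\<theta> - t) powr (3/2))
            * g t (h - x) h
            * exp (- (h - x)\<^sup>2 / (2 * (\<theta> - t)) - (h - c)\<^sup>2 / (2 * (1 - \<theta>)))
        else if \<theta> < t then
          (h * (h - x)) / (pi * \<theta> powr (3/2) * (t - \<theta>) powr (3/2))
            * g (1 - t) (h - x) (h - c)
            * exp (- (h - x)\<^sup>2 / (2 * (t - \<theta>)) - h\<^sup>2 / (2 * \<theta>))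
        else 0
      else 0)"

end

theory Submission
  imports Defs "HOL-Real_Asymp.Real_Asymp"
begin

text \<open>
  Write \<open>M\<close> for the maximum of a Brownian increment process over an interval and \<open>Z\<close> for its end
  value. Reflecting a random walk at its first passage over a level and refining the grid gives
  \<open>P(M > h, Z \<le> z) = P(Z \<ge> 2 h - z)\<close>, hence the joint density of \<open>(M, Z)\<close>. The pairs \<open>(M, Z)\<close> of the
  intervals \<open>[0, p]\<close>, \<open>[p, q]\<close> and \<open>[q, 1]\<close> are independent, and the event \<open>p < \<theta> \<le> q\<close> says that
  the maximum over the middle interval beats the other two; so the law of \<open>(B(p), B(q), h, c)\<close> on
  that event is an explicit integral. Taking \<open>t = p\<close> or \<open>t = q\<close> and integrating out the position at
  the other endpoint must produce the integral over \<open>\<theta>\<close> of the claimed density. This follows from two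
  facts about first passage densities: they form a convolution semigroup in the level, and they are
  reproduced by the transition density of Brownian motion killed at \<open>0\<close>. The second fact also
  shows that the conditional densities have total mass \<open>1\<close>.
\<close>

text \<open>The argmax depends on the whole path, so its density cannot be read off directly. What
  can be computed is the probability that it falls between two fixed times, since this only compares
  maxima over independent pieces of the path. The time \<open>t\<close> has to be one of the two
  endpoints because the density has the value of \<open>B t\<close> as an argument; hence only the
  intervals \<open>{s<..t}\<close> and \<open>{t<..s}\<close> are available, and they must suffice
  to determine a law on the open unit interval. In terms of \<open>passage\<close> the formulas
  become transparent. The path before the maximum is a climb from 0 to \<open>h\<close>, and the
  path after it, read backwards, a climb from \<open>c\<close> to \<open>h\<close>. The density of
  (final value, argmax, maximum) is
  \<open>2 * passage h \<theta> * passage (h - c) (1 - \<theta>)\<close>; recording the position at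
  \<open>t\<close> replaces one of these factors by \<open>g\<close> times a shorter passage.
  Choosing the smallest maximiser shows up as a strict comparison with the maximum before the
  interval and a weak one with the maximum after it.\<close>

section \<open>First passage densities\<close>

text \<open>The density at time \<open>u\<close> of the first passage of a Brownian motion over the level \<open>a\<close>.\<close>

definition passage :: "real \<Rightarrow> real \<Rightarrow> real" where
  "passage a u = a / u * phi u a"

lemma phi_measurable [measurable]:
  assumes [measurable]: "f \<in> borel_measurable M" "h \<in> borel_measurable M"
  shows "(\<lambda>x. phi (f x) (h x)) \<in> borel_measurable M"
  unfolding phi_def by measurable

lemma g_measurable [measurable]:
  assumes [measurable]: "f \<in> borel_measurable M" "h \<in> borel_measurable M" "k \<in> borel_measurable M"
  shows "(\<lambda>x. g (f x) (h x) (k x)) \<in> borel_measurable M"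
  unfolding g_def by measurable

lemma passage_measurable [measurable]:
  assumes [measurable]: "f \<in> borel_measurable M" "h \<in> borel_measurable M"
  shows "(\<lambda>x. passage (f x) (h x)) \<in> borel_measurable M"
  unfolding passage_def by measurable

lemma phi_pos: "0 < \<sigma> \<Longrightarrow> 0 < phi \<sigma> x"
  by (simp add: phi_def)

lemma phi_minus [simp]: "phi \<sigma> (- x) = phi \<sigma> x"
  by (simp add: phi_def)

lemma phi_diff_commute: "phi \<sigma> (x - y) = phi \<sigma> (y - x)"
  by (simp add: phi_def power2_commute)

lemma phi_eq_normal_density: "0 < \<sigma> \<Longrightarrow> phi \<sigma> x = normal_density 0 (sqrt \<sigma>) x"
  by (simp add: phi_def normal_density_def)

lemma phi_antimono: "0 < \<sigma> \<Longrightarrow> \<bar>x\<bar> \<le> \<bar>y\<bar> \<Longrightarrow> phi \<sigma> y \<le> phi \<sigma> x"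
  by (auto simp: phi_def abs_le_square_iff intro!: divide_right_mono)

lemma g_nonneg: "0 < \<sigma> \<Longrightarrow> 0 \<le> x \<Longrightarrow> 0 \<le> y \<Longrightarrow> 0 \<le> g \<sigma> x y"
  unfolding g_def using phi_antimono[of \<sigma> "y - x" "y + x"] by simp

lemma g_commute: "g \<sigma> x y = g \<sigma> y x"
  by (simp add: g_def phi_diff_commute add.commute)

lemma passage_nonneg: "0 \<le> u \<Longrightarrow> 0 \<le> a \<Longrightarrow> 0 \<le> passage a u"
  using phi_pos[of u a] by (cases "u = 0") (auto simp: passage_def)

lemma passage_pos: "0 < u \<Longrightarrow> 0 < a \<Longrightarrow> 0 < passage a u"
  using phi_pos[of u a] by (simp add: passage_def)

lemma passage_uminus: "passage (- a) u = - passage a u"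
  by (simp add: passage_def)

lemma powr_three_halves: "0 \<le> (u::real) \<Longrightarrow> u powr (3/2) = u * sqrt u"
proof -
  assume "0 \<le> u"
  have "u powr (3/2) = u powr (1 + 1/2)" by simp
  also have "\<dots> = u powr 1 * u powr (1/2)" by (rule powr_add)
  finally show ?thesis using \<open>0 \<le> u\<close> by (simp only: powr_half_sqrt powr_one)
qed

lemma passage_powr: "0 < u \<Longrightarrow> passage a u = a / (sqrt (2 * pi) * u powr (3/2)) * exp (- a\<^sup>2 / (2 * u))"
  by (simp add: passage_def phi_def powr_three_halves real_sqrt_mult)

lemma phi_mult_phi:
  assumes "0 < u" "0 < v"
  shows "phi u a * phi v b = 1 / (2 * pi * sqrt (u * v)) * exp (- a\<^sup>2 / (2 * u) - b\<^sup>2 / (2 * v))"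
proof -
  have "exp (- a\<^sup>2 / (2 * u) - b\<^sup>2 / (2 * v)) = exp (- a\<^sup>2 / (2 * u)) * exp (- b\<^sup>2 / (2 * v))"
    by (simp add: exp_add[symmetric])
  moreover have "sqrt (2 * pi * u) * sqrt (2 * pi * v) = 2 * pi * sqrt (u * v)"
  proof -
    have "sqrt (2 * pi * u) * sqrt (2 * pi * v) = sqrt ((2 * pi)\<^sup>2 * (u * v))"
      unfolding real_sqrt_mult[symmetric] by (simp add: power2_eq_square mult_ac)
    then show ?thesis by (simp add: real_sqrt_mult)
  qed
  ultimately show ?thesis by (simp add: phi_def)
qed

text \<open>The factors \<open>sqrt (u * v)\<close> cancel the normalising constants, so an identity
  between products of two Gaussians reduces to a rational identity between exponents.\<close>

lemma phi_mult_phi_eqI: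
  assumes "0 < u" "0 < v" "0 < u'" "0 < v'"
    and "a\<^sup>2 / u + b\<^sup>2 / v = a'\<^sup>2 / u' + b'\<^sup>2 / v'"
  shows "phi u a * phi v b * sqrt (u * v) = phi u' a' * phi v' b' * sqrt (u' * v')"
proof -
  have "- a\<^sup>2 / (2 * u) - b\<^sup>2 / (2 * v) = - (a\<^sup>2 / u + b\<^sup>2 / v) / 2" for a b u v :: real
    by (simp add: field_simps add_divide_distrib)
  then show ?thesis using assms by (simp add: phi_mult_phi)
qed

text \<open>Completing the square in \<open>b\<close>. The second factor on the right is the law at
  time \<open>v\<close> of a Brownian bridge from 0 to \<open>d\<close> of length
  \<open>v + q\<close>; only its mean matters for \<open>passage_through_position\<close>.\<close>

lemma phi_convolve:
  assumes "0 < v" "0 < q"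
  shows "phi v b * phi q (b - d) = phi (v + q) d * normal_density (d * v / (v + q)) (sqrt (v * q / (v + q))) b"
proof -
  have nd: "normal_density (d * v / (v + q)) (sqrt (v * q / (v + q))) b
      = phi (v * q / (v + q)) (b - d * v / (v + q))"
    using assms by (simp add: normal_density_def phi_def)
  have "b\<^sup>2 / v + (b - d)\<^sup>2 / q = d\<^sup>2 / (v + q) + (b - d * v / (v + q))\<^sup>2 / (v * q / (v + q))"
  proof -
    have [simp]: "v + q \<noteq> 0" using assms by linarith
    have "(b - d * v / (v + q)) = (b * (v + q) - d * v) / (v + q)" by (simp add: diff_divide_distrib)
    then have "(b - d * v / (v + q))\<^sup>2 / (v * q / (v + q)) = (b * (v + q) - d * v)\<^sup>2 / (v * q * (v + q))"
      by (simp add: power_divide power2_eq_square)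
    moreover have "b\<^sup>2 / v + (b - d)\<^sup>2 / q = (b\<^sup>2 * q * (v+q) + (b-d)\<^sup>2 * v * (v+q)) / (v * q * (v+q))"
    proof -
      have "b\<^sup>2 / v = b\<^sup>2 * q * (v+q) / (v * q * (v+q))" "(b - d)\<^sup>2 / q = (b-d)\<^sup>2 * v * (v+q) / (v * q * (v+q))"
        using assms by simp_all
      then show ?thesis by (simp add: add_divide_distrib)
    qed
    moreover have "d\<^sup>2 / (v + q) = d\<^sup>2 * v * q / (v * q * (v+q))" using assms by simp
    moreover have "b\<^sup>2 * q * (v+q) + (b-d)\<^sup>2 * v * (v+q) = d\<^sup>2 * v * q + (b * (v + q) - d * v)\<^sup>2"
      by (simp add: power2_eq_square algebra_simps)
    ultimately show ?thesis by (simp add: add_divide_distrib)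
  qed
  from phi_mult_phi_eqI[OF _ _ _ _ this] assms
  have "phi v b * phi q (b - d) * sqrt (v * q) =
     phi (v + q) d * phi (v * q / (v + q)) (b - d * v / (v + q)) * sqrt (v * q)"
    by (simp add: add_pos_pos mult_pos_pos)
  then show ?thesis unfolding nd using assms by simp
qed

text \<open>The integrand is even in \<open>b\<close>, so half a line of \<open>g\<close> unfolds to a full Gaussian convolution.\<close>

lemma passage_through_position:
  assumes "0 < v" "0 < q" "0 < d"
  shows "(\<integral>\<^sup>+b. ennreal (indicator {0<..} b * (passage b v * g q d b)) \<partial>lborel) = ennreal (passage d (v + q))"
proof -
  define k where "k b = passage b v * phi q (b - d)" for b
  have k: "k b = phi (v + q) d / v * (normal_density (d * v / (v + q)) (sqrt (v * q / (v + q))) b * b)" for b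
  proof -
    have "k b = b / v * (phi v b * phi q (b - d))" by (simp add: k_def passage_def)
    then show ?thesis using assms by (simp add: phi_convolve)
  qed
  \<comment> \<open>What is left to integrate is the bridge position itself, so the integral is the
    mean \<open>d * v / (v + q)\<close> times the constant in front.\<close>
  have "has_bochner_integral lborel k (phi (v + q) d / v * (d * v / (v + q)))"
    unfolding k using assms by (intro has_bochner_integral_mult_right normal_moment_nz_1) auto
  also have "phi (v + q) d / v * (d * v / (v + q)) = passage d (v + q)"
    using assms by (simp add: passage_def)
  finally have int: "integrable lborel k" and Ik: "integral\<^sup>L lborel k = passage d (v + q)"
    by (auto simp: has_bochner_integral_iff)
  have [measurable]: "k \<in> borel_measurable borel" using int by auto
  \<comment> \<open>\<open>passage\<close> is odd in the level and \<open>phi\<close> is even: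
    folding the line at 0 produces the reflected term of \<open>g\<close> together with its minus
    sign.\<close>
  have k': "k (- b) = - passage b v * phi q (b + d)" for b
    using phi_minus[of q "b + d"] by (simp add: k_def passage_uminus)
  have kk: "k b + k (- b) = passage b v * g q d b" for b
    unfolding k' unfolding k_def g_def by (simp add: algebra_simps)
  have intm: "integrable lborel (\<lambda>b. k (- b))"
    using lborel_integrable_real_affine[OF int, of "-1" 0] by simp
  have i1: "integrable lborel (\<lambda>b. indicator {0<..} b * k b)"
    using integrable_mult_indicator[OF _ int, of "{0<..}"] by simp
  have i2: "integrable lborel (\<lambda>b. indicator {..<0} b * k b)"
    using integrable_mult_indicator[OF _ int, of "{..<0}"] by simp
  have i3: "integrable lborel (\<lambda>b. indicator {0<..} b * k (- b))"
    using integrable_mult_indicator[OF _ intm, of "{0<..}"] by simp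
  have "integral\<^sup>L lborel k = (\<integral>b. indicator {0<..} b * k b + indicator {..<0} b * k b \<partial>lborel)"
    by (intro integral_cong_AE) (auto simp: k_def passage_def split: split_indicator intro!: AE_I2)
  also have "\<dots> = (\<integral>b. indicator {0<..} b * k b \<partial>lborel) + (\<integral>b. indicator {..<0} b * k b \<partial>lborel)"
    using i1 i2 by simp
  also have "(\<integral>b. indicator {..<0} b * k b \<partial>lborel) = (\<integral>b. indicator {0<..} b * k (- b) \<partial>lborel)"
    by (subst lborel_integral_real_affine[of "-1" _ 0])
       (auto intro!: Bochner_Integration.integral_cong split: split_indicator)
  also have "(\<integral>b. indicator {0<..} b * k b \<partial>lborel) + \<dots> =
      (\<integral>b. indicator {0<..} b * k b + indicator {0<..} b * k (- b) \<partial>lborel)"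
    using i1 i3 by simp
  also have "(\<lambda>b. indicator {0<..} b * k b + indicator {0<..} b * k (- b)) =
      (\<lambda>b. indicator {0<..} b * (passage b v * g q d b))"
    by (simp_all add: fun_eq_iff kk distrib_left[symmetric])
  finally have eq: "(\<integral>b. indicator {0<..} b * (passage b v * g q d b) \<partial>lborel) = passage d (v + q)"
    using Ik by simp
  have "integrable lborel (\<lambda>b. indicator {0<..} b * (passage b v * g q d b))"
    using Bochner_Integration.integrable_add[OF i1 i3]
    by (rule Bochner_Integration.integrable_cong[THEN iffD1, rotated -1])
       (simp_all add: fun_eq_iff kk distrib_left[symmetric])
  then show ?thesis
    using eq assms by (subst nn_integral_eq_integral)
      (auto split: split_indicator intro!: mult_nonneg_nonneg passage_nonneg g_nonneg)
qed

section \<open>The normal distribution function and the convolution of passage densities\<close>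

definition Phi :: "real \<Rightarrow> real" where
  "Phi = cdf (density lborel (\<lambda>x. ennreal (std_normal_density x)))"

lemma prob_space_std_normal: "prob_space (density lborel (\<lambda>x. ennreal (std_normal_density x)))"
  using prob_space_normal_density[of 1 0] by simp

lemma real_distribution_std_normal: "real_distribution (density lborel (\<lambda>x. ennreal (std_normal_density x)))"
  using prob_space_std_normal by (simp add: real_distribution_def real_distribution_axioms_def)

lemma Phi_at_top: "(Phi \<longlongrightarrow> 1) at_top"
  unfolding Phi_def by (intro real_distribution.cdf_lim_at_top_prob real_distribution_std_normal)

lemma Phi_at_bot: "(Phi \<longlongrightarrow> 0) at_bot"
  unfolding Phi_def
  by (intro finite_borel_measure.cdf_lim_at_bot real_distribution.finite_borel_measure_M real_distribution_std_normal)

lemma phi_1: "phi 1 x = std_normal_density x"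
  by (simp add: phi_def std_normal_density_def)

lemma continuous_on_phi_1: "continuous_on A (phi 1)"
  unfolding phi_def[abs_def] by (intro continuous_intros) auto

lemma Phi_diff: "a < b \<Longrightarrow> Phi b - Phi a = integral {a..b} (phi 1)"
proof -
  assume "a < b"
  interpret real_distribution "density lborel (\<lambda>x. ennreal (std_normal_density x))"
    by (rule real_distribution_std_normal)
  have i: "integrable lborel (\<lambda>x. indicator {a..b} x * phi 1 x)"
    using integrable_mult_indicator[OF _ integrable_normal_density[of 1 0], of "{a..b}"] by (simp add: phi_1)
  have si: "set_integrable lborel {a..b} (phi 1)" using i by (simp add: set_integrable_def)
  have "Phi b - Phi a = measure (density lborel (\<lambda>x. ennreal (std_normal_density x))) {a<..b}"
    unfolding Phi_def by (rule cdf_diff_eq) fact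
  also have "\<dots> = (\<integral>x. indicator {a<..b} x * phi 1 x \<partial>lborel)"
  proof -
    have i': "integrable lborel (\<lambda>x. indicator {a<..b} x * phi 1 x)"
      using integrable_mult_indicator[OF _ integrable_normal_density[of 1 0], of "{a<..b}"] by (simp add: phi_1)
    have "emeasure (density lborel (\<lambda>x. ennreal (std_normal_density x))) {a<..b} =
        (\<integral>\<^sup>+x. ennreal (indicator {a<..b} x * phi 1 x) \<partial>lborel)"
      by (subst emeasure_density) (auto intro!: nn_integral_cong simp: phi_1 split: split_indicator)
    also have "\<dots> = ennreal (\<integral>x. indicator {a<..b} x * phi 1 x \<partial>lborel)"
      by (rule nn_integral_eq_integral[OF i']) (simp add: phi_1)
    finally show ?thesis by (simp add: measure_def phi_1)
  qed
  also have "\<dots> = (\<integral>x. indicator {a..b} x * phi 1 x \<partial>lborel)"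
    using AE_lborel_singleton[of a]
    by (intro integral_cong_AE) (auto simp: split: split_indicator)
  also have "\<dots> = integral {a..b} (phi 1)"
    using set_borel_integral_eq_integral(2)[OF si] by (simp add: set_lebesgue_integral_def)
  finally show ?thesis .
qed

lemma Phi_deriv: "(Phi has_real_derivative phi 1 x) (at x)"
proof -
  \<comment> \<open>Starting the integral at \<open>x - 1\<close> puts \<open>x\<close> in the
    interior of the interval, so the derivative is two-sided.\<close>
  have "((\<lambda>u. integral {x-1..u} (phi 1)) has_real_derivative phi 1 x) (at x within {x-1..x+1})"
    by (rule integral_has_real_derivative[OF continuous_on_phi_1]) auto
  then have "((\<lambda>u. integral {x-1..u} (phi 1)) has_real_derivative phi 1 x) (at x)"
    by (subst (asm) at_within_interior) auto
  then have "((\<lambda>u. integral {x-1..u} (phi 1) + Phi (x-1)) has_real_derivative phi 1 x) (at x)"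
    by (auto intro!: derivative_eq_intros)
  then show ?thesis
    by (rule DERIV_cong_ev[THEN iffD1, OF refl _ refl, rotated -1])
      (auto simp: eventually_nhds Phi_diff[symmetric] intro!: exI[of _ "{x-1<..}"])
qed

text \<open>
  With \<open>w = u (r - u)\<close>, both \<open>(a (r - u) \<plusminus> b u) / sqrt (r w)\<close> complete the square of
  \<open>a\<^sup>2 / u + b\<^sup>2 / (r - u)\<close>, leaving \<open>(a \<minusplus> b)\<^sup>2 / r\<close>; the derivatives of the two resulting
  normal distribution functions combine to the integrand.
\<close>

lemma passage_convolve:
  assumes [arith]: "0 < a" "0 < b" "0 < r"
  shows "(\<integral>\<^sup>+u. ennreal (indicator {0<..<r} u * (passage a u * passage b (r - u))) \<partial>lborel) = ennreal (passage (a + b) r)"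
proof -
  define y where "y c u = (a * (r - u) - c * u) / sqrt (r * (u * (r - u)))" for c u
  \<comment> \<open>The weights \<open>passage (a - b) r\<close> and
    \<open>passage (a + b) r\<close> are the ones for which, by \<open>gauss\<close>, both
    derivatives carry the common factor \<open>phi u a * phi (r - u) b\<close>.\<close>
  define F where "F u = passage (a - b) r * Phi (y (- b) u) - passage (a + b) r * Phi (y b u)" for u
  define f where "f u = passage a u * passage b (r - u)" for u
  have y': "(y c has_real_derivative - (r\<^sup>2 / 2) * (a * (r - u) + c * u) / (r * (u * (r - u)) * sqrt (r * (u * (r - u))))) (at u)"
    if [arith]: "0 < u" "u < r" for c u
  proof -
    define w where "w = r * (u * (r - u))"
    have w: "w > 0" by (simp add: w_def)
    have "(y c has_real_derivative
        ((- a - c) * sqrt w - (a * (r - u) - c * u) * (inverse (sqrt w) / 2 * (r * (r - 2 * u)))) / (sqrt w * sqrt w)) (at u)"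
      unfolding y_def[abs_def] using w unfolding w_def
      by (intro DERIV_divide DERIV_chain2[OF DERIV_real_sqrt])
        (auto intro!: derivative_eq_intros simp: algebra_simps)
    moreover have "((- a - c) * sqrt w - (a * (r - u) - c * u) * (inverse (sqrt w) / 2 * (r * (r - 2 * u)))) / (sqrt w * sqrt w)
        = ((- a - c) * (2 * w) - (a * (r - u) - c * u) * (r * (r - 2 * u))) / (2 * w * sqrt w)"
    proof -
      \<comment> \<open>Writing \<open>w\<close> as \<open>s * s\<close> makes the identity rational
        in \<open>s\<close>.\<close>
      obtain s where "sqrt w = s" "w = s * s" "s > 0" using w by (metis real_sqrt_gt_zero real_sqrt_mult_self abs_of_pos)
      then show ?thesis by (simp add: field_simps)
    qed
    moreover have "(- a - c) * (2 * w) - (a * (r - u) - c * u) * (r * (r - 2 * u)) = - r\<^sup>2 * (a * (r - u) + c * u)"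
      unfolding w_def by (simp add: power2_eq_square algebra_simps)
    ultimately show ?thesis unfolding w_def by (simp add: mult.assoc)
  qed
  have gauss: "phi r (a + c) * phi 1 (y c u) = phi u a * phi (r - u) c * sqrt (u * (r - u)) / sqrt r"
    if [arith]: "0 < u" "u < r" for c u
  proof -
    have "(a + c)\<^sup>2 / r + (y c u)\<^sup>2 / 1 = ((a + c)\<^sup>2 * (u * (r - u)) + (a * (r - u) - c * u)\<^sup>2) / (r * (u * (r - u)))"
      by (simp add: y_def power_divide add_divide_distrib)
    also have "(a + c)\<^sup>2 * (u * (r - u)) + (a * (r - u) - c * u)\<^sup>2 = r * (a\<^sup>2 * (r - u) + c\<^sup>2 * u)"
      by (simp add: power2_eq_square algebra_simps)
    also have "\<dots> / (r * (u * (r - u))) = a\<^sup>2 / u + c\<^sup>2 / (r - u)"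
      by (simp add: field_simps)
    finally have "phi r (a + c) * phi 1 (y c u) * sqrt (r * 1) = phi u a * phi (r - u) c * sqrt (u * (r - u))"
      by (intro phi_mult_phi_eqI) auto
    then show ?thesis by (simp add: field_simps)
  qed
  have summand: "passage (a + c) r * (phi 1 (y c u) * (- (r\<^sup>2 / 2) * (a * (r - u) + c * u) / (r * (u * (r - u)) * sqrt (r * (u * (r - u))))))
      = - (a + c) * (a * (r - u) + c * u) * (phi u a * phi (r - u) c) / (2 * r * (u * (r - u)))"
    if [arith]: "0 < u" "u < r" for c u
  proof -
    define w where "w = u * (r - u)"
    have w: "w > 0" by (simp add: w_def)
    have "passage (a + c) r * (phi 1 (y c u) * (- (r\<^sup>2 / 2) * (a * (r - u) + c * u) / (r * w * sqrt (r * w))))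
       = (phi r (a + c) * phi 1 (y c u)) * ((a + c) * (- (r\<^sup>2 / 2) * (a * (r - u) + c * u)) / (r * (r * w * sqrt (r * w))))"
      by (simp add: passage_def mult_ac)
    also have "\<dots> = - (a + c) * (a * (r - u) + c * u) * (phi u a * phi (r - u) c) / (2 * r * w)"
      unfolding gauss[OF that] w_def[symmetric] using w
      by (simp add: real_sqrt_mult divide_simps) (simp add: power2_eq_square algebra_simps)
    finally show ?thesis unfolding w_def .
  qed
  have F': "(F has_real_derivative f u) (at u)" if [arith]: "0 < u" "u < r" for u
  proof -
    have "(F has_real_derivative
       (passage (a - b) r * (phi 1 (y (-b) u) * (- (r\<^sup>2 / 2) * (a * (r - u) + (-b) * u) / (r * (u * (r - u)) * sqrt (r * (u * (r - u)))))) -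
        passage (a + b) r * (phi 1 (y b u) * (- (r\<^sup>2 / 2) * (a * (r - u) + b * u) / (r * (u * (r - u)) * sqrt (r * (u * (r - u)))))))) (at u)"
      unfolding F_def[abs_def]
      by (intro DERIV_diff DERIV_cmult DERIV_chain2[OF Phi_deriv] y' that)
    also have "(passage (a - b) r * (phi 1 (y (-b) u) * (- (r\<^sup>2 / 2) * (a * (r - u) + (-b) * u) / (r * (u * (r - u)) * sqrt (r * (u * (r - u)))))) -
        passage (a + b) r * (phi 1 (y b u) * (- (r\<^sup>2 / 2) * (a * (r - u) + b * u) / (r * (u * (r - u)) * sqrt (r * (u * (r - u))))))) =
       ((a + b) * (a * (r - u) + b * u) - (a - b) * (a * (r - u) - b * u)) * (phi u a * phi (r - u) b) / (2 * r * (u * (r - u)))"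
    proof -
      have eq: "P - Q = (v * w - x * y) * z / k" if "P = - x * y * z / k" "Q = - v * w * z / k" for P Q x y z k v w :: real
        using that by (simp add: left_diff_distrib diff_divide_distrib)
      show ?thesis
        using summand[OF that, of "- b"] by (intro eq summand[OF that]) simp
    qed
    \<comment> \<open>The squares of \<open>a\<close> and \<open>b\<close> cancel and the mixed
      terms add up, which yields the product of the two levels in the integrand.\<close>
    also have "(a + b) * (a * (r - u) + b * u) - (a - b) * (a * (r - u) - b * u) = 2 * r * (a * b)"
      by (simp add: algebra_simps)
    also have "2 * r * (a * b) * (phi u a * phi (r - u) b) / (2 * r * (u * (r - u))) = f u"
      by (simp add: f_def passage_def)
    finally show ?thesis .
  qed
  \<comment> \<open>At 0 both arguments of \<open>Phi\<close> tend to infinity. At \<open>r\<close>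
    they tend to opposite infinities, so only the first term of \<open>F\<close> survives there and
    the difference of the limits is \<open>passage (a + b) r\<close>.\<close>
  have y0: "filterlim (y c) at_top (at_right 0)" for c
    unfolding y_def[abs_def] by real_asymp
  have yr: "filterlim (y b) at_bot (at_left r)"
    unfolding y_def[abs_def] by real_asymp
  have yr': "filterlim (y (- b)) at_top (at_left r)"
    unfolding y_def[abs_def] by real_asymp
  have "(F \<longlongrightarrow> passage (a - b) r * 1 - passage (a + b) r * 1) (at_right 0)"
    unfolding F_def[abs_def] by (intro tendsto_intros filterlim_compose[OF Phi_at_top] y0)
  then have L0: "((F \<circ> real_of_ereal) \<longlongrightarrow> passage (a - b) r - passage (a + b) r) (at_right 0)"
    unfolding zero_ereal_def by (simp add: ereal_tendsto_simps)
  have "(F \<longlongrightarrow> passage (a - b) r * 1 - passage (a + b) r * 0) (at_left r)"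
    unfolding F_def[abs_def]
    by (intro tendsto_intros filterlim_compose[OF Phi_at_top] filterlim_compose[OF Phi_at_bot] yr yr')
  then have Lr: "((F \<circ> real_of_ereal) \<longlongrightarrow> passage (a - b) r) (at_left (ereal r))"
    by (simp add: ereal_tendsto_simps)
  have cont: "isCont f u" if "0 < u" "u < r" for u
    unfolding f_def[abs_def] passage_def[abs_def] phi_def[abs_def] using that by (intro continuous_intros) auto
  have nonneg: "0 \<le> f u" if "0 < u" "u < r" for u
    using that by (auto simp: f_def intro!: mult_nonneg_nonneg passage_nonneg)
  note FTC = interval_integral_FTC_nonneg[of 0 "ereal r" F f, OF _ _ _ _ L0 Lr]
  have si: "set_integrable lborel (einterval 0 (ereal r)) f"
    by (rule FTC) (auto intro!: F' cont nonneg)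
  have I: "(LBINT x=0..ereal r. f x) = passage (a - b) r - (passage (a - b) r - passage (a + b) r)"
    by (rule FTC) (auto intro!: F' cont nonneg)
  have e: "einterval 0 (ereal r) = {0<..<r}" by (auto simp: einterval_def)
  have I': "(\<integral>u. indicator {0<..<r} u * f u \<partial>lborel) = passage (a + b) r"
    using I by (simp add: interval_lebesgue_integral_def e set_lebesgue_integral_def)
  have i: "integrable lborel (\<lambda>u. indicator {0<..<r} u * f u)"
    using si by (simp add: set_integrable_def e)
  show ?thesis
    using nn_integral_eq_integral[OF i] I' nonneg
    by (simp add: f_def indicator_def)
qed

text \<open>
  Decompose the passage over the distance \<open>a + b\<close> at the first passage over \<open>a\<close>, at time \<open>u\<close>;
  averaging the remaining passage over \<open>b\<close> turns it into a passage over \<open>d\<close>.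
\<close>

lemma passage_sum_g_integral:
  assumes [arith]: "0 < a" "0 < d" "0 < r" "0 < q"
  shows "(\<integral>\<^sup>+b. ennreal (indicator {0<..} b * (passage (a + b) r * g q d b)) \<partial>lborel) =
    (\<integral>\<^sup>+u. ennreal (indicator {0<..<r} u * (passage a u * passage d (r + q - u))) \<partial>lborel)"
proof -
  have "(\<integral>\<^sup>+b. ennreal (indicator {0<..} b * (passage (a + b) r * g q d b)) \<partial>lborel) =
     (\<integral>\<^sup>+b. \<integral>\<^sup>+u. ennreal (indicator {0<..} b * indicator {0<..<r} u * (passage a u * passage b (r - u) * g q d b)) \<partial>lborel \<partial>lborel)"
  proof (intro nn_integral_cong)
    fix b :: real
    show "ennreal (indicator {0<..} b * (passage (a + b) r * g q d b)) =
       (\<integral>\<^sup>+u. ennreal (indicator {0<..} b * indicator {0<..<r} u * (passage a u * passage b (r - u) * g q d b)) \<partial>lborel)"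
    proof (cases "b > 0")
      case [arith]: True
      have "(\<integral>\<^sup>+u. ennreal (indicator {0<..} b * indicator {0<..<r} u * (passage a u * passage b (r - u) * g q d b)) \<partial>lborel)
        = (\<integral>\<^sup>+u. ennreal (indicator {0<..<r} u * (passage a u * passage b (r - u))) * ennreal (g q d b) \<partial>lborel)"
      proof (intro nn_integral_cong)
        fix u
        show "ennreal (indicator {0<..} b * indicator {0<..<r} u * (passage a u * passage b (r - u) * g q d b)) =
          ennreal (indicator {0<..<r} u * (passage a u * passage b (r - u))) * ennreal (g q d b)"
          unfolding ennreal_mult''[OF g_nonneg[of q d b], simplified, symmetric] by (simp add: mult_ac)
      qed
      also have "\<dots> = ennreal (passage (a + b) r) * ennreal (g q d b)"
        by (subst nn_integral_multc) (simp_all add: passage_convolve)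
      finally show ?thesis using g_nonneg[of q d b] by (simp add: ennreal_mult'')
    qed simp
  qed
  also have "\<dots> = (\<integral>\<^sup>+u. \<integral>\<^sup>+b. ennreal (indicator {0<..} b * indicator {0<..<r} u * (passage a u * passage b (r - u) * g q d b)) \<partial>lborel \<partial>lborel)"
    by (rule lborel_pair.Fubini') (simp add: case_prod_unfold)
  also have "\<dots> = (\<integral>\<^sup>+u. ennreal (indicator {0<..<r} u * (passage a u * passage d (r + q - u))) \<partial>lborel)"
  proof (intro nn_integral_cong)
    fix u :: real
    show "(\<integral>\<^sup>+b. ennreal (indicator {0<..} b * indicator {0<..<r} u * (passage a u * passage b (r - u) * g q d b)) \<partial>lborel)
       = ennreal (indicator {0<..<r} u * (passage a u * passage d (r + q - u)))"
    proof (cases "u \<in> {0<..<r}")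
      case True
      then have [arith]: "0 < u" "u < r" by auto
      have "(\<integral>\<^sup>+b. ennreal (indicator {0<..} b * indicator {0<..<r} u * (passage a u * passage b (r - u) * g q d b)) \<partial>lborel)
         = (\<integral>\<^sup>+b. ennreal (passage a u) * ennreal (indicator {0<..} b * (passage b (r - u) * g q d b)) \<partial>lborel)"
        using passage_nonneg[of u a] True
        by (intro nn_integral_cong) (auto simp: ennreal_mult'[symmetric] mult_ac)
      also have "\<dots> = ennreal (passage a u) * ennreal (passage d (r - u + q))"
        by (subst nn_integral_cmult) (simp_all add: passage_through_position)
      finally show ?thesis using True passage_nonneg[of u a] by (simp add: ennreal_mult'[symmetric] algebra_simps)
    qed simp
  qed
  finally show ?thesis .
qed

section \<open>The reflection principle\<close>

context prob_space
begin

text \<open>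
  Whether the first passage over \<open>h\<close> happens at step \<open>k\<close> is independent of the walk after step \<open>k\<close>,
  so the part of the walk after the first passage can be reflected.
\<close>

lemma walk_reflection:
  fixes X :: "nat \<Rightarrow> 'a \<Rightarrow> real"
  assumes ind: "indep_vars (\<lambda>_. borel) X {..<N}"
    and sym: "\<And>k. k \<le> N \<Longrightarrow>
      distr M borel (\<lambda>\<omega>. \<Sum>i\<in>{k..<N}. X i \<omega>) = distr M borel (\<lambda>\<omega>. - (\<Sum>i\<in>{k..<N}. X i \<omega>))"
    and "k \<le> N"
  defines "S \<equiv> \<lambda>k \<omega>. \<Sum>i<k. X i \<omega>"
  shows "prob {\<omega>\<in>space M. S k \<omega> > h \<and> (\<forall>j<k. S j \<omega> \<le> h) \<and> S N \<omega> \<le> z} =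
    prob {\<omega>\<in>space M. S k \<omega> > h \<and> (\<forall>j<k. S j \<omega> \<le> h) \<and> 2 * S k \<omega> - z \<le> S N \<omega>}"
proof -
  let ?F = "\<lambda>x. \<lambda>j\<in>{..k}. (\<Sum>i<j. x i :: real)"
  let ?R = "\<lambda>\<omega>. \<Sum>i\<in>{k..<N}. X i \<omega>"
  let ?V = "\<lambda>\<omega>. \<lambda>j\<in>{..k}. S j \<omega>"
  \<comment> \<open>\<open>indep_var\<close> compares two variables of one type, so the real sum
    after step \<open>k\<close> is wrapped as a function on \<open>{0}\<close> to match the tuple of
    partial sums.\<close>
  define e where "e x = (\<lambda>j\<in>{0::nat}. x)" for x :: real
  have e[measurable]: "e \<in> measurable borel (PiM {0} (\<lambda>_. borel))"
    unfolding e_def by (intro measurable_restrict) auto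
  have X[measurable]: "X i \<in> borel_measurable M" if "i < N" for i
    using ind that by (auto simp: indep_vars_def)
  have mS: "S j \<in> borel_measurable M" if "j \<le> N" for j
    unfolding S_def using that by (intro borel_measurable_sum X) auto
  have mR: "?R \<in> borel_measurable M"
    by (intro borel_measurable_sum X) auto
  have "indep_var (PiM {..<k} (\<lambda>_. borel)) (\<lambda>\<omega>. restrict (\<lambda>i. X i \<omega>) {..<k})
      (PiM {k..<N} (\<lambda>_. borel)) (\<lambda>\<omega>. restrict (\<lambda>i. X i \<omega>) {k..<N})"
    using \<open>k \<le> N\<close> by (intro indep_var_restrict[OF ind]) auto
  note indep_var_compose[OF this, of ?F "PiM {..k} (\<lambda>_. borel)" _ "PiM {0} (\<lambda>_. borel)"]
  note indep = this[of "\<lambda>x. e (\<Sum>i\<in>{k..<N}. x i)"] this[of "\<lambda>x. e (- (\<Sum>i\<in>{k..<N}. x i))"]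
  have "?F \<circ> (\<lambda>\<omega>. restrict (\<lambda>i. X i \<omega>) {..<k}) = ?V"
    by (auto simp: fun_eq_iff S_def intro!: sum.cong)
  moreover have "(\<lambda>x. e (\<Sum>i\<in>{k..<N}. x i)) \<circ> (\<lambda>\<omega>. restrict (\<lambda>i. X i \<omega>) {k..<N}) = (\<lambda>\<omega>. e (?R \<omega>))"
    "(\<lambda>x. e (- (\<Sum>i\<in>{k..<N}. x i))) \<circ> (\<lambda>\<omega>. restrict (\<lambda>i. X i \<omega>) {k..<N}) = (\<lambda>\<omega>. e (- ?R \<omega>))"
  proof -
    have "(\<Sum>i\<in>{k..<N}. restrict (\<lambda>i. X i \<omega>) {k..<N} i) = ?R \<omega>" for \<omega> by (intro sum.cong) auto
    then show "(\<lambda>x. e (\<Sum>i\<in>{k..<N}. x i)) \<circ> (\<lambda>\<omega>. restrict (\<lambda>i. X i \<omega>) {k..<N}) = (\<lambda>\<omega>. e (?R \<omega>))"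
      "(\<lambda>x. e (- (\<Sum>i\<in>{k..<N}. x i))) \<circ> (\<lambda>\<omega>. restrict (\<lambda>i. X i \<omega>) {k..<N}) = (\<lambda>\<omega>. e (- ?R \<omega>))"
      by (simp_all only: comp_def)
  qed
  moreover have "?F \<in> measurable (PiM {..<k} (\<lambda>_. borel)) (PiM {..k} (\<lambda>_. borel))"
    by (auto intro!: measurable_restrict borel_measurable_sum measurable_component_singleton)
  moreover have "(\<lambda>x. \<Sum>i\<in>{k..<N}. x i) \<in> borel_measurable (PiM {k..<N} (\<lambda>_. borel :: real measure))"
    by (auto intro!: borel_measurable_sum measurable_component_singleton)
  ultimately have
    "indep_var (PiM {..k} (\<lambda>_. borel)) ?V (PiM {0} (\<lambda>_. borel)) (\<lambda>\<omega>. e (?R \<omega>))"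
    "indep_var (PiM {..k} (\<lambda>_. borel)) ?V (PiM {0} (\<lambda>_. borel)) (\<lambda>\<omega>. e (- ?R \<omega>))"
    using indep by auto
  moreover have "distr M (PiM {0} (\<lambda>_. borel)) (\<lambda>\<omega>. e (?R \<omega>)) = distr M (PiM {0} (\<lambda>_. borel)) (\<lambda>\<omega>. e (- ?R \<omega>))"
    using arg_cong[OF sym[OF \<open>k \<le> N\<close>], of "\<lambda>D. distr D (PiM {0} (\<lambda>_. borel)) e"] mR
    by (simp add: distr_distr comp_def)
  \<comment> \<open>Both joint laws are products of the same marginals, by independence and symmetry
    of the later part.\<close>
  ultimately have eq: "distr M (PiM {..k} (\<lambda>_. borel) \<Otimes>\<^sub>M PiM {0} (\<lambda>_. borel)) (\<lambda>\<omega>. (?V \<omega>, e (?R \<omega>))) =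
      distr M (PiM {..k} (\<lambda>_. borel) \<Otimes>\<^sub>M PiM {0} (\<lambda>_. borel)) (\<lambda>\<omega>. (?V \<omega>, e (- ?R \<omega>)))"
    by (simp add: indep_var_distribution_eq)
  have mV: "?V \<in> measurable M (PiM {..k} (\<lambda>_. borel))"
    using \<open>k \<le> N\<close> by (intro measurable_restrict mS) auto
  define A where "A = {y \<in> space (PiM {..k} (\<lambda>_. borel :: real measure) \<Otimes>\<^sub>M PiM {0::nat} (\<lambda>_. borel :: real measure)).
     fst y k > h \<and> (\<forall>j\<in>{..<k}. fst y j \<le> h) \<and> fst y k + snd y 0 \<le> z}"
  have comp: "(\<lambda>y. fst y j) \<in> borel_measurable (PiM {..k} (\<lambda>_. borel :: real measure) \<Otimes>\<^sub>M PiM {0::nat} (\<lambda>_. borel :: real measure))"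
    if "j \<le> k" for j
    by (rule measurable_compose[OF measurable_fst measurable_component_singleton]) (use that in auto)
  have comp': "(\<lambda>y. snd y 0) \<in> borel_measurable (PiM {..k} (\<lambda>_. borel :: real measure) \<Otimes>\<^sub>M PiM {0::nat} (\<lambda>_. borel :: real measure))"
    by (rule measurable_compose[OF measurable_snd measurable_component_singleton]) auto
  have A: "A \<in> sets (PiM {..k} (\<lambda>_. borel) \<Otimes>\<^sub>M PiM {0} (\<lambda>_. borel))"
    unfolding A_def
    by (intro sets.sets_Collect_conj sets.sets_Collect_finite_All borel_measurable_less borel_measurable_le
        borel_measurable_add borel_measurable_const comp comp') auto
  have SN: "S N \<omega> = S k \<omega> + ?R \<omega>" for \<omega>
    unfolding S_def using \<open>k \<le> N\<close> by (simp add: lessThan_atLeast0 sum.atLeastLessThan_concat)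
  have "{\<omega>\<in>space M. S k \<omega> > h \<and> (\<forall>j<k. S j \<omega> \<le> h) \<and> S N \<omega> \<le> z} = (\<lambda>\<omega>. (?V \<omega>, e (?R \<omega>))) -` A \<inter> space M"
    by (auto simp: A_def SN e_def space_pair_measure space_PiM)
  then have "prob {\<omega>\<in>space M. S k \<omega> > h \<and> (\<forall>j<k. S j \<omega> \<le> h) \<and> S N \<omega> \<le> z} =
      measure (distr M (PiM {..k} (\<lambda>_. borel) \<Otimes>\<^sub>M PiM {0} (\<lambda>_. borel)) (\<lambda>\<omega>. (?V \<omega>, e (?R \<omega>)))) A"
    using mV mR A by (subst measure_distr) auto
  also have "\<dots> = prob ((\<lambda>\<omega>. (?V \<omega>, e (- ?R \<omega>))) -` A \<inter> space M)"
    unfolding eq using mV mR A by (subst measure_distr) auto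
  \<comment> \<open>With the later part negated the end value is \<open>S k - ?R\<close>, that is
    \<open>2 * S k - S N\<close>; it is at most \<open>z\<close> exactly if
    \<open>2 * S k - z \<le> S N\<close>.\<close>
  also have "(\<lambda>\<omega>. (?V \<omega>, e (- ?R \<omega>))) -` A \<inter> space M =
      {\<omega>\<in>space M. S k \<omega> > h \<and> (\<forall>j<k. S j \<omega> \<le> h) \<and> 2 * S k \<omega> - z \<le> S N \<omega>}"
    by (auto simp: A_def SN e_def space_pair_measure space_PiM)
  finally show ?thesis .
qed

text \<open>A walk jumps over the level \<open>h\<close>, so reflection at the first passage uses
  \<open>S k\<close> in place of \<open>h\<close>. Since \<open>S k\<close> exceeds
  \<open>h\<close>, replacing it by \<open>h\<close> gives the upper bound. The overshoot is at most
  the last step, hence at most \<open>\<epsilon>\<close> unless some step is larger; this gives the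
  lower bound.\<close>

lemma walk_reflection_bounds:
  fixes X :: "nat \<Rightarrow> 'a \<Rightarrow> real"
  assumes ind: "indep_vars (\<lambda>_. borel) X {..<N}"
    and sym: "\<And>k. k \<le> N \<Longrightarrow>
      distr M borel (\<lambda>\<omega>. \<Sum>i\<in>{k..<N}. X i \<omega>) = distr M borel (\<lambda>\<omega>. - (\<Sum>i\<in>{k..<N}. X i \<omega>))"
    and "z \<le> h" "0 \<le> h" "0 < \<epsilon>"
  defines "S \<equiv> \<lambda>k \<omega>. \<Sum>i<k. X i \<omega>"
  defines "U \<equiv> {\<omega>\<in>space M. (\<exists>k\<le>N. S k \<omega> > h) \<and> S N \<omega> \<le> z}"
  shows "prob U \<le> prob {\<omega>\<in>space M. 2 * h - z \<le> S N \<omega>}" (is ?th1)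
    and "prob {\<omega>\<in>space M. 2 * h - z + 2 * \<epsilon> \<le> S N \<omega>} \<le> prob U + prob {\<omega>\<in>space M. \<exists>k<N. X k \<omega> > \<epsilon>}" (is ?th2)
proof -
  have X[measurable]: "X i \<in> borel_measurable M" if "i < N" for i
    using ind that by (auto simp: indep_vars_def)
  have mS: "S j \<in> borel_measurable M" if "j \<le> N" for j
    unfolding S_def using that by (intro borel_measurable_sum X) auto
  define T where "T k \<omega> \<longleftrightarrow> S k \<omega> > h \<and> (\<forall>j<k. S j \<omega> \<le> h)" for k \<omega>
  have T: "{\<omega>\<in>space M. T k \<omega>} \<in> events" if "k \<le> N" for k
  proof -
    have *: "(\<forall>j<k. S j \<omega> \<le> h) \<longleftrightarrow> (\<forall>j\<in>{..<k}. S j \<omega> \<le> h)" for \<omega> by auto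
    show ?thesis unfolding T_def * using that
      by (intro sets.sets_Collect_conj sets.sets_Collect_finite_All borel_measurable_less borel_measurable_le
         borel_measurable_const mS) auto
  qed
  have T_disj: "T k \<omega> \<Longrightarrow> T k' \<omega> \<Longrightarrow> k = k'" for k k' \<omega>
    unfolding T_def by (metis linorder_neqE_nat not_less)
  have T_ex: "\<exists>k\<le>N. T k \<omega>" if "S k \<omega> > h" "k \<le> N" for k \<omega>
  proof -
    let ?k = "LEAST k. S k \<omega> > h"
    have "S ?k \<omega> > h" "?k \<le> k" using that by (auto intro: LeastI Least_le)
    moreover have "S j \<omega> \<le> h" if "j < ?k" for j using not_less_Least[OF that] by simp
    ultimately show ?thesis using \<open>k \<le> N\<close> unfolding T_def by (intro exI[of _ ?k]) auto
  qed
  define W where "W = {\<omega>\<in>space M. \<exists>k\<le>N. T k \<omega> \<and> 2 * S k \<omega> - z \<le> S N \<omega>}"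
  have ev1: "{\<omega>\<in>space M. T k \<omega> \<and> S N \<omega> \<le> z} \<in> events" if "k \<le> N" for k
    using that T mS by (intro sets.sets_Collect_conj borel_measurable_le) auto
  have ev2: "{\<omega>\<in>space M. T k \<omega> \<and> 2 * S k \<omega> - z \<le> S N \<omega>} \<in> events" if "k \<le> N" for k
    using that T mS by (intro sets.sets_Collect_conj borel_measurable_le) auto
  \<comment> \<open>Cutting along the first passage makes the pieces disjoint, so
    \<open>walk_reflection\<close> can be applied to each piece and summed.\<close>
  have "U = (\<Union>k\<in>{..N}. {\<omega>\<in>space M. T k \<omega> \<and> S N \<omega> \<le> z})"
    using T_ex by (auto simp: U_def) (auto simp: T_def)
  then have "prob U = (\<Sum>k\<in>{..N}. prob {\<omega>\<in>space M. T k \<omega> \<and> S N \<omega> \<le> z})"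
    using ev1 T_disj by (auto intro!: finite_measure_finite_Union simp: disjoint_family_on_def)
  also have "\<dots> = (\<Sum>k\<in>{..N}. prob {\<omega>\<in>space M. T k \<omega> \<and> 2 * S k \<omega> - z \<le> S N \<omega>})"
    using walk_reflection[OF ind sym] by (intro sum.cong) (auto simp: T_def S_def conj_assoc)
  also have "\<dots> = prob (\<Union>k\<in>{..N}. {\<omega>\<in>space M. T k \<omega> \<and> 2 * S k \<omega> - z \<le> S N \<omega>})"
    using ev2 T_disj by (auto intro!: finite_measure_finite_Union[symmetric] simp: disjoint_family_on_def)
  also have "(\<Union>k\<in>{..N}. {\<omega>\<in>space M. T k \<omega> \<and> 2 * S k \<omega> - z \<le> S N \<omega>}) = W"
    by (auto simp: W_def)
  finally have UW: "prob U = prob W" .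
  have W: "W \<in> events"
    using ev2 \<open>(\<Union>k\<in>{..N}. {\<omega>\<in>space M. T k \<omega> \<and> 2 * S k \<omega> - z \<le> S N \<omega>}) = W\<close> by auto
  show ?th1
    unfolding UW using mS[of N]
    by (intro finite_measure_mono) (auto simp: W_def T_def)
  have J: "{\<omega>\<in>space M. \<exists>k<N. X k \<omega> > \<epsilon>} \<in> events"
  proof -
    have *: "(\<exists>j<N. X j \<omega> > \<epsilon>) \<longleftrightarrow> (\<exists>j\<in>{..<N}. X j \<omega> > \<epsilon>)" for \<omega> by auto
    show ?thesis unfolding *
      by (intro sets.sets_Collect_finite_Ex borel_measurable_less borel_measurable_const X) auto
  qed
  have "{\<omega>\<in>space M. 2 * h - z + 2 * \<epsilon> \<le> S N \<omega>} \<subseteq> W \<union> {\<omega>\<in>space M. \<exists>k<N. X k \<omega> > \<epsilon>}"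
  proof (intro subsetI UnCI)
    fix \<omega> assume "\<omega> \<in> {\<omega>\<in>space M. 2 * h - z + 2 * \<epsilon> \<le> S N \<omega>}" "\<omega> \<notin> {\<omega>\<in>space M. \<exists>k<N. X k \<omega> > \<epsilon>}"
    then have \<omega>: "\<omega> \<in> space M" "2 * h - z + 2 * \<epsilon> \<le> S N \<omega>" and nJ: "\<not> (\<exists>k<N. X k \<omega> > \<epsilon>)" by auto
    \<comment> \<open>Here \<open>z \<le> h\<close> enters: an end value of at least
      \<open>2 * h - z + 2 * \<epsilon>\<close> lies above \<open>h\<close> and forces a
      passage.\<close>
    have "S N \<omega> > h" using \<omega> assms by simp
    then obtain k where k: "k \<le> N" "T k \<omega>" using T_ex by blast
    \<comment> \<open>As \<open>S 0 = 0 \<le> h\<close>, the passage is preceded by a step that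
      bounds the overshoot.\<close>
    have "k \<noteq> 0" using k(2) \<open>0 \<le> h\<close> by (intro notI) (simp add: T_def S_def)
    then obtain j where j: "k = Suc j" by (cases k) auto
    then have "S k \<omega> = S j \<omega> + X j \<omega>" "S j \<omega> \<le> h"
      using k by (auto simp: j S_def T_def)
    moreover have "X j \<omega> \<le> \<epsilon>" using nJ k(1) j by (meson Suc_le_lessD linorder_not_le)
    ultimately
    show "\<omega> \<in> W" using \<omega> k by (auto simp: W_def)
  qed
  then have "prob {\<omega>\<in>space M. 2 * h - z + 2 * \<epsilon> \<le> S N \<omega>} \<le> prob (W \<union> {\<omega>\<in>space M. \<exists>k<N. X k \<omega> > \<epsilon>})"
    using W J by (intro finite_measure_mono) auto
  also have "\<dots> \<le> prob W + prob {\<omega>\<in>space M. \<exists>k<N. X k \<omega> > \<epsilon>}"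
    using W J by (intro measure_Un_le)
  finally show ?th2 unfolding UW .
qed

end

section \<open>The joint density of the maximum and the end value\<close>

lemma DERIV_phi: "0 < \<sigma> \<Longrightarrow> (phi \<sigma> has_real_derivative - passage x \<sigma>) (at x)"
proof -
  assume "0 < \<sigma>"
  then have "((\<lambda>x. exp (- x\<^sup>2 / (2 * \<sigma>))) has_real_derivative exp (- x\<^sup>2 / (2 * \<sigma>)) * (- x / \<sigma>)) (at x)"
    by (auto intro!: derivative_eq_intros)
  from DERIV_cmult[OF this, of "1 / sqrt (2 * pi * \<sigma>)"] show ?thesis
    by (simp add: phi_def[abs_def] passage_def mult_ac)
qed

text \<open>
  The density at \<open>x\<close> of a Brownian motion from \<open>0\<close> at time \<open>T\<close> on the event that its maximum up to
  time \<open>T\<close> is below \<open>y\<close>.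
\<close>

definition killed :: "real \<Rightarrow> real \<Rightarrow> real \<Rightarrow> real" where
  "killed T y x = (if 0 < y \<and> x < y then g T (y - x) y else 0)"

text \<open>This is the derivative of \<open>killed T m z\<close> in \<open>m\<close>: of the two
  Gaussians in \<open>killed\<close> only \<open>phi T (2 * m - z)\<close> depends on
  \<open>m\<close>. It is the classical density of (running maximum, end value) of a Brownian motion
  at time \<open>T\<close>.\<close>

definition max_end_density :: "real \<Rightarrow> real \<Rightarrow> real \<Rightarrow> real" where
  "max_end_density T m z = (if 0 < m \<and> z < m then 2 * passage (2 * m - z) T else 0)"

lemma killed_measurable [measurable]:
  assumes [measurable]: "f \<in> borel_measurable M" "h \<in> borel_measurable M"
  shows "(\<lambda>x. killed T (f x) (h x)) \<in> borel_measurable M"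
  unfolding killed_def by measurable

lemma max_end_density_measurable [measurable]:
  assumes [measurable]: "f \<in> borel_measurable M" "h \<in> borel_measurable M"
  shows "(\<lambda>x. max_end_density T (f x) (h x)) \<in> borel_measurable M"
  unfolding max_end_density_def by measurable

lemma killed_nonneg: "0 < T \<Longrightarrow> 0 \<le> killed T y x"
  by (simp add: killed_def g_nonneg)

lemma max_end_density_nonneg: "0 < T \<Longrightarrow> 0 \<le> max_end_density T m z"
  by (simp add: max_end_density_def passage_nonneg)

lemma nn_integral_max_end_density:
  assumes "0 < T"
  shows "(\<integral>\<^sup>+m. ennreal (max_end_density T m x) * indicator {..y} m \<partial>lborel) = ennreal (killed T y x)"
proof (cases "max 0 x < y")
  case True
  have "AE m in lborel. m \<noteq> max 0 x"
    by (rule AE_lborel_singleton)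
  then have "(\<integral>\<^sup>+m. ennreal (max_end_density T m x) * indicator {..y} m \<partial>lborel) =
     (\<integral>\<^sup>+m. ennreal (2 * passage (2 * m - x) T) * indicator {max 0 x..y} m \<partial>lborel)"
    by (intro nn_integral_cong_AE) (auto simp: max_end_density_def split: split_indicator)
  also have "\<dots> = ennreal (- phi T (2 * y - x) - - phi T (2 * max 0 x - x))"
  proof (rule nn_integral_FTC_Icc)
    show "((\<lambda>m. - phi T (2 * m - x)) has_real_derivative 2 * passage (2 * m - x) T) (at m)" for m
      by (auto intro!: derivative_eq_intros DERIV_chain2[OF DERIV_phi[OF assms]])
    show "0 \<le> 2 * passage (2 * m - x) T" if "m \<in> {max 0 x..y}" for m
      using assms that by (auto intro!: passage_nonneg)
  qed (use True in auto)
  also have "- phi T (2 * y - x) - - phi T (2 * max 0 x - x) = killed T y x"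
  proof -
    \<comment> \<open>At the lower limit the argument is the absolute value of \<open>x\<close>, so
      the boundary term is the free Gaussian density.\<close>
    have "phi T (2 * max 0 x - x) = phi T x"
      by (cases "0 \<le> x") (auto simp: max_def)
    then show ?thesis using True by (simp add: killed_def g_def)
  qed
  finally show ?thesis .
next
  case False
  then have "(\<integral>\<^sup>+m. ennreal (max_end_density T m x) * indicator {..y} m \<partial>lborel) = (\<integral>\<^sup>+m. 0 \<partial>(lborel::real measure))"
    by (intro nn_integral_cong) (auto simp: max_end_density_def split: split_indicator)
  then show ?thesis using False by (auto simp: killed_def)
qed

text \<open>The strict form is the one for the piece before the interval of the argmax: a tie there
  would move the first argmax to the left.\<close>

lemma nn_integral_max_end_density_less:
  assumes "0 < T"
  shows "(\<integral>\<^sup>+m. ennreal (max_end_density T m x) * indicator {..<y} m \<partial>lborel) = ennreal (killed T y x)"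
  unfolding nn_integral_max_end_density[OF assms, symmetric]
  using AE_lborel_singleton[of y]
  by (intro nn_integral_cong_AE) (auto split: split_indicator)

section \<open>Dyadic grids and suprema of continuous functions\<close>

definition grid :: "real \<Rightarrow> real \<Rightarrow> nat \<Rightarrow> nat \<Rightarrow> real" where
  "grid p q n k = p + (q - p) * real k / 2 ^ n"

lemma grid_in: "p \<le> q \<Longrightarrow> k \<le> 2 ^ n \<Longrightarrow> grid p q n k \<in> {p..q}"
proof -
  assume "p \<le> q" "k \<le> 2 ^ n"
  moreover from this have "real k \<le> 2 ^ n" by (metis of_nat_le_iff of_nat_numeral of_nat_power)
  ultimately have "(q - p) * real k / 2 ^ n \<le> (q - p) * 2 ^ n / 2 ^ n"
    by (intro divide_right_mono mult_left_mono) auto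
  then show ?thesis using \<open>p \<le> q\<close> by (auto simp: grid_def)
qed

lemma grid_0 [simp]: "grid p q n 0 = p" and grid_end [simp]: "grid p q n (2 ^ n) = q"
  by (auto simp: grid_def)

lemma grid_mono: "p \<le> q \<Longrightarrow> k \<le> l \<Longrightarrow> grid p q n k \<le> grid p q n l"
  by (auto simp: grid_def intro!: divide_right_mono mult_left_mono)

text \<open>Nesting is the reason for dyadic grids: the events formed from grid values become
  monotone in \<open>n\<close>, so their probabilities converge.\<close>

lemma grid_double: "grid p q (Suc n) (2 * k) = grid p q n k"
  by (simp add: grid_def)

lemma grid_Suc_diff: "grid p q n (Suc k) - grid p q n k = (q - p) / 2 ^ n"
  by (simp add: grid_def field_simps)

lemma grid_approx:
  assumes "p \<le> q" "u \<in> {p..q}"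
  obtains k where "\<And>n. k n \<le> 2 ^ n" "(\<lambda>n. grid p q n (k n)) \<longlonglongrightarrow> u"
proof (cases "p = q")
  case True
  then show ?thesis using assms by (intro that[of "\<lambda>_. 0"]) auto
next
  case False
  then have [arith]: "p < q" using assms by auto
  define v where "v = (u - p) / (q - p)"
  have v: "0 \<le> v" "v \<le> 1" "u = p + (q - p) * v" using assms by (auto simp: v_def)
  define k where "k n = nat \<lfloor>v * 2 ^ n\<rfloor>" for n
  have k: "real (k n) \<le> v * 2 ^ n" "v * 2 ^ n - 1 \<le> real (k n)" for n
    using v by (auto simp: k_def)
  have "real (k n) \<le> 2 ^ n" for n using k(1)[of n] v(2) by (meson mult_left_le_one_le order_trans v(1) zero_le_numeral zero_le_power)
  then have 1: "k n \<le> 2 ^ n" for n by (metis of_nat_le_iff of_nat_numeral of_nat_power)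
  have "(\<lambda>n. real (k n) / 2 ^ n) \<longlonglongrightarrow> v"
  proof (rule tendsto_sandwich[of "\<lambda>n. v - 1 / 2 ^ n" _ _ "\<lambda>n. v"])
    show "(\<lambda>n. v - 1 / 2 ^ n) \<longlonglongrightarrow> v" by real_asymp
    show "\<forall>\<^sub>F n in sequentially. v - 1 / 2 ^ n \<le> real (k n) / 2 ^ n"
    proof (intro always_eventually allI)
      fix n
      have "(v * 2 ^ n - 1) / 2 ^ n \<le> real (k n) / 2 ^ n" using k(2) by (intro divide_right_mono) auto
      then show "v - 1 / 2 ^ n \<le> real (k n) / 2 ^ n" by (simp add: diff_divide_distrib)
    qed
    show "\<forall>\<^sub>F n in sequentially. real (k n) / 2 ^ n \<le> v"
      using k(1) by (auto simp: field_simps)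
  qed auto
  then have "(\<lambda>n. p + (q - p) * (real (k n) / 2 ^ n)) \<longlonglongrightarrow> p + (q - p) * v"
    by (intro tendsto_intros)
  then show ?thesis using 1 v(3) by (intro that[of k]) (auto simp: grid_def)
qed

text \<open>By continuity a strict inequality at one point persists nearby, and the grid points come
  arbitrarily close to every point. The strictness is what lets countably many times decide.\<close>

lemma less_SUP_iff_grid:
  fixes f :: "real \<Rightarrow> real"
  assumes "p \<le> q" "continuous_on {p..q} f"
  shows "h < (SUP u\<in>{p..q}. f u) \<longleftrightarrow> (\<exists>n. \<exists>k\<le>2 ^ n. h < f (grid p q n k))"
proof -
  have bdd: "bdd_above (f ` {p..q})"
    using compact_continuous_image[OF assms(2)] by (auto intro: bounded_imp_bdd_above compact_imp_bounded)
  have "\<exists>n. \<exists>k\<le>2 ^ n. h < f (grid p q n k)" if u: "u \<in> {p..q}" "h < f u" for u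
  proof -
    obtain k where k: "\<And>n. k n \<le> 2 ^ n" "(\<lambda>n. grid p q n (k n)) \<longlonglongrightarrow> u"
      using grid_approx[OF assms(1) u(1)] by blast
    have "(\<lambda>n. f (grid p q n (k n))) \<longlonglongrightarrow> f u"
      using k u by (intro continuous_on_tendsto_compose[OF assms(2)]) (auto intro!: always_eventually grid_in[OF assms(1), simplified])
    then have "\<forall>\<^sub>F n in sequentially. h < f (grid p q n (k n))"
      using u(2) by (rule order_tendstoD)
    then show ?thesis using k(1) eventually_happens[of _ sequentially] by fastforce
  qed
  then show ?thesis
    using assms(1) bdd grid_in[OF assms(1)] by (subst less_cSUP_iff) auto
qed

text \<open>The maximum is taken relative to the value at the start, so that it is a function of
  increments inside the interval; this is what makes disjoint intervals independent.\<close>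

definition incr_max :: "(real \<Rightarrow> 'a \<Rightarrow> real) \<Rightarrow> real \<Rightarrow> real \<Rightarrow> 'a \<Rightarrow> real" where
  "incr_max B p q \<omega> = (SUP u\<in>{p..q}. B u \<omega> - B p \<omega>)"

lemma distributed_AE:
  assumes "distributed M N X f" "AE x in N. P x"
  shows "AE \<omega> in M. P (X \<omega>)"
proof (rule AE_distrD[of X M N])
  show "X \<in> measurable M N" using assms(1) by (simp add: distributed_def)
  have "AE x in density N f. P x"
    using assms by (subst AE_density) (auto simp: distributed_def)
  then show "AE x in distr M N X. P x"
    using distributed_distr_eq_density[OF assms(1)] by metis
qed

section \<open>The reflection principle and the law of (maximum, end value) for Brownian
  motion\<close>

locale brownian =
  fixes M :: "'a measure" and B :: "real \<Rightarrow> 'a \<Rightarrow> real"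
  assumes bm: "brownian_motion01 M B"

sublocale brownian \<subseteq> prob_space M
  using bm by (simp add: brownian_motion01_def)

context brownian
begin

lemma B_measurable [measurable]: "0 \<le> t \<Longrightarrow> t \<le> 1 \<Longrightarrow> B t \<in> borel_measurable M"
  using bm by (simp add: brownian_motion01_def)

lemma B_0: "\<omega> \<in> space M \<Longrightarrow> B 0 \<omega> = 0"
  using bm by (simp add: brownian_motion01_def)

lemma B_continuous_on: "\<omega> \<in> space M \<Longrightarrow> A \<subseteq> {0..1} \<Longrightarrow> continuous_on A (\<lambda>t. B t \<omega>)"
  using bm continuous_on_subset by (simp add: brownian_motion01_def) blast

lemma B_indep:
  "(\<And>i. i \<le> n \<Longrightarrow> u i \<in> {0..1}) \<Longrightarrow> (\<And>i. i < n \<Longrightarrow> u i \<le> u (Suc i)) \<Longrightarrow>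
    indep_vars (\<lambda>_. borel) (\<lambda>i \<omega>. B (u (Suc i)) \<omega> - B (u i) \<omega>) {..<n}"
  using bm by (simp add: brownian_motion01_def)

lemma B_incr_distributed:
  "0 \<le> s \<Longrightarrow> s < t \<Longrightarrow> t \<le> 1 \<Longrightarrow> distributed M lborel (\<lambda>\<omega>. B t \<omega> - B s \<omega>) (\<lambda>x. ennreal (phi (t - s) x))"
  using bm by (simp add: brownian_motion01_def phi_eq_normal_density)

lemma B_incr_uminus:
  assumes "0 \<le> s" "s \<le> t" "t \<le> 1"
  shows "distr M borel (\<lambda>\<omega>. B t \<omega> - B s \<omega>) = distr M borel (\<lambda>\<omega>. - (B t \<omega> - B s \<omega>))"
\<comment> \<open>The degenerate case is the empty sum after the last step of a grid walk.\<close>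
proof (cases "s = t")
  case False
  then have d: "distributed M lborel (\<lambda>\<omega>. B t \<omega> - B s \<omega>) (\<lambda>x. ennreal (normal_density 0 (sqrt (t - s)) x))"
    using bm assms by (simp add: brownian_motion01_def)
  then have d': "distributed M lborel (\<lambda>\<omega>. - (B t \<omega> - B s \<omega>)) (\<lambda>x. ennreal (normal_density 0 (sqrt (t - s)) x))"
    using normal_density_affine[OF d, of "-1" 0] False assms by simp
  have "distr M lborel (\<lambda>\<omega>. B t \<omega> - B s \<omega>) = distr M lborel (\<lambda>\<omega>. - (B t \<omega> - B s \<omega>))"
    using d d' by (simp add: distributed_def)
  moreover have "distr M lborel f = distr M borel f" for f :: "'a \<Rightarrow> real"
    by (intro distr_cong) auto
  ultimately show ?thesis by simp
qed simp

lemma incr_max_measurable [measurable]: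
  assumes "0 \<le> p" "p \<le> q" "q \<le> 1"
  shows "incr_max B p q \<in> borel_measurable M"
proof (subst borel_measurable_iff_greater, intro allI)
  fix h
  have "{\<omega>\<in>space M. h < incr_max B p q \<omega>} = {\<omega>\<in>space M. \<exists>n. \<exists>k\<in>{..2^n}. h < B (grid p q n k) \<omega> - B p \<omega>}"
    unfolding incr_max_def using assms
    by (intro Collect_cong conj_cong refl, subst less_SUP_iff_grid)
      (auto intro!: continuous_intros B_continuous_on)
  also have "\<dots> \<in> events"
  proof -
    have [measurable]: "B (grid p q n k) \<in> borel_measurable M" if "k \<in> {..2^n}" for n k
      using that assms grid_in[of p q k n] by (intro B_measurable) auto
    have [measurable]: "B p \<in> borel_measurable M" using assms by simp
    show ?thesis by (intro sets.sets_Collect_countable_Ex sets.sets_Collect_finite_Ex) measurable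
  qed
  finally show "{\<omega>\<in>space M. h < incr_max B p q \<omega>} \<in> events" .
qed

lemma incr_le_incr_max:
  assumes "0 \<le> p" "p \<le> u" "u \<le> q" "q \<le> 1" "\<omega> \<in> space M"
  shows "B u \<omega> - B p \<omega> \<le> incr_max B p q \<omega>"
proof -
  have "compact ((\<lambda>u. B u \<omega> - B p \<omega>) ` {p..q})"
    using assms by (intro compact_continuous_image continuous_intros B_continuous_on) auto
  then show ?thesis unfolding incr_max_def using assms
    by (intro cSUP_upper bounded_imp_bdd_above compact_imp_bounded) auto
qed

text \<open>Each path is uniformly continuous on the compact interval, so pathwise no grid step
  exceeds \<open>\<epsilon>\<close> once the mesh is small; dominated convergence passes this to
  probabilities.\<close>

lemma jump_tendsto_0:
  assumes "0 \<le> p" "p \<le> q" "q \<le> 1" "0 < \<epsilon>"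
  shows "(\<lambda>n. prob {\<omega>\<in>space M. \<exists>k<2^n. B (grid p q n (Suc k)) \<omega> - B (grid p q n k) \<omega> > \<epsilon>}) \<longlonglongrightarrow> 0"
proof -
  let ?J = "\<lambda>n. {\<omega>\<in>space M. \<exists>k\<in>{..<2^n}. B (grid p q n (Suc k)) \<omega> - B (grid p q n k) \<omega> > \<epsilon>}"
  have mJ: "?J n \<in> events" for n
  proof -
    have [measurable]: "B (grid p q n k) \<in> borel_measurable M" if "k \<le> 2^n" for k
      using that assms grid_in[of p q k n] by (intro B_measurable) auto
    show ?thesis by (intro sets.sets_Collect_finite_Ex) (auto simp: Suc_le_eq)
  qed
  have "(\<lambda>n. indicator (?J n) \<omega> :: real) \<longlonglongrightarrow> 0" if \<omega>: "\<omega> \<in> space M" for \<omega>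
  proof -
    have "uniformly_continuous_on {p..q} (\<lambda>u. B u \<omega>)"
      using \<omega> assms by (intro compact_uniformly_continuous B_continuous_on) auto
    then obtain d where d: "d > 0" "\<And>u v. u \<in> {p..q} \<Longrightarrow> v \<in> {p..q} \<Longrightarrow> dist u v < d \<Longrightarrow> dist (B u \<omega>) (B v \<omega>) < \<epsilon>"
      unfolding uniformly_continuous_on_def using \<open>0 < \<epsilon>\<close> by metis
    have "(\<lambda>n. (q - p) / 2 ^ n) \<longlonglongrightarrow> 0" by real_asymp
    then have "\<forall>\<^sub>F n in sequentially. (q - p) / 2 ^ n < d"
      using d(1) by (rule order_tendstoD)
    then have "\<forall>\<^sub>F n in sequentially. indicator (?J n) \<omega> = (0::real)"
    proof eventually_elim
      case (elim n)
      have "B (grid p q n (Suc k)) \<omega> - B (grid p q n k) \<omega> < \<epsilon>" if "k < 2^n" for k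
        using d(2)[of "grid p q n (Suc k)" "grid p q n k"] elim that assms
          grid_in[of p q "Suc k" n] grid_in[of p q k n] grid_Suc_diff[of p q n k]
        by (auto simp: dist_real_def)
      then have "\<omega> \<notin> ?J n" using less_asym by blast
      then show ?case by simp
    qed
    then show ?thesis by (rule tendsto_eventually)
  qed
  then have "(\<lambda>n. \<integral>\<omega>. indicator (?J n) \<omega> \<partial>M) \<longlonglongrightarrow> (\<integral>\<omega>. (0::real) \<partial>M)"
    using mJ by (intro integral_dominated_convergence[where w="\<lambda>_. 1"]) (auto intro!: AE_I2)
  moreover have "(\<integral>\<omega>. indicator (?J n) \<omega> \<partial>M) = prob (?J n)" for n
  proof -
    have "?J n \<inter> space M = ?J n" by auto
    then show ?thesis by (simp only: Bochner_Integration.integral_indicator)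
  qed
  moreover have "?J n = {\<omega>\<in>space M. \<exists>k<2^n. B (grid p q n (Suc k)) \<omega> - B (grid p q n k) \<omega> > \<epsilon>}" for n
    by (simp only: Bex_def lessThan_iff)
  ultimately show ?thesis by (simp only: integral_zero)
qed

text \<open>The walk bounds squeeze the probability. First the grid is refined with
  \<open>\<epsilon>\<close> fixed, which removes the probability of large steps; then
  \<open>\<epsilon>\<close> tends to 0. The second limit only reaches the strict inequality, and the
  boundary case is a null event because the increment has a density.\<close>

lemma reflection_principle:
  assumes pq: "0 \<le> p" "p < q" "q \<le> 1" and "z \<le> h" "0 \<le> h"
  shows "prob {\<omega>\<in>space M. h < incr_max B p q \<omega> \<and> B q \<omega> - B p \<omega> \<le> z} = prob {\<omega>\<in>space M. 2 * h - z \<le> B q \<omega> - B p \<omega>}"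
proof -
  have [measurable]: "B p \<in> borel_measurable M" "B q \<in> borel_measurable M" using pq by auto
  have mg: "B (grid p q n k) \<in> borel_measurable M" if "k \<le> 2^n" for n k
    using that pq grid_in[of p q k n] by (intro B_measurable) auto
  let ?X = "\<lambda>n i \<omega>. B (grid p q n (Suc i)) \<omega> - B (grid p q n i) \<omega>"
  let ?U = "\<lambda>n. {\<omega>\<in>space M. (\<exists>k\<le>2^n. B (grid p q n k) \<omega> - B p \<omega> > h) \<and> B q \<omega> - B p \<omega> \<le> z}"
  let ?J = "\<lambda>n \<epsilon>. {\<omega>\<in>space M. \<exists>k<2^n. B (grid p q n (Suc k)) \<omega> - B (grid p q n k) \<omega> > \<epsilon>}"
  have mU: "?U n \<in> events" for n
  proof -
    have *: "(\<exists>k\<le>2^n. B (grid p q n k) \<omega> - B p \<omega> > h) \<longleftrightarrow> (\<exists>k\<in>{..2^n}. B (grid p q n k) \<omega> - B p \<omega> > h)" for \<omega>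
      by auto
    show ?thesis unfolding * using mg
      by (intro sets.sets_Collect_conj sets.sets_Collect_finite_Ex) auto
  qed
  have sum: "(\<Sum>i\<in>{k..<l}. ?X n i \<omega>) = B (grid p q n l) \<omega> - B (grid p q n k) \<omega>" if "k \<le> l" for n k l \<omega>
    using that by (rule sum_Suc_diff')
  have ind: "indep_vars (\<lambda>_. borel) (?X n) {..<2^n}" for n
  proof (intro B_indep)
    show "grid p q n i \<in> {0..1}" if "i \<le> 2^n" for i
      using grid_in[of p q i n] pq that by auto
    show "grid p q n i \<le> grid p q n (Suc i)" for i
      using grid_mono[of p q i "Suc i" n] pq by auto
  qed
  have sym: "distr M borel (\<lambda>\<omega>. \<Sum>i\<in>{k..<2^n}. ?X n i \<omega>) = distr M borel (\<lambda>\<omega>. - (\<Sum>i\<in>{k..<2^n}. ?X n i \<omega>))"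
    if "k \<le> 2^n" for n k
    unfolding sum[OF that] using that pq grid_in[of p q k n] by (intro B_incr_uminus) auto
  have sum': "(\<Sum>i<k. ?X n i \<omega>) = B (grid p q n k) \<omega> - B p \<omega>" for n k \<omega>
    using sum[of 0 k n \<omega>] by (simp add: lessThan_atLeast0)
  have le: "prob (?U n) \<le> prob {\<omega>\<in>space M. 2 * h - z \<le> B q \<omega> - B p \<omega>}" for n
    using walk_reflection_bounds(1)[OF ind[of n] sym \<open>z \<le> h\<close> \<open>0 \<le> h\<close>, of 1] unfolding sum' by simp
  have ge: "prob {\<omega>\<in>space M. 2 * h - z + 2 * \<epsilon> \<le> B q \<omega> - B p \<omega>} \<le> prob (?U n) + prob (?J n \<epsilon>)" if "0 < \<epsilon>" for n \<epsilon>
    using walk_reflection_bounds(2)[OF ind[of n] sym \<open>z \<le> h\<close> \<open>0 \<le> h\<close>, of \<epsilon>] that unfolding sum' by simp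
  have incU: "incseq ?U"
  proof (intro incseq_SucI subsetI)
    fix n \<omega> assume "\<omega> \<in> ?U n"
    then obtain k where "k \<le> 2^n" "B (grid p q n k) \<omega> - B p \<omega> > h" "B q \<omega> - B p \<omega> \<le> z" "\<omega> \<in> space M" by auto
    then show "\<omega> \<in> ?U (Suc n)"
      by (auto intro!: exI[of _ "2 * k"] simp: grid_double)
  qed
  let ?V = "{\<omega>\<in>space M. h < incr_max B p q \<omega> \<and> B q \<omega> - B p \<omega> \<le> z}"
  have UV: "(\<Union>n. ?U n) = ?V"
  proof -
    have "h < incr_max B p q \<omega> \<longleftrightarrow> (\<exists>n. \<exists>k\<le>2 ^ n. h < B (grid p q n k) \<omega> - B p \<omega>)" if "\<omega> \<in> space M" for \<omega>
      unfolding incr_max_def using that pq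
      by (intro less_SUP_iff_grid) (auto intro!: continuous_intros B_continuous_on)
    then show ?thesis by blast
  qed
  have "range ?U \<subseteq> events" using mU by blast
  from finite_Lim_measure_incseq[OF this incU]
  have limU: "(\<lambda>n. prob (?U n)) \<longlonglongrightarrow> prob ?V" unfolding UV .
  have "prob ?V \<le> prob {\<omega>\<in>space M. 2 * h - z \<le> B q \<omega> - B p \<omega>}"
    by (rule LIMSEQ_le_const2[OF limU]) (use le in blast)
  moreover have "prob {\<omega>\<in>space M. 2 * h - z \<le> B q \<omega> - B p \<omega>} \<le> prob ?V"
  proof -
    have ge': "prob {\<omega>\<in>space M. 2 * h - z + 2 * \<epsilon> \<le> B q \<omega> - B p \<omega>} \<le> prob ?V" if "0 < \<epsilon>" for \<epsilon>
    proof (rule LIMSEQ_le_const)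
      show "(\<lambda>n. prob (?U n) + prob (?J n \<epsilon>)) \<longlonglongrightarrow> prob ?V"
        using tendsto_add[OF limU jump_tendsto_0[of p q \<epsilon>]] pq that by simp
    qed (use ge[OF that] in blast)
    define \<epsilon> where "\<epsilon> n = inverse (real (Suc n))" for n
    define A where "A n = {\<omega>\<in>space M. 2 * h - z + 2 * \<epsilon> n \<le> B q \<omega> - B p \<omega>}" for n
    have A: "A n \<in> events" for n unfolding A_def by measurable
    have "incseq A"
    proof (intro incseq_SucI subsetI)
      fix n \<omega> assume "\<omega> \<in> A n"
      moreover have "\<epsilon> (Suc n) \<le> \<epsilon> n" unfolding \<epsilon>_def by (intro le_imp_inverse_le) auto
      ultimately show "\<omega> \<in> A (Suc n)" by (auto simp: A_def)
    qed
    then have "(\<lambda>n. prob (A n)) \<longlonglongrightarrow> prob (\<Union>n. A n)"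
      using A by (intro finite_Lim_measure_incseq) auto
    moreover have "(\<Union>n. A n) = {\<omega>\<in>space M. 2 * h - z < B q \<omega> - B p \<omega>}"
    proof -
      have "(\<exists>n. a + 2 * \<epsilon> n \<le> b) \<longleftrightarrow> a < b" for a b
      proof
        assume "a < b"
        then obtain n where "inverse (real (Suc n)) < (b - a) / 2"
          using reals_Archimedean[of "(b - a) / 2"] by auto
        then show "\<exists>n. a + 2 * \<epsilon> n \<le> b" by (intro exI[of _ n]) (simp add: \<epsilon>_def)
      next
        assume "\<exists>n. a + 2 * \<epsilon> n \<le> b"
        moreover have "\<epsilon> n > 0" for n by (simp add: \<epsilon>_def)
        ultimately show "a < b" by (smt (verit))
      qed
      then show ?thesis unfolding A_def by auto
    qed
    moreover have "prob (A n) \<le> prob ?V" for n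
      unfolding A_def by (rule ge') (simp add: \<epsilon>_def)
    ultimately have "prob {\<omega>\<in>space M. 2 * h - z < B q \<omega> - B p \<omega>} \<le> prob ?V"
      by (intro LIMSEQ_le_const2[of "\<lambda>n. prob (A n)"]) auto
    moreover have "prob {\<omega>\<in>space M. 2 * h - z < B q \<omega> - B p \<omega>} = prob {\<omega>\<in>space M. 2 * h - z \<le> B q \<omega> - B p \<omega>}"
    proof (rule measure_eq_AE)
      have "AE \<omega> in M. B q \<omega> - B p \<omega> \<noteq> 2 * h - z"
        by (rule distributed_AE[OF B_incr_distributed[OF pq] AE_lborel_singleton])
      then show "AE \<omega> in M. (\<omega> \<in> {\<omega>\<in>space M. 2 * h - z < B q \<omega> - B p \<omega>}) = (\<omega> \<in> {\<omega>\<in>space M. 2 * h - z \<le> B q \<omega> - B p \<omega>})"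
        by eventually_elim auto
    qed measurable
    ultimately show ?thesis by simp
  qed
  ultimately show ?thesis by simp
qed

text \<open>The event that the end value is at most \<open>z'\<close> splits according to whether
  the maximum exceeds \<open>y\<close>. The reflection principle evaluates the part where it does,
  and in terms of densities the rest is the Gaussian minus its mirror image at \<open>y\<close>,
  that is, \<open>killed\<close>.\<close>

lemma emeasure_max_end:
  assumes pq: "0 \<le> p" "p < q" "q \<le> 1"
  shows "emeasure M {\<omega>\<in>space M. incr_max B p q \<omega> \<le> y \<and> B q \<omega> - B p \<omega> \<le> z} =
    (\<integral>\<^sup>+x. ennreal (killed (q - p) y x) * indicator {..z} x \<partial>lborel)"
proof (cases "0 \<le> y")
  case False
  have "incr_max B p q \<omega> \<ge> 0" if "\<omega> \<in> space M" for \<omega>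
    using incr_le_incr_max[of p p q \<omega>] pq that by simp
  then have "{\<omega>\<in>space M. incr_max B p q \<omega> \<le> y \<and> B q \<omega> - B p \<omega> \<le> z} = {}"
    using False by fastforce
  moreover have "killed (q - p) y x = 0" for x using False by (simp add: killed_def)
  ultimately show ?thesis by (simp only:) simp
next
  case [arith]: True
  \<comment> \<open>The reflection principle requires the bound on the end value to be at most the
    level. Capping it at \<open>y\<close> leaves the event unchanged, since the end value never
    exceeds the maximum.\<close>
  define T z' where "T = q - p" and "z' = min y z"
  have T: "0 < T" using pq by (simp add: T_def)
  define Z where "Z \<omega> = B q \<omega> - B p \<omega>" for \<omega>
  have [measurable]: "incr_max B p q \<in> borel_measurable M" "Z \<in> borel_measurable M"
    using pq by (auto simp: Z_def[abs_def])
  have dZ: "distributed M lborel Z (\<lambda>x. ennreal (phi T x))"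
    unfolding Z_def[abs_def] T_def by (rule B_incr_distributed[OF pq])
  have eZ: "emeasure M {\<omega>\<in>space M. Z \<omega> \<in> A} = (\<integral>\<^sup>+x. ennreal (phi T x) * indicator A x \<partial>lborel)" if "A \<in> sets borel" for A
    using distributed_emeasure[OF dZ, of A] that by (simp add: vimage_def Int_def conj_commute)
  \<comment> \<open>The probability of the reflected event. In \<open>ennreal\<close> it is added on
    both sides and cancelled at the end, where its finiteness is needed.\<close>
  define e where "e = (\<integral>\<^sup>+x. ennreal (phi T (2 * y - x)) * indicator {..z'} x \<partial>lborel)"
  have Z_le: "Z \<omega> \<le> incr_max B p q \<omega>" if "\<omega> \<in> space M" for \<omega>
    using incr_le_incr_max[of p q q \<omega>] pq that by (simp add: Z_def)
  have "(\<integral>\<^sup>+x. ennreal (phi T x) * indicator {2 * y - z'..} x \<partial>lborel) = e"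
    unfolding e_def
    by (subst nn_integral_real_affine[where c="-1" and t="2 * y"])
       (auto intro!: nn_integral_cong split: split_indicator)
  then have e: "e = emeasure M {\<omega>\<in>space M. 2 * y - z' \<le> Z \<omega>}"
    using eZ[of "{2 * y - z'..}"] by simp
  have refl: "prob {\<omega>\<in>space M. y < incr_max B p q \<omega> \<and> Z \<omega> \<le> z'} = prob {\<omega>\<in>space M. 2 * y - z' \<le> Z \<omega>}"
    unfolding Z_def by (rule reflection_principle[OF pq]) (auto simp: z'_def)
  have "{\<omega>\<in>space M. incr_max B p q \<omega> \<le> y \<and> Z \<omega> \<le> z} = {\<omega>\<in>space M. incr_max B p q \<omega> \<le> y \<and> Z \<omega> \<le> z'}"
    using Z_le by (force simp: z'_def)
  then have "emeasure M {\<omega>\<in>space M. incr_max B p q \<omega> \<le> y \<and> Z \<omega> \<le> z} + e =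
    emeasure M {\<omega>\<in>space M. incr_max B p q \<omega> \<le> y \<and> Z \<omega> \<le> z'} + emeasure M {\<omega>\<in>space M. y < incr_max B p q \<omega> \<and> Z \<omega> \<le> z'}"
    using e refl by (simp add: emeasure_eq_measure)
  also have "\<dots> = emeasure M {\<omega>\<in>space M. Z \<omega> \<in> {..z'}}"
    by (subst plus_emeasure) (auto intro!: arg_cong[where f="emeasure M"])
  also have "\<dots> = (\<integral>\<^sup>+x. ennreal (phi T x) * indicator {..z'} x \<partial>lborel)"
    by (rule eZ) simp
  also have "\<dots> = (\<integral>\<^sup>+x. ennreal (killed T y x) * indicator {..z} x + ennreal (phi T (2 * y - x)) * indicator {..z'} x \<partial>lborel)"
  proof (rule nn_integral_cong_AE)
    show "AE x in lborel. ennreal (phi T x) * indicator {..z'} x =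
       ennreal (killed T y x) * indicator {..z} x + ennreal (phi T (2 * y - x)) * indicator {..z'} x"
      using AE_lborel_singleton[of y]
    proof eventually_elim
      case (elim x)
      have "ennreal (phi T x) = ennreal (killed T y x) + ennreal (phi T (2 * y - x))" if "x \<le> z'"
      proof -
        \<comment> \<open>For \<open>y = 0\<close> the killed density vanishes and the identity is
          the symmetry of \<open>phi\<close>.\<close>
        have "phi T x = killed T y x + phi T (2 * y - x)"
          using True that elim by (cases "y = 0") (auto simp: killed_def g_def z'_def)
        then show ?thesis
          using killed_nonneg[OF T] phi_pos[OF T] by (simp add: less_imp_le flip: ennreal_plus)
      qed
      then show ?case using elim by (auto simp: z'_def killed_def split: split_indicator)
    qed
  qed
  also have "\<dots> = (\<integral>\<^sup>+x. ennreal (killed T y x) * indicator {..z} x \<partial>lborel) + e"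
    unfolding e_def by (intro nn_integral_add) auto
  finally have "e + emeasure M {\<omega>\<in>space M. incr_max B p q \<omega> \<le> y \<and> Z \<omega> \<le> z} =
      e + (\<integral>\<^sup>+x. ennreal (killed T y x) * indicator {..z} x \<partial>lborel)"
    by (simp only: add.commute[of e])
  moreover have "e \<noteq> \<infinity>" unfolding e by (simp add: emeasure_eq_measure)
  ultimately have "emeasure M {\<omega>\<in>space M. incr_max B p q \<omega> \<le> y \<and> Z \<omega> \<le> z} =
      (\<integral>\<^sup>+x. ennreal (killed T y x) * indicator {..z} x \<partial>lborel)"
    by (simp only: ennreal_add_left_cancel simp_thms)
  then show ?thesis
    by (simp only: T_def Z_def)
qed

text \<open>The sets \<open>{..(y, z)}\<close> form an intersection-stable generator, and on them
  both measures are integrals of \<open>killed\<close>: one by reflection, the other by integrating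
  out the maximum.\<close>

lemma max_end_distributed:
  assumes pq: "0 \<le> p" "p < q" "q \<le> 1"
  shows "distributed M lborel (\<lambda>\<omega>. (incr_max B p q \<omega>, B q \<omega> - B p \<omega>)) (\<lambda>(m, z). ennreal (max_end_density (q - p) m z))"
  unfolding distributed_def
proof (intro conjI)
  have [measurable]: "incr_max B p q \<in> borel_measurable M" "B p \<in> borel_measurable M" "B q \<in> borel_measurable M"
    using pq by auto
  show m: "(\<lambda>\<omega>. (incr_max B p q \<omega>, B q \<omega> - B p \<omega>)) \<in> measurable M lborel"
    by simp
  show f: "(\<lambda>(m, z). ennreal (max_end_density (q - p) m z)) \<in> borel_measurable lborel"
    unfolding case_prod_unfold lborel_prod[symmetric] by simp
  let ?D = "density (lborel :: (real \<times> real) measure) (\<lambda>(m, z). ennreal (max_end_density (q - p) m z))"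
  show "distr M lborel (\<lambda>\<omega>. (incr_max B p q \<omega>, B q \<omega> - B p \<omega>)) = ?D"
  proof (rule measure_eqI_generator_eq[where E="range atMost" and \<Omega>=UNIV and A="\<lambda>n. {..(real n, real n)}"])
    show "Int_stable (range atMost :: (real \<times> real) set set)"
    proof (rule Int_stableI_image)
      fix v w :: "real \<times> real"
      show "\<exists>u\<in>UNIV. {..v} \<inter> {..w} = {..u}"
        by (intro bexI[of _ "(min (fst v) (fst w), min (snd v) (snd w))"]) (auto simp: less_eq_prod_def)
    qed
    show "sets (distr M lborel (\<lambda>\<omega>. (incr_max B p q \<omega>, B q \<omega> - B p \<omega>))) = sigma_sets UNIV (range atMost)"
      by (simp add: borel_eq_atMost)
    show "sets ?D = sigma_sets UNIV (range atMost)"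
      by (simp add: borel_eq_atMost)
    show "emeasure (distr M lborel (\<lambda>\<omega>. (incr_max B p q \<omega>, B q \<omega> - B p \<omega>))) X = emeasure ?D X"
      if "X \<in> range atMost" for X
    proof -
      from that obtain v where v: "X = {..v}" by blast
      obtain y z where "v = (y, z)" by (cases v)
      with v have X: "X = {..(y, z)}" by simp
      then have X': "X = {..y} \<times> {..z}" by (auto simp: less_eq_prod_def)
      have "emeasure (distr M lborel (\<lambda>\<omega>. (incr_max B p q \<omega>, B q \<omega> - B p \<omega>))) X =
          emeasure M {\<omega>\<in>space M. incr_max B p q \<omega> \<le> y \<and> B q \<omega> - B p \<omega> \<le> z}"
        using X by (subst emeasure_distr[OF m]) (auto intro!: arg_cong[where f="emeasure M"] simp: less_eq_prod_def)
      also have "\<dots> = (\<integral>\<^sup>+x. ennreal (killed (q - p) y x) * indicator {..z} x \<partial>lborel)"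
        by (rule emeasure_max_end[OF pq])
      also have "\<dots> = (\<integral>\<^sup>+x. (\<integral>\<^sup>+m. ennreal (max_end_density (q - p) m x) * indicator {..y} m \<partial>lborel) * indicator {..z} x \<partial>lborel)"
        using pq by (simp add: nn_integral_max_end_density)
      also have "\<dots> = (\<integral>\<^sup>+x. (\<integral>\<^sup>+m. ennreal (max_end_density (q - p) m x) * indicator {..y} m * indicator {..z} x \<partial>lborel) \<partial>lborel)"
        by (simp add: nn_integral_multc)
      also have "\<dots> = (\<integral>\<^sup>+v. ennreal (max_end_density (q - p) (fst v) (snd v)) * indicator {..y} (fst v) * indicator {..z} (snd v) \<partial>(lborel \<Otimes>\<^sub>M lborel))"
        by (subst lborel_pair.nn_integral_snd[symmetric]) simp_all
      also have "\<dots> = emeasure ?D X"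
        unfolding lborel_prod X'
        by (subst emeasure_density[OF f])
          (auto intro!: nn_integral_cong borel_Times simp: case_prod_unfold split: split_indicator)
      finally show ?thesis .
    qed
    show "(\<Union>n. {..(real n, real n)}) = (UNIV :: (real \<times> real) set)"
    proof -
      have "\<exists>n. a \<le> real n \<and> b \<le> real n" for a b :: real
        using real_arch_simple[of "max a b"] by auto
      then show ?thesis by (auto simp: less_eq_prod_def)
    qed
    show "emeasure (distr M lborel (\<lambda>\<omega>. (incr_max B p q \<omega>, B q \<omega> - B p \<omega>))) {..(real n, real n)} \<noteq> \<infinity>" for n
      using m by (simp add: emeasure_distr emeasure_eq_measure)
  qed auto
qed

end

section \<open>Independence of disjoint intervals\<close>

lemma chain_mono:
  fixes P :: "nat \<Rightarrow> real"
  assumes "\<And>j. j < L \<Longrightarrow> P j < P (Suc j)" "i \<le> j" "j \<le> L"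
  shows "P i \<le> P j"
  using assms(2,3)
proof (induction j rule: dec_induct)
  case (step j)
  then show ?case using assms(1)[of j] by simp
qed simp

context brownian
begin

definition max_end :: "real \<Rightarrow> real \<Rightarrow> 'a \<Rightarrow> real \<times> real" where
  "max_end p q \<omega> = (incr_max B p q \<omega>, B q \<omega> - B p \<omega>)"

lemma max_end_measurable [measurable]:
  "0 \<le> p \<Longrightarrow> p \<le> q \<Longrightarrow> q \<le> 1 \<Longrightarrow> max_end p q \<in> borel_measurable M"
  unfolding max_end_def[abs_def] by (intro borel_measurable_Pair borel_measurable_diff) auto

text \<open>The grids of all \<open>L\<close> intervals are strung into one chain of
  \<open>L * N\<close> increments, which are independent by definition of Brownian motion. Each
  interval owns a block of \<open>N\<close> consecutive increments, and its grid maximum and end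
  value are functions of that block.\<close>

lemma indep_grid_max_end:
  fixes P :: "nat \<Rightarrow> real"
  assumes P: "0 \<le> P 0" "P L \<le> 1" "\<And>j. j < L \<Longrightarrow> P j < P (Suc j)"
  shows "indep_vars (\<lambda>_. borel \<Otimes>\<^sub>M borel) (\<lambda>j \<omega>.
      (Max ((\<lambda>k. B (grid (P j) (P (Suc j)) n k) \<omega> - B (P j) \<omega>) ` {..2 ^ n}), B (P (Suc j)) \<omega> - B (P j) \<omega>)) {..<L}"
proof -
  define N where "N = (2::nat) ^ n"
  have N: "0 < N" by (simp add: N_def)
  have gN: "grid a b n N = b" for a b by (simp add: N_def)
  have P01: "P j \<in> {0..1}" if "j \<le> L" for j
    using chain_mono[of L P 0 j] chain_mono[of L P j L] P(3) P that by auto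
  \<comment> \<open>The quotient by \<open>N\<close> selects the interval and the remainder the grid
    point in it.\<close>
  define u where "u i = grid (P (i div N)) (P (Suc (i div N))) n (i mod N)" for i
  \<comment> \<open>The index \<open>k = N\<close> is included: it is the start of the next block
    and at the same time the right end of the present one.\<close>
  have u: "u (j * N + k) = grid (P j) (P (Suc j)) n k" if "k \<le> N" for j k
  proof (cases "k = N")
    case True
    then have "j * N + k = Suc j * N" by simp
    then show ?thesis using N True gN by (simp only: u_def) simp
  qed (use N that in \<open>auto simp: u_def\<close>)
  have split: "\<exists>j<L. \<exists>k<N. i = j * N + k" if "i < L * N" for i
    using that N by (intro exI[of _ "i div N"] exI[of _ "i mod N"] conjI) (auto simp: less_mult_imp_div_less)
  have u_in: "u i \<in> {0..1}" if "i \<le> L * N" for i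
  proof (cases "i = L * N")
    case True
    then show ?thesis using u[of 0 L] P01[of L] by simp
  next
    case False
    with that have "i < L * N" by linarith
    then obtain j k where "j < L" "k < N" "i = j * N + k" using split by blast
    then show ?thesis using u[of k j] grid_in[of "P j" "P (Suc j)" k n] P(3)[of j] P01[of j] P01[of "Suc j"]
      by (auto simp: N_def)
  qed
  have u_mono: "u i \<le> u (Suc i)" if "i < L * N" for i
  proof -
    from split[OF that] obtain j k where "j < L" "k < N" "i = j * N + k" by blast
    then show ?thesis using u[of k j] u[of "Suc k" j] grid_mono[of "P j" "P (Suc j)" k "Suc k" n] P(3)[of j] by simp
  qed
  let ?X = "\<lambda>i \<omega>. B (u (Suc i)) \<omega> - B (u i) \<omega>"
  have "indep_vars (\<lambda>_. borel) ?X {..<L * N}"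
    by (rule B_indep) (rule u_in, assumption, rule u_mono, assumption)
  then have "indep_vars (\<lambda>j. PiM {j * N..<j * N + N} (\<lambda>_. borel)) (\<lambda>j \<omega>. restrict (\<lambda>i. ?X i \<omega>) {j * N..<j * N + N}) {..<L}"
  proof (rule indep_vars_restrict)
    show "{j * N..<j * N + N} \<subseteq> {..<L * N}" if "j \<in> {..<L}" for j
    proof -
      have "Suc j * N \<le> L * N" using that by (intro mult_le_mono1) auto
      then show ?thesis by auto
    qed
    show "disjoint_family_on (\<lambda>j. {j * N..<j * N + N}) {..<L}"
    unfolding disjoint_family_on_def proof (intro ballI impI)
      fix i j :: nat assume "i \<noteq> j"
      have "x div N = j" if "x \<in> {j * N..<j * N + N}" for x j
        using that by (intro div_nat_eqI) (auto simp: mult.commute)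
      then show "{i * N..<i * N + N} \<inter> {j * N..<j * N + N} = {}" using \<open>i \<noteq> j\<close> by blast
    qed
  qed
  then have "indep_vars (\<lambda>_. borel \<Otimes>\<^sub>M borel) (\<lambda>j \<omega>. (\<lambda>x. (Max ((\<lambda>k. \<Sum>i\<in>{j * N..<j * N + k}. x i) ` {..N}), \<Sum>i\<in>{j * N..<j * N + N}. x i))
      (restrict (\<lambda>i. ?X i \<omega>) {j * N..<j * N + N})) {..<L}"
    by (rule indep_vars_compose2)
      (auto intro!: measurable_Pair borel_measurable_Max borel_measurable_sum measurable_component_singleton)
  moreover have "(\<lambda>x. (Max ((\<lambda>k. \<Sum>i\<in>{j * N..<j * N + k}. x i) ` {..N}), \<Sum>i\<in>{j * N..<j * N + N}. x i))
      (restrict (\<lambda>i. ?X i \<omega>) {j * N..<j * N + N}) =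
    (Max ((\<lambda>k. B (grid (P j) (P (Suc j)) n k) \<omega> - B (P j) \<omega>) ` {..N}), B (P (Suc j)) \<omega> - B (P j) \<omega>)" for j \<omega>
  proof -
    have s1: "(\<Sum>i\<in>{j * N..<j * N + k}. restrict (\<lambda>i. ?X i \<omega>) {j * N..<j * N + N} i) = B (grid (P j) (P (Suc j)) n k) \<omega> - B (P j) \<omega>"
      if "k \<le> N" for k
    proof -
      have "(\<Sum>i\<in>{j * N..<j * N + k}. restrict (\<lambda>i. ?X i \<omega>) {j * N..<j * N + N} i) = (\<Sum>i\<in>{j * N..<j * N + k}. ?X i \<omega>)"
        using that by (intro sum.cong) auto
      also have "\<dots> = B (u (j * N + k)) \<omega> - B (u (j * N)) \<omega>"
        by (rule sum_Suc_diff') simp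
      finally show ?thesis using u[OF that] u[of 0 j] by simp
    qed
    from this[of N] have s2: "(\<Sum>i\<in>{j * N..<j * N + N}. restrict (\<lambda>i. ?X i \<omega>) {j * N..<j * N + N} i) = B (P (Suc j)) \<omega> - B (P j) \<omega>"
      by (simp only: gN order_refl)
    have "(\<lambda>k. \<Sum>i\<in>{j * N..<j * N + k}. restrict (\<lambda>i. ?X i \<omega>) {j * N..<j * N + N} i) ` {..N} =
        (\<lambda>k. B (grid (P j) (P (Suc j)) n k) \<omega> - B (P j) \<omega>) ` {..N}"
      by (rule image_cong) (use s1 in auto)
    then show ?thesis by (simp only: s2)
  qed
  ultimately show ?thesis by (simp only: N_def)
qed

text \<open>For a set \<open>{..(y, z)}\<close> the grid events decrease to the event for the true
  maximum, so by continuity from above the product formula survives the limit.\<close>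

lemma indep_max_end:
  fixes P :: "nat \<Rightarrow> real"
  assumes P: "0 \<le> P 0" "P L \<le> 1" "\<And>j. j < L \<Longrightarrow> P j < P (Suc j)"
  shows "indep_vars (\<lambda>_. borel) (\<lambda>j. max_end (P j) (P (Suc j))) {..<L}"
proof (cases "L = 0")
  case True
  then show ?thesis by (simp add: indep_vars_def indep_sets_def)
next
  case False
  define V where "V n j \<omega> = (Max ((\<lambda>k. B (grid (P j) (P (Suc j)) n k) \<omega> - B (P j) \<omega>) ` {..2 ^ n}), B (P (Suc j)) \<omega> - B (P j) \<omega>)"
    for n j \<omega>
  have indV: "indep_vars (\<lambda>_. borel) (V n) {..<L}" for n
    unfolding V_def[abs_def] borel_prod[symmetric] by (rule indep_grid_max_end[of P, OF P])
  have P01: "0 \<le> P j" "P j \<le> 1" if "j \<le> L" for j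
    using chain_mono[of L P 0 j] chain_mono[of L P j L] P(3) P that by auto
  \<comment> \<open>\<open>indep_vars_finite\<close> asks for the whole space in the generator,
    hence the added \<open>UNIV\<close>.\<close>
  let ?E = "insert UNIV (range atMost) :: (real \<times> real) set set"
  have V_le: "V n j \<omega> \<le> (y, z) \<longleftrightarrow> (\<forall>k\<le>2^n. B (grid (P j) (P (Suc j)) n k) \<omega> - B (P j) \<omega> \<le> y) \<and> B (P (Suc j)) \<omega> - B (P j) \<omega> \<le> z"
    for n j \<omega> y z by (auto simp: V_def)
  \<comment> \<open>A finer grid contains the coarser one, so its maximum is larger and the event
    smaller.\<close>
  have dec: "V n j \<omega> \<in> A" if "V (Suc n) j \<omega> \<in> A" "A \<in> ?E" for n j \<omega> A
  proof (cases "A = UNIV")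
    case False
    with that obtain v where v: "A = {..v}" by blast
    obtain y z where "v = (y, z)" by (cases v)
    with v have A: "A = {..(y, z)}" by simp
    have *: "\<And>k. k \<le> 2 ^ Suc n \<Longrightarrow> B (grid (P j) (P (Suc j)) (Suc n) k) \<omega> - B (P j) \<omega> \<le> y"
      and **: "B (P (Suc j)) \<omega> - B (P j) \<omega> \<le> z"
      using that(1) unfolding A atMost_iff V_le by blast+
    have "B (grid (P j) (P (Suc j)) n k) \<omega> - B (P j) \<omega> \<le> y" if "k \<le> 2^n" for k
      using *[of "2 * k"] that by (simp add: grid_double)
    then show ?thesis using ** unfolding A atMost_iff V_le by blast
  qed simp
  have lim: "max_end (P j) (P (Suc j)) \<omega> \<in> A \<longleftrightarrow> (\<forall>n. V n j \<omega> \<in> A)" if "A \<in> ?E" "j < L" "\<omega> \<in> space M" for j \<omega> A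
  proof (cases "A = UNIV")
    case False
    with that obtain v where v: "A = {..v}" by blast
    obtain y z where "v = (y, z)" by (cases v)
    with v have A: "A = {..(y, z)}" by simp
    have "incr_max B (P j) (P (Suc j)) \<omega> \<le> y \<longleftrightarrow> (\<forall>n. \<forall>k\<le>2^n. B (grid (P j) (P (Suc j)) n k) \<omega> - B (P j) \<omega> \<le> y)"
      unfolding not_less[symmetric] incr_max_def using that P01[of j] P01[of "Suc j"] P(3)[of j]
      by (subst less_SUP_iff_grid) (auto intro!: continuous_intros B_continuous_on)
    then show ?thesis unfolding A atMost_iff V_le by (auto simp: max_end_def)
  qed simp
  show ?thesis
  proof (subst indep_vars_finite[where E="\<lambda>_. ?E"])
    show "sets borel = sigma_sets (space (borel :: (real \<times> real) measure)) ?E"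
    proof -
      have "sigma_sets UNIV ?E = sigma_sets UNIV (range atMost :: (real \<times> real) set set)"
        by (intro sigma_sets_eqI) (auto intro: sigma_sets_top sigma_sets.Basic)
      then show ?thesis by (simp add: borel_eq_atMost)
    qed
    show "random_variable borel (max_end (P j) (P (Suc j)))" if "j \<in> {..<L}" for j
      using that P01[of j] P01[of "Suc j"] P(3)[of j] by auto
    have "{..v} \<inter> {..w} \<in> range atMost" for v w :: "real \<times> real"
      by (intro range_eqI[of _ _ "(min (fst v) (fst w), min (snd v) (snd w))"]) (auto simp: less_eq_prod_def)
    then show "Int_stable ?E" by (auto simp: Int_stable_def)
    show "\<forall>A\<in>{..<L} \<rightarrow> ?E. prob (\<Inter>j\<in>{..<L}. max_end (P j) (P (Suc j)) -` A j \<inter> space M) =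
        (\<Prod>j\<in>{..<L}. prob (max_end (P j) (P (Suc j)) -` A j \<inter> space M))"
    proof
      fix A assume A: "A \<in> {..<L} \<rightarrow> ?E"
      have AE: "A j \<in> ?E" if "j < L" for j
        by (rule PiE[OF A, of j]) (use that in simp_all)
      have A_borel: "A j \<in> sets borel" if "j < L" for j
      proof -
        have "X \<in> sets borel" if "X \<in> range atMost" for X :: "(real \<times> real) set"
        proof -
          have "X \<in> sets (sigma UNIV (range (\<lambda>a. {..a :: real \<times> real})))"
            using that by (subst sets_measure_of) (auto intro: sigma_sets.Basic)
          then show ?thesis by (simp only: borel_eq_atMost)
        qed
        then show ?thesis using AE[OF that] by (metis insert_iff space_borel sets.top)
      qed
      have V_rv: "V n j \<in> borel_measurable M" if "j < L" for n j
        using indV that by (auto simp: indep_vars_def)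
      have Vev: "V n j -` A j \<inter> space M \<in> events" if "j < L" for n j
        using V_rv A_borel that by (intro measurable_sets) auto
      have L: "{..<L} \<noteq> {}" using False by auto
      have j: "(\<lambda>n. prob (V n j -` A j \<inter> space M)) \<longlonglongrightarrow> prob (max_end (P j) (P (Suc j)) -` A j \<inter> space M)" if "j < L" for j
      proof -
        have "(\<lambda>n. prob (V n j -` A j \<inter> space M)) \<longlonglongrightarrow> prob (\<Inter>n. V n j -` A j \<inter> space M)"
        proof (intro finite_Lim_measure_decseq decseq_SucI)
          show "range (\<lambda>n. V n j -` A j \<inter> space M) \<subseteq> events" using Vev[OF that] by blast
          show "V (Suc n) j -` A j \<inter> space M \<subseteq> V n j -` A j \<inter> space M" for n
            using dec[OF _ AE[OF that]] by blast
        qed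
        also have "(\<Inter>n. V n j -` A j \<inter> space M) = max_end (P j) (P (Suc j)) -` A j \<inter> space M"
          using lim[OF AE[OF that] that] by blast
        finally show ?thesis .
      qed
      have "(\<lambda>n. prob (\<Inter>j\<in>{..<L}. V n j -` A j \<inter> space M)) \<longlonglongrightarrow> prob (\<Inter>n. \<Inter>j\<in>{..<L}. V n j -` A j \<inter> space M)"
      proof (intro finite_Lim_measure_decseq decseq_SucI)
        show "range (\<lambda>n. \<Inter>j\<in>{..<L}. V n j -` A j \<inter> space M) \<subseteq> events"
        proof (intro subsetI, elim rangeE)
          fix X n assume X: "X = (\<Inter>j\<in>{..<L}. V n j -` A j \<inter> space M)"
          show "X \<in> events" unfolding X using Vev L by (intro sets.finite_INT) auto
        qed
        show "(\<Inter>j\<in>{..<L}. V (Suc n) j -` A j \<inter> space M) \<subseteq> (\<Inter>j\<in>{..<L}. V n j -` A j \<inter> space M)" for n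
        proof
          fix \<omega> assume *: "\<omega> \<in> (\<Inter>j\<in>{..<L}. V (Suc n) j -` A j \<inter> space M)"
          have "V n j \<omega> \<in> A j \<and> \<omega> \<in> space M" if "j < L" for j
            using INT_D[OF *, of j] dec[OF _ AE[OF that], of n j \<omega>] that by blast
          then show "\<omega> \<in> (\<Inter>j\<in>{..<L}. V n j -` A j \<inter> space M)" by blast
        qed
      qed
      also have "(\<Inter>n. \<Inter>j\<in>{..<L}. V n j -` A j \<inter> space M) = (\<Inter>j\<in>{..<L}. max_end (P j) (P (Suc j)) -` A j \<inter> space M)"
      proof -
        have "(\<forall>n. \<forall>j<L. V n j \<omega> \<in> A j) \<longleftrightarrow> (\<forall>j<L. max_end (P j) (P (Suc j)) \<omega> \<in> A j)" if "\<omega> \<in> space M" for \<omega>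
          using lim[OF AE _ that] by metis
        then show ?thesis using L by (auto simp: set_eq_iff)
      qed
      finally have "(\<lambda>n. prob (\<Inter>j\<in>{..<L}. V n j -` A j \<inter> space M)) \<longlonglongrightarrow> prob (\<Inter>j\<in>{..<L}. max_end (P j) (P (Suc j)) -` A j \<inter> space M)" .
      moreover have "prob (\<Inter>j\<in>{..<L}. V n j -` A j \<inter> space M) = (\<Prod>j\<in>{..<L}. prob (V n j -` A j \<inter> space M))" for n
        using indV L A_borel by (intro indep_varsD_finite) auto
      moreover have "(\<lambda>n. \<Prod>j\<in>{..<L}. prob (V n j -` A j \<inter> space M)) \<longlonglongrightarrow> (\<Prod>j\<in>{..<L}. prob (max_end (P j) (P (Suc j)) -` A j \<inter> space M))"
        using j by (intro tendsto_prod) auto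
      ultimately show "prob (\<Inter>j\<in>{..<L}. max_end (P j) (P (Suc j)) -` A j \<inter> space M) =
        (\<Prod>j\<in>{..<L}. prob (max_end (P j) (P (Suc j)) -` A j \<inter> space M))"
        by (metis (lifting) LIMSEQ_unique ext)
    qed
  qed (use False in auto)
qed

end

section \<open>Product laws and integrals over three independent intervals\<close>

lemma (in prob_space) indep_vars_pair_distr:
  assumes ind: "indep_vars (\<lambda>_. N) U I" and ij: "i \<in> I" "j \<in> I" "i \<noteq> j"
  shows "distr M (N \<Otimes>\<^sub>M N) (\<lambda>\<omega>. (U i \<omega>, U j \<omega>)) = distr M N (U i) \<Otimes>\<^sub>M distr M N (U j)"
proof (rule pair_measure_eqI[symmetric])
  have [measurable]: "U i \<in> measurable M N" "U j \<in> measurable M N"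
    using ind ij by (auto simp: indep_vars_def)
  show "sigma_finite_measure (distr M N (U i))" "sigma_finite_measure (distr M N (U j))"
    by (auto intro!: prob_space_imp_sigma_finite prob_space_distr)
  fix A B assume AB: "A \<in> sets (distr M N (U i))" "B \<in> sets (distr M N (U j))"
  have "prob (\<Inter>k\<in>{i, j}. U k -` (if k = i then A else B) \<inter> space M) =
      (\<Prod>k\<in>{i, j}. prob (U k -` (if k = i then A else B) \<inter> space M))"
    using AB ij by (intro indep_varsD_finite[OF indep_vars_subset[OF ind]]) auto
  moreover have "(\<Inter>k\<in>{i, j}. U k -` (if k = i then A else B) \<inter> space M) = (\<lambda>\<omega>. (U i \<omega>, U j \<omega>)) -` (A \<times> B) \<inter> space M"
    using ij by auto
  ultimately show "emeasure (distr M N (U i)) A * emeasure (distr M N (U j)) B =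
      emeasure (distr M (N \<Otimes>\<^sub>M N) (\<lambda>\<omega>. (U i \<omega>, U j \<omega>))) (A \<times> B)"
    using AB ij by (simp add: emeasure_distr emeasure_eq_measure ennreal_mult)
qed auto

text \<open>Grouping the indices as \<open>{i}\<close> and \<open>{j, k}\<close> separates the first
  variable from the other two; the pair lemma then splits those.\<close>

lemma (in prob_space) indep_vars_triple_distr:
  assumes ind: "indep_vars (\<lambda>_. N) U I" and ijk: "i \<in> I" "j \<in> I" "k \<in> I" "distinct [i, j, k]"
  shows "distr M (N \<Otimes>\<^sub>M (N \<Otimes>\<^sub>M N)) (\<lambda>\<omega>. (U i \<omega>, U j \<omega>, U k \<omega>)) =
    distr M N (U i) \<Otimes>\<^sub>M (distr M N (U j) \<Otimes>\<^sub>M distr M N (U k))"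
proof -
  have [measurable]: "U i \<in> measurable M N" "U j \<in> measurable M N" "U k \<in> measurable M N"
    using ind ijk by (auto simp: indep_vars_def)
  have "distr M N (U i) \<Otimes>\<^sub>M distr M (N \<Otimes>\<^sub>M N) (\<lambda>\<omega>. (U j \<omega>, U k \<omega>)) =
      distr M (N \<Otimes>\<^sub>M (N \<Otimes>\<^sub>M N)) (\<lambda>\<omega>. (U i \<omega>, U j \<omega>, U k \<omega>))"
  proof (rule pair_measure_eqI)
    show "sigma_finite_measure (distr M N (U i))" "sigma_finite_measure (distr M (N \<Otimes>\<^sub>M N) (\<lambda>\<omega>. (U j \<omega>, U k \<omega>)))"
      by (auto intro!: prob_space_imp_sigma_finite prob_space_distr)
    fix A B assume "A \<in> sets (distr M N (U i))" "B \<in> sets (distr M (N \<Otimes>\<^sub>M N) (\<lambda>\<omega>. (U j \<omega>, U k \<omega>)))"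
    then have [measurable]: "A \<in> sets N" "B \<in> sets (N \<Otimes>\<^sub>M N)" by auto
    let ?Pi = "PiM {i} (\<lambda>_. N)" and ?Pjk = "PiM {j, k} (\<lambda>_. N)"
    have ind': "indep_var ?Pi (\<lambda>\<omega>. restrict (\<lambda>i. U i \<omega>) {i}) ?Pjk (\<lambda>\<omega>. restrict (\<lambda>i. U i \<omega>) {j, k})"
      using ijk by (intro indep_var_restrict[OF ind]) auto
    \<comment> \<open>Independence of the groups is stated on function spaces, so \<open>A\<close>
      and \<open>B\<close> are pulled back to cylinder sets there.\<close>
    define A' B' where "A' = (\<lambda>x. x i) -` A \<inter> space ?Pi" and "B' = (\<lambda>x. (x j, x k)) -` B \<inter> space ?Pjk"
    have "A' \<in> sets ?Pi" unfolding A'_def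
      by (intro measurable_sets[OF measurable_component_singleton]) auto
    moreover have "B' \<in> sets ?Pjk" unfolding B'_def
      by (rule measurable_sets[of _ _ "N \<Otimes>\<^sub>M N"]) (auto intro!: measurable_Pair measurable_component_singleton)
    ultimately have "prob ((\<lambda>\<omega>. (restrict (\<lambda>i. U i \<omega>) {i}, restrict (\<lambda>i. U i \<omega>) {j, k})) -` (A' \<times> B') \<inter> space M) =
       prob ((\<lambda>\<omega>. restrict (\<lambda>i. U i \<omega>) {i}) -` A' \<inter> space M) * prob ((\<lambda>\<omega>. restrict (\<lambda>i. U i \<omega>) {j, k}) -` B' \<inter> space M)"
      by (rule indep_varD[OF ind'])
    moreover have "(\<lambda>\<omega>. (restrict (\<lambda>i. U i \<omega>) {i}, restrict (\<lambda>i. U i \<omega>) {j, k})) -` (A' \<times> B') \<inter> space M =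
        (\<lambda>\<omega>. (U i \<omega>, U j \<omega>, U k \<omega>)) -` (A \<times> B) \<inter> space M"
      "(\<lambda>\<omega>. restrict (\<lambda>i. U i \<omega>) {i}) -` A' \<inter> space M = U i -` A \<inter> space M"
      "(\<lambda>\<omega>. restrict (\<lambda>i. U i \<omega>) {j, k}) -` B' \<inter> space M = (\<lambda>\<omega>. (U j \<omega>, U k \<omega>)) -` B \<inter> space M"
      using ijk measurable_space[of "U i" M N] measurable_space[of "U j" M N] measurable_space[of "U k" M N]
      by (auto simp: A'_def B'_def space_PiM)
    ultimately show "emeasure (distr M N (U i)) A * emeasure (distr M (N \<Otimes>\<^sub>M N) (\<lambda>\<omega>. (U j \<omega>, U k \<omega>))) B =
      emeasure (distr M (N \<Otimes>\<^sub>M (N \<Otimes>\<^sub>M N)) (\<lambda>\<omega>. (U i \<omega>, U j \<omega>, U k \<omega>))) (A \<times> B)"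
      by (simp add: emeasure_distr emeasure_eq_measure ennreal_mult)
  qed auto
  also have "distr M (N \<Otimes>\<^sub>M N) (\<lambda>\<omega>. (U j \<omega>, U k \<omega>)) = distr M N (U j) \<Otimes>\<^sub>M distr M N (U k)"
    using ijk by (intro indep_vars_pair_distr[OF ind]) auto
  finally show ?thesis by simp
qed

definition max_end_law :: "real \<Rightarrow> (real \<times> real) measure" where
  "max_end_law T = density lborel (\<lambda>(m, z). ennreal (max_end_density T m z))"

lemma sets_max_end_law [measurable_cong]: "sets (max_end_law T) = sets (borel \<Otimes>\<^sub>M borel)"
  unfolding max_end_law_def by (simp only: sets_density sets_lborel borel_prod)

lemma nn_integral_max_end_law:
  assumes [measurable]: "H \<in> borel_measurable (borel \<Otimes>\<^sub>M borel)"
  shows "(\<integral>\<^sup>+u. H u \<partial>max_end_law T) = (\<integral>\<^sup>+z. \<integral>\<^sup>+m. ennreal (max_end_density T m z) * H (m, z) \<partial>lborel \<partial>lborel)"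
proof -
  have "(\<integral>\<^sup>+u. H u \<partial>max_end_law T) = (\<integral>\<^sup>+u. ennreal (max_end_density T (fst u) (snd u)) * H u \<partial>(lborel \<Otimes>\<^sub>M lborel))"
    unfolding max_end_law_def lborel_prod[symmetric]
    by (subst nn_integral_density) (auto simp: case_prod_unfold)
  also have "\<dots> = (\<integral>\<^sup>+z. \<integral>\<^sup>+m. ennreal (max_end_density T m z) * H (m, z) \<partial>lborel \<partial>lborel)"
    by (subst lborel_pair.nn_integral_snd[symmetric]) simp_all
  finally show ?thesis .
qed

text \<open>Keeping the maximum below a level and integrating it out leaves the killed density of
  the end value. The level may depend on the end value: the level \<open>h\<close> is absolute,
  while for the interval before the argmax it is expressed through the position reached at the end
  of that interval.\<close>

lemma nn_integral_max_end_law_killed: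
  assumes T: "0 < T" and [measurable]: "G \<in> borel_measurable borel" "Y \<in> borel_measurable borel"
  shows "(\<integral>\<^sup>+u. G (snd u) * indicator {..Y (snd u)} (fst u) \<partial>max_end_law T) =
      (\<integral>\<^sup>+z. ennreal (killed T (Y z) z) * G z \<partial>lborel)"
    and "(\<integral>\<^sup>+u. G (snd u) * indicator {..<Y (snd u)} (fst u) \<partial>max_end_law T) =
      (\<integral>\<^sup>+z. ennreal (killed T (Y z) z) * G z \<partial>lborel)"
proof -
  have [measurable]: "(\<lambda>u. indicator {..Y (snd u)} (fst u) :: ennreal) \<in> borel_measurable (borel \<Otimes>\<^sub>M borel)"
    "(\<lambda>u. indicator {..<Y (snd u)} (fst u) :: ennreal) \<in> borel_measurable (borel \<Otimes>\<^sub>M borel)"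
    unfolding indicator_def lessThan_iff atMost_iff by measurable
  show "(\<integral>\<^sup>+u. G (snd u) * indicator {..Y (snd u)} (fst u) \<partial>max_end_law T) =
      (\<integral>\<^sup>+z. ennreal (killed T (Y z) z) * G z \<partial>lborel)"
    by (subst nn_integral_max_end_law)
      (simp_all add: nn_integral_max_end_density[OF T, symmetric] nn_integral_cmult mult_ac)
  show "(\<integral>\<^sup>+u. G (snd u) * indicator {..<Y (snd u)} (fst u) \<partial>max_end_law T) =
      (\<integral>\<^sup>+z. ennreal (killed T (Y z) z) * G z \<partial>lborel)"
    by (subst nn_integral_max_end_law)
      (simp_all add: nn_integral_max_end_density_less[OF T, symmetric] nn_integral_cmult mult_ac)
qed

lemma nn_integral_lborel_swap:
  fixes f :: "real \<Rightarrow> real \<Rightarrow> ennreal"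
  assumes "case_prod f \<in> borel_measurable (borel \<Otimes>\<^sub>M borel)"
  shows "(\<integral>\<^sup>+x. \<integral>\<^sup>+y. f x y \<partial>lborel \<partial>lborel) = (\<integral>\<^sup>+y. \<integral>\<^sup>+x. f x y \<partial>lborel \<partial>lborel)"
proof (rule lborel_pair.Fubini'[symmetric])
  show "case_prod f \<in> borel_measurable (lborel \<Otimes>\<^sub>M lborel)" using assms by simp
qed

lemma nn_integral_lborel_shift:
  fixes f :: "real \<Rightarrow> ennreal"
  assumes [measurable]: "f \<in> borel_measurable borel"
  shows "(\<integral>\<^sup>+x. f x \<partial>lborel) = (\<integral>\<^sup>+x. f (x - a) \<partial>lborel)"
  using nn_integral_real_affine[of f 1 "- a"] by (simp add: add.commute)

context brownian
begin

lemma distr_max_end: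
  assumes "0 \<le> p" "p < q" "q \<le> 1"
  shows "distr M borel (max_end p q) = max_end_law (q - p)"
proof -
  have "distr M borel (max_end p q) = distr M lborel (max_end p q)"
    by (intro distr_cong) auto
  then show ?thesis
    using max_end_distributed[OF assms] by (simp add: distributed_def max_end_law_def max_end_def[abs_def])
qed

text \<open>The middle interval is integrated outermost because its maximum is the level with which
  the other two are compared.\<close>

lemma nn_integral_three_max_end:
  assumes pq: "0 < p" "p < q" "q < 1"
    and F[measurable]: "F \<in> borel_measurable ((borel \<Otimes>\<^sub>M borel) \<Otimes>\<^sub>M ((borel \<Otimes>\<^sub>M borel) \<Otimes>\<^sub>M (borel \<Otimes>\<^sub>M borel)))"
  shows "(\<integral>\<^sup>+\<omega>. F (max_end p q \<omega>, max_end q 1 \<omega>, max_end 0 p \<omega>) \<partial>M) =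
    (\<integral>\<^sup>+u1. \<integral>\<^sup>+u2. \<integral>\<^sup>+u0. F (u1, u2, u0) \<partial>max_end_law p \<partial>max_end_law (1 - q) \<partial>max_end_law (q - p))"
proof -
  define P where "P j = (if j = 0 then 0 else if j = 1 then p else if j = 2 then q else 1)" for j :: nat
  have P: "P j < P (Suc j)" if "j < 3" for j
    using pq that by (auto simp: P_def)
  have [simp]: "P 0 = 0" "P (Suc 0) = p" "P 2 = q" "P (Suc 2) = 1" "P (Suc (Suc 0)) = q" "P 3 = 1"
    by (auto simp: P_def)
  have ind: "indep_vars (\<lambda>_. borel) (\<lambda>j. max_end (P j) (P (Suc j))) {..<3}"
    by (rule indep_max_end) (use P in auto)
  have sf: "sigma_finite_measure (max_end_law (b - a))" if "0 \<le> a" "a < b" "b \<le> 1" for a b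
    unfolding distr_max_end[OF that, symmetric] using that
    by (auto intro!: prob_space_imp_sigma_finite prob_space_distr)
  interpret D0: sigma_finite_measure "max_end_law p" using sf[of 0 p] pq by simp
  interpret D2: sigma_finite_measure "max_end_law (1 - q)" using sf[of q 1] pq by simp
  interpret D20: pair_sigma_finite "max_end_law (1 - q)" "max_end_law p" ..
  have meas: "(\<lambda>\<omega>. (max_end p q \<omega>, max_end q 1 \<omega>, max_end 0 p \<omega>)) \<in> measurable M (borel \<Otimes>\<^sub>M (borel \<Otimes>\<^sub>M borel))"
    using pq by (intro measurable_Pair) auto
  have "distr M (borel \<Otimes>\<^sub>M (borel \<Otimes>\<^sub>M borel)) (\<lambda>\<omega>. (max_end p q \<omega>, max_end q 1 \<omega>, max_end 0 p \<omega>)) =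
      max_end_law (q - p) \<Otimes>\<^sub>M (max_end_law (1 - q) \<Otimes>\<^sub>M max_end_law p)"
    using indep_vars_triple_distr[OF ind, of 1 2 0] pq by (simp add: distr_max_end)
  then have "(\<integral>\<^sup>+\<omega>. F (max_end p q \<omega>, max_end q 1 \<omega>, max_end 0 p \<omega>) \<partial>M) =
      (\<integral>\<^sup>+v. F v \<partial>(max_end_law (q - p) \<Otimes>\<^sub>M (max_end_law (1 - q) \<Otimes>\<^sub>M max_end_law p)))"
    using F meas by (subst nn_integral_distr[symmetric, OF meas]) (simp_all add: borel_prod)
  also have "\<dots> = (\<integral>\<^sup>+u1. \<integral>\<^sup>+v. F (u1, v) \<partial>(max_end_law (1 - q) \<Otimes>\<^sub>M max_end_law p) \<partial>max_end_law (q - p))"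
    by (rule D20.nn_integral_fst[symmetric]) measurable
  also have "\<dots> = (\<integral>\<^sup>+u1. \<integral>\<^sup>+u2. \<integral>\<^sup>+u0. F (u1, u2, u0) \<partial>max_end_law p \<partial>max_end_law (1 - q) \<partial>max_end_law (q - p))"
  proof (intro nn_integral_cong)
    fix u1 :: "real \<times> real"
    have "u1 \<in> space (borel \<Otimes>\<^sub>M borel)" by (simp add: borel_prod)
    then show "(\<integral>\<^sup>+v. F (u1, v) \<partial>(max_end_law (1 - q) \<Otimes>\<^sub>M max_end_law p)) = (\<integral>\<^sup>+u2. \<integral>\<^sup>+u0. F (u1, u2, u0) \<partial>max_end_law p \<partial>max_end_law (1 - q))"
      by (intro D0.nn_integral_fst[symmetric, where f="\<lambda>v. F (u1, v)"]) measurable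
  qed
  finally show ?thesis .
qed

text \<open>The indicator describes the event that the first argmax lies in \<open>{p<..q}\<close>,
  see \<open>first_argmax_between\<close>. Integrating out the outer two maxima yields the
  \<open>killed\<close> factors. What remains is a change from increments to the positions
  \<open>z\<close>, \<open>w\<close>, the maximum \<open>h\<close> and the final value
  \<open>c\<close>, which is a shear with determinant 1.\<close>

lemma nn_integral_argmax_between:
  assumes pq: "0 < p" "p < q" "q < 1"
    and F[measurable]: "F \<in> borel_measurable (borel \<Otimes>\<^sub>M (borel \<Otimes>\<^sub>M (borel \<Otimes>\<^sub>M borel)))"
  shows "(\<integral>\<^sup>+\<omega>. F (B p \<omega>, B q \<omega>, B p \<omega> + incr_max B p q \<omega>, B 1 \<omega>) *
        indicator {\<omega>. incr_max B 0 p \<omega> < B p \<omega> + incr_max B p q \<omega> \<and>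
          B q \<omega> + incr_max B q 1 \<omega> \<le> B p \<omega> + incr_max B p q \<omega>} \<omega> \<partial>M) =
    (\<integral>\<^sup>+z. \<integral>\<^sup>+w. \<integral>\<^sup>+h. \<integral>\<^sup>+c. ennreal (killed p h z * max_end_density (q - p) (h - z) (w - z) * killed (1 - q) (h - w) (c - w))
        * F (z, w, h, c) \<partial>lborel \<partial>lborel \<partial>lborel \<partial>lborel)"
proof -
  have [measurable]: "(\<lambda>v. F (a v, b v, c v, d v)) \<in> borel_measurable N"
    if [measurable]: "a \<in> borel_measurable N" "b \<in> borel_measurable N" "c \<in> borel_measurable N" "d \<in> borel_measurable N"
    for a b c d and N :: "'b measure"
    by measurable
  define W where "W z1 z2 m2 z3 = ennreal (max_end_density (q - p) m2 z2) * (ennreal (killed (1 - q) (m2 - z2) z3) *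
      (ennreal (killed p (z1 + m2) z1) * F (z1, z1 + z2, z1 + m2, z1 + z2 + z3)))" for z1 z2 m2 z3
  have [measurable]: "(\<lambda>v. W (a v) (b v) (c v) (d v)) \<in> borel_measurable N"
    if [measurable]: "a \<in> borel_measurable N" "b \<in> borel_measurable N" "c \<in> borel_measurable N" "d \<in> borel_measurable N"
    for a b c d and N :: "'b measure"
    unfolding W_def by measurable
  have [measurable]: "(\<lambda>v. indicator {..<a v} (b v) :: ennreal) \<in> borel_measurable N"
    "(\<lambda>v. indicator {..a v} (b v) :: ennreal) \<in> borel_measurable N"
    if [measurable]: "a \<in> borel_measurable N" "b \<in> borel_measurable N"
    for a b :: "'b \<Rightarrow> real" and N
    unfolding indicator_def lessThan_iff atMost_iff by measurable
  \<comment> \<open>Both comparisons are solved for the maximum that is integrated next: weakly for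
    the later interval, strictly for the earlier one.\<close>
  define \<Phi> where "\<Phi> u1 u2 u0 = (F (snd u0, snd u0 + snd u1, snd u0 + fst u1, snd u0 + snd u1 + snd u2) *
      indicator {..fst u1 - snd u1} (fst u2)) * indicator {..<snd u0 + fst u1} (fst u0)"
    for u1 u2 u0 :: "real \<times> real"
  have "(\<integral>\<^sup>+\<omega>. F (B p \<omega>, B q \<omega>, B p \<omega> + incr_max B p q \<omega>, B 1 \<omega>) *
        indicator {\<omega>. incr_max B 0 p \<omega> < B p \<omega> + incr_max B p q \<omega> \<and>
          B q \<omega> + incr_max B q 1 \<omega> \<le> B p \<omega> + incr_max B p q \<omega>} \<omega> \<partial>M) =
      (\<integral>\<^sup>+\<omega>. (\<lambda>(u1, u2, u0). \<Phi> u1 u2 u0) (max_end p q \<omega>, max_end q 1 \<omega>, max_end 0 p \<omega>) \<partial>M)"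
    by (intro nn_integral_cong) (auto simp: max_end_def \<Phi>_def B_0 indicator_def)
  also have "\<dots> = (\<integral>\<^sup>+u1. \<integral>\<^sup>+u2. \<integral>\<^sup>+u0. \<Phi> u1 u2 u0 \<partial>max_end_law p \<partial>max_end_law (1 - q) \<partial>max_end_law (q - p))"
    by (subst nn_integral_three_max_end[OF pq]) (auto simp: \<Phi>_def[abs_def] case_prod_unfold)
  also have "\<dots> = (\<integral>\<^sup>+u1. \<integral>\<^sup>+u2. (\<integral>\<^sup>+z1. ennreal (killed p (z1 + fst u1) z1) * F (z1, z1 + snd u1, z1 + fst u1, z1 + snd u1 + snd u2) \<partial>lborel) *
      indicator {..fst u1 - snd u1} (fst u2) \<partial>max_end_law (1 - q) \<partial>max_end_law (q - p))"
    unfolding \<Phi>_def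
    by (subst nn_integral_max_end_law_killed(2)) (use pq in \<open>simp_all add: nn_integral_multc[symmetric] mult.assoc\<close>)
  also have "\<dots> = (\<integral>\<^sup>+u1. \<integral>\<^sup>+z3. ennreal (killed (1 - q) (fst u1 - snd u1) z3) *
      (\<integral>\<^sup>+z1. ennreal (killed p (z1 + fst u1) z1) * F (z1, z1 + snd u1, z1 + fst u1, z1 + snd u1 + z3) \<partial>lborel) \<partial>lborel \<partial>max_end_law (q - p))"
    using pq by (subst nn_integral_max_end_law_killed(1)) simp_all
  also have "\<dots> = (\<integral>\<^sup>+z2. \<integral>\<^sup>+m2. \<integral>\<^sup>+z3. \<integral>\<^sup>+z1. W z1 z2 m2 z3 \<partial>lborel \<partial>lborel \<partial>lborel \<partial>lborel)"
    by (subst nn_integral_max_end_law) (simp_all add: W_def nn_integral_cmult)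
  \<comment> \<open>The swaps bring the variables into an order in which each shift below is by an
    amount fixed by the outer variables.\<close>
  also have "\<dots> = (\<integral>\<^sup>+z2. \<integral>\<^sup>+m2. \<integral>\<^sup>+z1. \<integral>\<^sup>+z3. W z1 z2 m2 z3 \<partial>lborel \<partial>lborel \<partial>lborel \<partial>lborel)"
    by (intro nn_integral_cong nn_integral_lborel_swap) measurable
  also have "\<dots> = (\<integral>\<^sup>+z2. \<integral>\<^sup>+z1. \<integral>\<^sup>+m2. \<integral>\<^sup>+z3. W z1 z2 m2 z3 \<partial>lborel \<partial>lborel \<partial>lborel \<partial>lborel)"
    by (intro nn_integral_cong nn_integral_lborel_swap) measurable
  also have "\<dots> = (\<integral>\<^sup>+z1. \<integral>\<^sup>+z2. \<integral>\<^sup>+m2. \<integral>\<^sup>+z3. W z1 z2 m2 z3 \<partial>lborel \<partial>lborel \<partial>lborel \<partial>lborel)"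
    by (intro nn_integral_lborel_swap) measurable
  also have "\<dots> = (\<integral>\<^sup>+z. \<integral>\<^sup>+z2. \<integral>\<^sup>+m2. \<integral>\<^sup>+c. W z z2 m2 (c - (z + z2)) \<partial>lborel \<partial>lborel \<partial>lborel \<partial>lborel)"
    by (intro nn_integral_cong nn_integral_lborel_shift) measurable
  also have "\<dots> = (\<integral>\<^sup>+z. \<integral>\<^sup>+z2. \<integral>\<^sup>+h. \<integral>\<^sup>+c. W z z2 (h - z) (c - (z + z2)) \<partial>lborel \<partial>lborel \<partial>lborel \<partial>lborel)"
    by (intro nn_integral_cong nn_integral_lborel_shift) measurable
  also have "\<dots> = (\<integral>\<^sup>+z. \<integral>\<^sup>+w. \<integral>\<^sup>+h. \<integral>\<^sup>+c. W z (w - z) (h - z) (c - (z + (w - z))) \<partial>lborel \<partial>lborel \<partial>lborel \<partial>lborel)"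
    by (intro nn_integral_cong nn_integral_lborel_shift) measurable
  also have "\<dots> = (\<integral>\<^sup>+z. \<integral>\<^sup>+w. \<integral>\<^sup>+h. \<integral>\<^sup>+c. ennreal (killed p h z * max_end_density (q - p) (h - z) (w - z) * killed (1 - q) (h - w) (c - w))
        * F (z, w, h, c) \<partial>lborel \<partial>lborel \<partial>lborel \<partial>lborel)"
    using pq by (intro nn_integral_cong) (simp add: W_def ennreal_mult killed_nonneg max_end_density_nonneg mult_ac)
  finally show ?thesis .
qed

end

section \<open>The joint law\<close>

definition argmax_domain :: "real \<Rightarrow> real \<Rightarrow> real \<Rightarrow> bool" where
  "argmax_domain \<theta> h c \<longleftrightarrow> 0 < \<theta> \<and> \<theta> < 1 \<and> max 0 c < h"

text \<open>For \<open>t < \<theta>\<close> the factors are the motion from 0 to \<open>x\<close>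
  killed at \<open>h\<close>, the climb from \<open>x\<close> to \<open>h\<close> and, backwards in
  time, the climb from \<open>c\<close> to \<open>h\<close>; for \<open>\<theta> < t\<close> the
  roles of the two sides are exchanged. The factor 2 compensates the two constants
  \<open>1 / sqrt (2 * pi)\<close>, leaving \<open>1 / pi\<close>.\<close>

lemma joint_density_eq:
  "joint_density t x \<theta> h c =
     (if argmax_domain \<theta> h c \<and> x < h then
        if t < \<theta> then 2 * passage (h - c) (1 - \<theta>) * passage (h - x) (\<theta> - t) * g t (h - x) h
        else if \<theta> < t then 2 * passage h \<theta> * passage (h - x) (t - \<theta>) * g (1 - t) (h - x) (h - c)
        else 0
      else 0)"
proof -
  have twice_passage: "2 * passage a u * passage b v = a * b / (pi * u powr (3/2) * v powr (3/2)) * exp (- b\<^sup>2 / (2 * v) - a\<^sup>2 / (2 * u))"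
    if "0 < u" "0 < v" for a b u v
  proof -
    have e: "exp (- b\<^sup>2 / (2 * v) - a\<^sup>2 / (2 * u)) = exp (- a\<^sup>2 / (2 * u)) * exp (- b\<^sup>2 / (2 * v))"
      by (simp add: exp_add[symmetric])
    have alg: "2 * (a / (r * x) * y) * (b / (r * z) * w) = 2 * (a * b) / ((r * r) * (x * z)) * (y * w)" for r x y z w :: real
      by (simp add: mult_ac)
    have f: "2 * passage a u * passage b v = 2 * (a * b) / ((sqrt (2 * pi) * sqrt (2 * pi)) * (u powr (3/2) * v powr (3/2))) *
        (exp (- a\<^sup>2 / (2 * u)) * exp (- b\<^sup>2 / (2 * v)))"
      unfolding passage_powr[OF that(1)] passage_powr[OF that(2)] by (rule alg)
    have s: "sqrt (2 * pi) * sqrt (2 * pi) = 2 * pi" by simp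
    show ?thesis unfolding e f s by simp
  qed
  show ?thesis
    unfolding joint_density_def argmax_domain_def by (auto simp: twice_passage)
qed

lemma joint_density_measurable [measurable]:
  assumes [measurable]: "x \<in> borel_measurable M" "\<theta> \<in> borel_measurable M" "h \<in> borel_measurable M" "c \<in> borel_measurable M"
  shows "(\<lambda>v. joint_density t (x v) (\<theta> v) (h v) (c v)) \<in> borel_measurable M"
  unfolding joint_density_eq argmax_domain_def by measurable

lemma nn_integral_lborel_reflect:
  fixes f :: "real \<Rightarrow> ennreal"
  assumes [measurable]: "f \<in> borel_measurable borel"
  shows "(\<integral>\<^sup>+x. f x \<partial>lborel) = (\<integral>\<^sup>+x. f (a - x) \<partial>lborel)"
  using nn_integral_real_affine[of f "-1" a] by simp

text \<open>In terms of the distance \<open>b = h - w\<close> below the maximum at time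
  \<open>s\<close>, the middle density is \<open>2 * passage ((h - z) + b) (s - t)\<close>.
  \<open>passage_sum_g_integral\<close> splits it at the first passage over \<open>h - z\<close>,
  and the splitting time \<open>u\<close> is the time from \<open>t\<close> to the argmax.\<close>

lemma killed_argmax_after:
  assumes [arith]: "0 < t" "t < s" "s < 1"
  shows "(\<integral>\<^sup>+w. ennreal (killed t h z * max_end_density (s - t) (h - z) (w - z) * killed (1 - s) (h - w) (c - w)) \<partial>lborel) =
    (\<integral>\<^sup>+\<theta>. ennreal (joint_density t z \<theta> h c) * indicator {t<..s} \<theta> \<partial>lborel)"
proof (cases "z < h \<and> 0 < h \<and> c < h")
  case True
  then have [arith]: "z < h" "0 < h" "c < h" by auto
  let ?C = "2 * g t (h - z) h"
  have C: "0 \<le> ?C" by (simp add: g_nonneg)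
  have "(\<integral>\<^sup>+w. ennreal (killed t h z * max_end_density (s - t) (h - z) (w - z) * killed (1 - s) (h - w) (c - w)) \<partial>lborel) =
     (\<integral>\<^sup>+b. ennreal (killed t h z * max_end_density (s - t) (h - z) (h - b - z) * killed (1 - s) b (c - (h - b))) \<partial>lborel)"
    by (subst nn_integral_lborel_reflect[of _ h]) simp_all
  also have "\<dots> = (\<integral>\<^sup>+b. ennreal ?C * ennreal (indicator {0<..} b * (passage ((h - z) + b) (s - t) * g (1 - s) (h - c) b)) \<partial>lborel)"
  proof (intro nn_integral_cong)
    fix b
    have "2 * (h - z) - (h - b - z) = (h - z) + b" by simp
    moreover have "b - (c - (h - b)) = h - c" by simp
    ultimately show "ennreal (killed t h z * max_end_density (s - t) (h - z) (h - b - z) * killed (1 - s) b (c - (h - b))) =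
        ennreal ?C * ennreal (indicator {0<..} b * (passage ((h - z) + b) (s - t) * g (1 - s) (h - c) b))"
      using True by (simp add: killed_def max_end_density_def ennreal_mult'[OF C, symmetric] mult_ac split: split_indicator)
        (simp add: algebra_simps)
  qed
  also have "\<dots> = ennreal ?C * (\<integral>\<^sup>+u. ennreal (indicator {0<..<s-t} u * (passage (h - z) u * passage (h - c) (s - t + (1 - s) - u))) \<partial>lborel)"
    by (subst nn_integral_cmult) (simp_all add: passage_sum_g_integral)
  also have "\<dots> = (\<integral>\<^sup>+u. ennreal ?C * ennreal (indicator {0<..<s-t} u * (passage (h - z) u * passage (h - c) (s - t + (1 - s) - u))) \<partial>lborel)"
    by (subst nn_integral_cmult) simp_all
  also have "\<dots> = (\<integral>\<^sup>+\<theta>. ennreal ?C * ennreal (indicator {0<..<s-t} (\<theta> - t) * (passage (h - z) (\<theta> - t) * passage (h - c) (s - t + (1 - s) - (\<theta> - t)))) \<partial>lborel)"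
    by (rule nn_integral_lborel_shift) simp
  also have "\<dots> = (\<integral>\<^sup>+\<theta>. ennreal (joint_density t z \<theta> h c) * indicator {t<..s} \<theta> \<partial>lborel)"
    \<comment> \<open>The range of \<open>u\<close> is open at both ends, whereas
      \<open>{t<..s}\<close> contains \<open>s\<close>.\<close>
    using AE_lborel_singleton[of s]
    by (intro nn_integral_cong_AE)
      (auto elim!: eventually_mono simp: joint_density_eq argmax_domain_def ennreal_mult'[OF C, symmetric] mult_ac split: split_indicator)
  finally show ?thesis .
next
  case False
  then have "killed t h z * max_end_density (s - t) (h - z) (w - z) * killed (1 - s) (h - w) (c - w) = 0"
    and "joint_density t z \<theta> h c = 0" for w \<theta>
    by (auto simp: killed_def joint_density_eq argmax_domain_def)
  then show ?thesis by (simp only:) simp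
qed

text \<open>The mirror image of \<open>killed_argmax_after\<close> under time reversal: the position
  integrated out is now the one at the left end, and \<open>u\<close> is the time from the argmax to
  \<open>t\<close>, run backwards.\<close>

lemma killed_argmax_before:
  assumes [arith]: "0 < s" "s < t" "t < 1"
  shows "(\<integral>\<^sup>+z. ennreal (killed s h z * max_end_density (t - s) (h - z) (w - z) * killed (1 - t) (h - w) (c - w)) \<partial>lborel) =
    (\<integral>\<^sup>+\<theta>. ennreal (joint_density t w \<theta> h c) * indicator {s<..t} \<theta> \<partial>lborel)"
proof (cases "w < h \<and> 0 < h \<and> c < h")
  case True
  then have [arith]: "w < h" "0 < h" "c < h" by auto
  let ?C = "2 * g (1 - t) (h - w) (h - c)"
  have C: "0 \<le> ?C" by (simp add: g_nonneg)
  have "(\<integral>\<^sup>+z. ennreal (killed s h z * max_end_density (t - s) (h - z) (w - z) * killed (1 - t) (h - w) (c - w)) \<partial>lborel) =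
     (\<integral>\<^sup>+b. ennreal (killed s h (h - b) * max_end_density (t - s) b (w - (h - b)) * killed (1 - t) (h - w) (c - w)) \<partial>lborel)"
    by (subst nn_integral_lborel_reflect[of _ h]) simp_all
  also have "\<dots> = (\<integral>\<^sup>+b. ennreal ?C * ennreal (indicator {0<..} b * (passage ((h - w) + b) (t - s) * g s h b)) \<partial>lborel)"
  proof (intro nn_integral_cong)
    fix b
    have "2 * b - (w - (h - b)) = (h - w) + b" by simp
    then show "ennreal (killed s h (h - b) * max_end_density (t - s) b (w - (h - b)) * killed (1 - t) (h - w) (c - w)) =
        ennreal ?C * ennreal (indicator {0<..} b * (passage ((h - w) + b) (t - s) * g s h b))"
      using True by (simp add: killed_def max_end_density_def ennreal_mult'[OF C, symmetric] g_commute[of _ _ "h - w"] g_commute[of s b] mult_ac split: split_indicator)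
        (simp add: algebra_simps)
  qed
  also have "\<dots> = ennreal ?C * (\<integral>\<^sup>+u. ennreal (indicator {0<..<t-s} u * (passage (h - w) u * passage h (t - s + s - u))) \<partial>lborel)"
    by (subst nn_integral_cmult) (simp_all add: passage_sum_g_integral)
  also have "\<dots> = (\<integral>\<^sup>+u. ennreal ?C * ennreal (indicator {0<..<t-s} u * (passage (h - w) u * passage h (t - s + s - u))) \<partial>lborel)"
    by (subst nn_integral_cmult) simp_all
  also have "\<dots> = (\<integral>\<^sup>+\<theta>. ennreal ?C * ennreal (indicator {0<..<t-s} (t - \<theta>) * (passage (h - w) (t - \<theta>) * passage h (t - s + s - (t - \<theta>)))) \<partial>lborel)"
    by (rule nn_integral_lborel_reflect) simp
  also have "\<dots> = (\<integral>\<^sup>+\<theta>. ennreal (joint_density t w \<theta> h c) * indicator {s<..t} \<theta> \<partial>lborel)"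
    \<comment> \<open>The endpoint \<open>\<theta> = t\<close> causes no mismatch here, since
      \<open>joint_density\<close> is 0 there by definition.\<close>
    by (intro nn_integral_cong)
      (auto simp: joint_density_eq argmax_domain_def ennreal_mult'[OF C, symmetric] mult_ac split: split_indicator)
  finally show ?thesis .
next
  case False
  then have "killed s h z * max_end_density (t - s) (h - z) (w - z) * killed (1 - t) (h - w) (c - w) = 0"
    and "joint_density t w \<theta> h c = 0" for z \<theta>
    by (auto simp: killed_def joint_density_eq argmax_domain_def)
  then show ?thesis by (simp only:) simp
qed

section \<open>Maxima over adjacent intervals, the first argmax and its joint law on
  intervals\<close>

context brownian
begin

lemma incr_max_attained:
  assumes "0 \<le> a" "a \<le> b" "b \<le> 1" "\<omega> \<in> space M"
  obtains u where "u \<in> {a..b}" "B u \<omega> = B a \<omega> + incr_max B a b \<omega>"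
proof -
  have "compact ((\<lambda>u. B u \<omega> - B a \<omega>) ` {a..b})" "(\<lambda>u. B u \<omega> - B a \<omega>) ` {a..b} \<noteq> {}"
    using assms by (auto intro!: compact_continuous_image continuous_intros B_continuous_on)
  from compact_attains_sup[OF this] obtain u where u: "u \<in> {a..b}" "\<forall>v\<in>{a..b}. B v \<omega> - B a \<omega> \<le> B u \<omega> - B a \<omega>"
    by auto
  have "incr_max B a b \<omega> \<le> B u \<omega> - B a \<omega>"
    unfolding incr_max_def using assms u by (intro cSUP_least) auto
  then show ?thesis using incr_le_incr_max[of a u b \<omega>] u assms by (intro that[of u]) auto
qed

lemma incr_max_split:
  assumes "0 \<le> a" "a \<le> b" "b \<le> c" "c \<le> 1" "\<omega> \<in> space M"
  shows "B a \<omega> + incr_max B a c \<omega> = max (B a \<omega> + incr_max B a b \<omega>) (B b \<omega> + incr_max B b c \<omega>)"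
proof (rule antisym)
  obtain u where u: "u \<in> {a..c}" "B u \<omega> = B a \<omega> + incr_max B a c \<omega>"
    using incr_max_attained[of a c \<omega>] assms by auto
  show "B a \<omega> + incr_max B a c \<omega> \<le> max (B a \<omega> + incr_max B a b \<omega>) (B b \<omega> + incr_max B b c \<omega>)"
    using u incr_le_incr_max[of a u b \<omega>] incr_le_incr_max[of b u c \<omega>] assms by (cases "u \<le> b") auto
next
  obtain v where v: "v \<in> {a..b}" "B v \<omega> = B a \<omega> + incr_max B a b \<omega>"
    using incr_max_attained[of a b \<omega>] assms by auto
  obtain w where w: "w \<in> {b..c}" "B w \<omega> = B b \<omega> + incr_max B b c \<omega>"
    using incr_max_attained[of b c \<omega>] assms by auto
  show "max (B a \<omega> + incr_max B a b \<omega>) (B b \<omega> + incr_max B b c \<omega>) \<le> B a \<omega> + incr_max B a c \<omega>"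
    using v w incr_le_incr_max[of a v c \<omega>] incr_le_incr_max[of a w c \<omega>] assms by auto
qed

lemma path_max_eq: "\<omega> \<in> space M \<Longrightarrow> path_max B \<omega> = incr_max B 0 1 \<omega>"
  by (simp add: path_max_def incr_max_def B_0)

text \<open>A \<open>LEAST\<close> over the reals is meaningful only if a smallest element exists;
  by continuity the set of maximisers is nonempty and compact.\<close>

lemma first_argmax:
  assumes "\<omega> \<in> space M"
  shows "first_argmax B \<omega> \<in> {0..1}" "B (first_argmax B \<omega>) \<omega> = path_max B \<omega>"
    and "\<And>s. s \<in> {0..1} \<Longrightarrow> B s \<omega> = path_max B \<omega> \<Longrightarrow> first_argmax B \<omega> \<le> s"
proof -
  let ?S = "{s\<in>{0..1}. B s \<omega> = path_max B \<omega>}"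
  have "compact ?S"
  proof -
    have "closed ?S"
      using assms by (intro continuous_closed_preimage_constant B_continuous_on) auto
    moreover have "bounded ?S" by (rule bounded_subset[of "{0..1}"]) auto
    ultimately show ?thesis by (simp add: compact_eq_bounded_closed)
  qed
  moreover obtain u where "u \<in> ?S"
    using incr_max_attained[of 0 1 \<omega>] assms by (auto simp: path_max_eq B_0)
  ultimately obtain s where s: "s \<in> ?S" "\<And>u. u \<in> ?S \<Longrightarrow> s \<le> u"
    using compact_attains_inf[of ?S] by blast
  have "first_argmax B \<omega> = s"
    unfolding first_argmax_def using s by (intro Least_equality) auto
  then show "first_argmax B \<omega> \<in> {0..1}" "B (first_argmax B \<omega>) \<omega> = path_max B \<omega>"
    "\<And>s. s \<in> {0..1} \<Longrightarrow> B s \<omega> = path_max B \<omega> \<Longrightarrow> first_argmax B \<omega> \<le> s"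
    using s by auto
qed

text \<open>This trades the argmax for a comparison of maxima. Because the first maximiser is taken,
  it is enough that the overall maximum is attained somewhere up to \<open>b\<close>.\<close>

lemma first_argmax_le_iff:
  assumes \<omega>: "\<omega> \<in> space M" and b: "0 \<le> b" "b \<le> 1"
  shows "first_argmax B \<omega> \<le> b \<longleftrightarrow> path_max B \<omega> \<le> incr_max B 0 b \<omega>"
proof
  assume "first_argmax B \<omega> \<le> b"
  then show "path_max B \<omega> \<le> incr_max B 0 b \<omega>"
    using first_argmax[OF \<omega>] incr_le_incr_max[of 0 "first_argmax B \<omega>" b \<omega>] \<omega> b by (auto simp: B_0)
next
  assume le: "path_max B \<omega> \<le> incr_max B 0 b \<omega>"
  obtain u where u: "u \<in> {0..b}" "B u \<omega> = incr_max B 0 b \<omega>"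
    using incr_max_attained[of 0 b \<omega>] \<omega> b by (auto simp: B_0)
  moreover have "B u \<omega> \<le> path_max B \<omega>"
    using incr_le_incr_max[of 0 u 1 \<omega>] u b \<omega> by (auto simp: path_max_eq B_0)
  ultimately show "first_argmax B \<omega> \<le> b"
    using first_argmax(3)[OF \<omega>, of u] le b by auto
qed

text \<open>Apply \<open>first_argmax_le_iff\<close> at both ends: at \<open>p\<close> in negated
  form, which gives the strict inequality, and at \<open>q\<close> directly, which gives the weak
  one.\<close>

lemma first_argmax_between:
  assumes \<omega>: "\<omega> \<in> space M" and pq: "0 \<le> p" "p \<le> q" "q \<le> 1"
  shows "p < first_argmax B \<omega> \<and> first_argmax B \<omega> \<le> q \<longleftrightarrow>
      incr_max B 0 p \<omega> < B p \<omega> + incr_max B p q \<omega> \<and> B q \<omega> + incr_max B q 1 \<omega> \<le> B p \<omega> + incr_max B p q \<omega>"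
    and "p < first_argmax B \<omega> \<Longrightarrow> first_argmax B \<omega> \<le> q \<Longrightarrow> path_max B \<omega> = B p \<omega> + incr_max B p q \<omega>"
  using incr_max_split[of 0 p q \<omega>] incr_max_split[of 0 q 1 \<omega>] first_argmax_le_iff[OF \<omega>, of p] first_argmax_le_iff[OF \<omega>, of q] pq
  by (auto simp: B_0 \<omega> path_max_eq max_def not_le[symmetric] split: if_splits)

lemma path_max_measurable [measurable]: "path_max B \<in> borel_measurable M"
proof -
  have "incr_max B 0 1 \<in> borel_measurable M" by (rule incr_max_measurable) auto
  then show ?thesis by (rule measurable_cong[THEN iffD1, rotated]) (simp add: path_max_eq)
qed

lemma first_argmax_measurable [measurable]: "first_argmax B \<in> borel_measurable M"
proof (subst borel_measurable_iff_le, intro allI)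
  fix b :: real
  consider "b < 0" | "1 < b" | "0 \<le> b" "b \<le> 1" by linarith
  then show "{\<omega>\<in>space M. first_argmax B \<omega> \<le> b} \<in> events"
  proof cases
    case 1
    then have "{\<omega>\<in>space M. first_argmax B \<omega> \<le> b} = {}" using first_argmax(1) by fastforce
    then show ?thesis by (simp only: sets.empty_sets)
  next
    case 2
    then have "{\<omega>\<in>space M. first_argmax B \<omega> \<le> b} = space M" using first_argmax(1) by fastforce
    then show ?thesis by (simp only: sets.top)
  next
    case 3
    then have [measurable]: "incr_max B 0 b \<in> borel_measurable M" by (intro incr_max_measurable) auto
    have "{\<omega>\<in>space M. first_argmax B \<omega> \<le> b} = {\<omega>\<in>space M. path_max B \<omega> \<le> incr_max B 0 b \<omega>}"
      using first_argmax_le_iff 3 by blast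
    then show ?thesis by (simp only:) measurable
  qed
qed

text \<open>\<open>F\<close> does not see the position at time \<open>s\<close>, so once that
  position is the innermost variable it can be integrated out by \<open>killed_argmax_after\<close>,
  which introduces \<open>\<theta>\<close> in its place.\<close>

lemma nn_integral_argmax_after:
  assumes ts: "0 < t" "t < s" "s < 1"
    and F[measurable]: "F \<in> borel_measurable (borel \<Otimes>\<^sub>M (borel \<Otimes>\<^sub>M borel))"
  shows "(\<integral>\<^sup>+\<omega>. F (B t \<omega>, path_max B \<omega>, B 1 \<omega>) * indicator {t<..s} (first_argmax B \<omega>) \<partial>M) =
    (\<integral>\<^sup>+x. \<integral>\<^sup>+h. \<integral>\<^sup>+c. \<integral>\<^sup>+\<theta>. ennreal (joint_density t x \<theta> h c) * (F (x, h, c) * indicator {t<..s} \<theta>) \<partial>lborel \<partial>lborel \<partial>lborel \<partial>lborel)"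
proof -
  define W where "W z w h c = ennreal (killed t h z * max_end_density (s - t) (h - z) (w - z) * killed (1 - s) (h - w) (c - w)) * F (z, h, c)"
    for z w h c
  have [measurable]: "(\<lambda>v. W (a v) (b v) (c v) (d v)) \<in> borel_measurable N"
    if [measurable]: "a \<in> borel_measurable N" "b \<in> borel_measurable N" "c \<in> borel_measurable N" "d \<in> borel_measurable N"
    for a b c d and N :: "'b measure"
    unfolding W_def by measurable
  have "(\<integral>\<^sup>+\<omega>. F (B t \<omega>, path_max B \<omega>, B 1 \<omega>) * indicator {t<..s} (first_argmax B \<omega>) \<partial>M) =
     (\<integral>\<^sup>+\<omega>. (\<lambda>(z, w, h, c). F (z, h, c)) (B t \<omega>, B s \<omega>, B t \<omega> + incr_max B t s \<omega>, B 1 \<omega>) *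
        indicator {\<omega>. incr_max B 0 t \<omega> < B t \<omega> + incr_max B t s \<omega> \<and>
          B s \<omega> + incr_max B s 1 \<omega> \<le> B t \<omega> + incr_max B t s \<omega>} \<omega> \<partial>M)"
  proof (intro nn_integral_cong)
    fix \<omega> assume "\<omega> \<in> space M"
    from first_argmax_between[OF this, of t s] ts
    show "F (B t \<omega>, path_max B \<omega>, B 1 \<omega>) * indicator {t<..s} (first_argmax B \<omega>) =
      (\<lambda>(z, w, h, c). F (z, h, c)) (B t \<omega>, B s \<omega>, B t \<omega> + incr_max B t s \<omega>, B 1 \<omega>) *
        indicator {\<omega>. incr_max B 0 t \<omega> < B t \<omega> + incr_max B t s \<omega> \<and>
          B s \<omega> + incr_max B s 1 \<omega> \<le> B t \<omega> + incr_max B t s \<omega>} \<omega>"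
      by (cases "t < first_argmax B \<omega> \<and> first_argmax B \<omega> \<le> s") auto
  qed
  also have "\<dots> = (\<integral>\<^sup>+z. \<integral>\<^sup>+w. \<integral>\<^sup>+h. \<integral>\<^sup>+c. W z w h c \<partial>lborel \<partial>lborel \<partial>lborel \<partial>lborel)"
    by (subst nn_integral_argmax_between[OF ts]) (simp_all add: W_def[abs_def])
  also have "\<dots> = (\<integral>\<^sup>+z. \<integral>\<^sup>+h. \<integral>\<^sup>+w. \<integral>\<^sup>+c. W z w h c \<partial>lborel \<partial>lborel \<partial>lborel \<partial>lborel)"
    by (intro nn_integral_cong nn_integral_lborel_swap) measurable
  also have "\<dots> = (\<integral>\<^sup>+z. \<integral>\<^sup>+h. \<integral>\<^sup>+c. \<integral>\<^sup>+w. W z w h c \<partial>lborel \<partial>lborel \<partial>lborel \<partial>lborel)"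
    by (intro nn_integral_cong nn_integral_lborel_swap) measurable
  also have "\<dots> = (\<integral>\<^sup>+x. \<integral>\<^sup>+h. \<integral>\<^sup>+c. (\<integral>\<^sup>+\<theta>. ennreal (joint_density t x \<theta> h c) * indicator {t<..s} \<theta> \<partial>lborel) * F (x, h, c) \<partial>lborel \<partial>lborel \<partial>lborel)"
    unfolding W_def by (simp add: nn_integral_multc killed_argmax_after[OF ts])
  also have "\<dots> = (\<integral>\<^sup>+x. \<integral>\<^sup>+h. \<integral>\<^sup>+c. \<integral>\<^sup>+\<theta>. ennreal (joint_density t x \<theta> h c) * (F (x, h, c) * indicator {t<..s} \<theta>) \<partial>lborel \<partial>lborel \<partial>lborel \<partial>lborel)"
    by (simp add: nn_integral_multc[symmetric]) (simp add: mult_ac)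
  finally show ?thesis .
qed

lemma nn_integral_argmax_before:
  assumes st: "0 < s" "s < t" "t < 1"
    and F[measurable]: "F \<in> borel_measurable (borel \<Otimes>\<^sub>M (borel \<Otimes>\<^sub>M borel))"
  shows "(\<integral>\<^sup>+\<omega>. F (B t \<omega>, path_max B \<omega>, B 1 \<omega>) * indicator {s<..t} (first_argmax B \<omega>) \<partial>M) =
    (\<integral>\<^sup>+x. \<integral>\<^sup>+h. \<integral>\<^sup>+c. \<integral>\<^sup>+\<theta>. ennreal (joint_density t x \<theta> h c) * (F (x, h, c) * indicator {s<..t} \<theta>) \<partial>lborel \<partial>lborel \<partial>lborel \<partial>lborel)"
proof -
  define W where "W z w h c = ennreal (killed s h z * max_end_density (t - s) (h - z) (w - z) * killed (1 - t) (h - w) (c - w)) * F (w, h, c)"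
    for z w h c
  have [measurable]: "(\<lambda>v. W (a v) (b v) (c v) (d v)) \<in> borel_measurable N"
    if [measurable]: "a \<in> borel_measurable N" "b \<in> borel_measurable N" "c \<in> borel_measurable N" "d \<in> borel_measurable N"
    for a b c d and N :: "'b measure"
    unfolding W_def by measurable
  have "(\<integral>\<^sup>+\<omega>. F (B t \<omega>, path_max B \<omega>, B 1 \<omega>) * indicator {s<..t} (first_argmax B \<omega>) \<partial>M) =
     (\<integral>\<^sup>+\<omega>. (\<lambda>(z, w, h, c). F (w, h, c)) (B s \<omega>, B t \<omega>, B s \<omega> + incr_max B s t \<omega>, B 1 \<omega>) *
        indicator {\<omega>. incr_max B 0 s \<omega> < B s \<omega> + incr_max B s t \<omega> \<and>
          B t \<omega> + incr_max B t 1 \<omega> \<le> B s \<omega> + incr_max B s t \<omega>} \<omega> \<partial>M)"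
  proof (intro nn_integral_cong)
    fix \<omega> assume "\<omega> \<in> space M"
    from first_argmax_between[OF this, of s t] st
    show "F (B t \<omega>, path_max B \<omega>, B 1 \<omega>) * indicator {s<..t} (first_argmax B \<omega>) =
      (\<lambda>(z, w, h, c). F (w, h, c)) (B s \<omega>, B t \<omega>, B s \<omega> + incr_max B s t \<omega>, B 1 \<omega>) *
        indicator {\<omega>. incr_max B 0 s \<omega> < B s \<omega> + incr_max B s t \<omega> \<and>
          B t \<omega> + incr_max B t 1 \<omega> \<le> B s \<omega> + incr_max B s t \<omega>} \<omega>"
      by (cases "s < first_argmax B \<omega> \<and> first_argmax B \<omega> \<le> t") auto
  qed
  also have "\<dots> = (\<integral>\<^sup>+z. \<integral>\<^sup>+w. \<integral>\<^sup>+h. \<integral>\<^sup>+c. W z w h c \<partial>lborel \<partial>lborel \<partial>lborel \<partial>lborel)"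
    by (subst nn_integral_argmax_between[OF st]) (simp_all add: W_def[abs_def])
  also have "\<dots> = (\<integral>\<^sup>+w. \<integral>\<^sup>+z. \<integral>\<^sup>+h. \<integral>\<^sup>+c. W z w h c \<partial>lborel \<partial>lborel \<partial>lborel \<partial>lborel)"
    by (intro nn_integral_cong nn_integral_lborel_swap) measurable
  also have "\<dots> = (\<integral>\<^sup>+w. \<integral>\<^sup>+h. \<integral>\<^sup>+z. \<integral>\<^sup>+c. W z w h c \<partial>lborel \<partial>lborel \<partial>lborel \<partial>lborel)"
    by (intro nn_integral_cong nn_integral_lborel_swap) measurable
  also have "\<dots> = (\<integral>\<^sup>+w. \<integral>\<^sup>+h. \<integral>\<^sup>+c. \<integral>\<^sup>+z. W z w h c \<partial>lborel \<partial>lborel \<partial>lborel \<partial>lborel)"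
    by (intro nn_integral_cong nn_integral_lborel_swap) measurable
  also have "\<dots> = (\<integral>\<^sup>+x. \<integral>\<^sup>+h. \<integral>\<^sup>+c. (\<integral>\<^sup>+\<theta>. ennreal (joint_density t x \<theta> h c) * indicator {s<..t} \<theta> \<partial>lborel) * F (x, h, c) \<partial>lborel \<partial>lborel \<partial>lborel)"
    unfolding W_def by (simp add: nn_integral_multc killed_argmax_before[OF st])
  also have "\<dots> = (\<integral>\<^sup>+x. \<integral>\<^sup>+h. \<integral>\<^sup>+c. \<integral>\<^sup>+\<theta>. ennreal (joint_density t x \<theta> h c) * (F (x, h, c) * indicator {s<..t} \<theta>) \<partial>lborel \<partial>lborel \<partial>lborel \<partial>lborel)"
    by (simp add: nn_integral_multc[symmetric]) (simp add: mult_ac)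
  finally show ?thesis .
qed

end

text \<open>Agreement is known only on half-open intervals with one end at \<open>t\<close> that
  stay away from \<open>a\<close> and \<open>b\<close>. Monotone limits extend it to the whole of
  either side; differences to the left of \<open>t\<close> and unions to the right then give all
  initial segments.\<close>

lemma borel_measure_eqI_split:
  fixes \<mu> \<nu> :: "real measure"
  assumes [measurable_cong]: "sets \<mu> = sets borel" "sets \<nu> = sets borel" and "finite_measure \<mu>"
    and "a < t" "t < b"
    and left: "\<And>s. a < s \<Longrightarrow> s < t \<Longrightarrow> emeasure \<mu> {s<..t} = emeasure \<nu> {s<..t}"
    and right: "\<And>s. t < s \<Longrightarrow> s < b \<Longrightarrow> emeasure \<mu> {t<..s} = emeasure \<nu> {t<..s}"
    and AE: "AE x in \<mu>. a < x \<and> x < b" "AE x in \<nu>. a < x \<and> x < b"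
  shows "\<mu> = \<nu>"
proof -
  interpret \<mu>: finite_measure \<mu> by fact
  have L: "emeasure \<mu> {a<..t} = emeasure \<nu> {a<..t}"
  proof -
    \<comment> \<open>Adding 2 keeps the left end strictly below \<open>t\<close> already for
      \<open>n = 0\<close>.\<close>
    let ?A = "\<lambda>n. {a + (t - a) / (real n + 2)<..t}"
    have UN: "(\<Union>n. ?A n) = {a<..t}"
    proof safe
      fix x assume x: "x \<in> {a<..t}"
      have "(\<lambda>n. a + (t - a) / (real n + 2)) \<longlonglongrightarrow> a" by real_asymp
      then have "\<forall>\<^sub>F n in sequentially. a + (t - a) / (real n + 2) < x"
        using x by (intro order_tendstoD) auto
      then obtain n where "a + (t - a) / (real n + 2) < x" by (auto simp: eventually_sequentially)
      then show "x \<in> (\<Union>n. ?A n)" using x by auto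
    next
      fix x n assume "x \<in> ?A n"
      moreover have "0 < (t - a) / (real n + 2)" using \<open>a < t\<close> by simp
      ultimately show "x \<in> {a<..t}" by auto
    qed
    have inc: "incseq ?A"
    proof (rule incseq_SucI)
      fix n
      have "(t - a) / (real (Suc n) + 2) \<le> (t - a) / (real n + 2)"
        using \<open>a < t\<close> by (intro divide_left_mono) auto
      then show "?A n \<le> ?A (Suc n)" by auto
    qed
    have eq: "emeasure \<mu> (?A n) = emeasure \<nu> (?A n)" for n
    proof (rule left)
      show "a < a + (t - a) / (real n + 2)" using \<open>a < t\<close> by simp
      have "(t - a) / (real n + 2) < (t - a) / 1" using \<open>a < t\<close> by (intro divide_strict_left_mono) auto
      then show "a + (t - a) / (real n + 2) < t" by simp
    qed
    have "emeasure \<mu> (\<Union>n. ?A n) = (SUP n. emeasure \<mu> (?A n))"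
      by (rule SUP_emeasure_incseq[symmetric]) (auto simp: inc)
    also have "\<dots> = emeasure \<nu> (\<Union>n. ?A n)"
      unfolding eq by (rule SUP_emeasure_incseq) (auto simp: inc)
    finally show ?thesis unfolding UN .
  qed
  have R: "emeasure \<mu> {t<..<b} = emeasure \<nu> {t<..<b}"
  proof -
    let ?A = "\<lambda>n. {t<..b - (b - t) / (real n + 2)}"
    have UN: "(\<Union>n. ?A n) = {t<..<b}"
    proof safe
      fix x assume x: "x \<in> {t<..<b}"
      have "(\<lambda>n. b - (b - t) / (real n + 2)) \<longlonglongrightarrow> b" by real_asymp
      then have "\<forall>\<^sub>F n in sequentially. x < b - (b - t) / (real n + 2)"
        using x by (intro order_tendstoD) auto
      then obtain n where "x < b - (b - t) / (real n + 2)" by (auto simp: eventually_sequentially)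
      then show "x \<in> (\<Union>n. ?A n)" using x by (auto intro: less_imp_le)
    next
      fix x n assume "x \<in> ?A n"
      moreover have "0 < (b - t) / (real n + 2)" using \<open>t < b\<close> by simp
      ultimately show "x \<in> {t<..<b}" by auto
    qed
    have inc: "incseq ?A"
    proof (rule incseq_SucI)
      fix n
      have "(b - t) / (real (Suc n) + 2) \<le> (b - t) / (real n + 2)"
        using \<open>t < b\<close> by (intro divide_left_mono) auto
      then show "?A n \<le> ?A (Suc n)" by auto
    qed
    have eq: "emeasure \<mu> (?A n) = emeasure \<nu> (?A n)" for n
    proof (rule right)
      show "b - (b - t) / (real n + 2) < b" using \<open>t < b\<close> by simp
      have "(b - t) / (real n + 2) < (b - t) / 1" using \<open>t < b\<close> by (intro divide_strict_left_mono) auto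
      then show "t < b - (b - t) / (real n + 2)" by simp
    qed
    have "emeasure \<mu> (\<Union>n. ?A n) = (SUP n. emeasure \<mu> (?A n))"
      by (rule SUP_emeasure_incseq[symmetric]) (auto simp: inc)
    also have "\<dots> = emeasure \<nu> (\<Union>n. ?A n)"
      unfolding eq by (rule SUP_emeasure_incseq) (auto simp: inc)
    finally show ?thesis unfolding UN .
  qed
  have eq: "emeasure \<mu> {..x} = emeasure \<nu> {..x}" for x
  proof -
    have restrict: "emeasure \<mu> {..x} = emeasure \<mu> ({..x} \<inter> {a<..<b})" "emeasure \<nu> {..x} = emeasure \<nu> ({..x} \<inter> {a<..<b})"
      by (rule emeasure_eq_AE, use AE(1) in eventually_elim, auto)
        (rule emeasure_eq_AE, use AE(2) in eventually_elim, auto)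
    consider "x \<le> a" | "a < x" "x < t" | "x = t" | "t < x" "x < b" | "b \<le> x" by linarith
    then show ?thesis
    proof cases
      case 1
      then have "{..x} \<inter> {a<..<b} = {}" by auto
      then show ?thesis unfolding restrict by (simp only: emeasure_empty)
    next
      case 2
      then have I: "{..x} \<inter> {a<..<b} = {a<..t} - {x<..t}" using \<open>t < b\<close> by auto
      \<comment> \<open>Finiteness is assumed of \<open>\<mu>\<close> alone; the agreement on
        \<open>{x<..t}\<close> carries it over to \<open>\<nu>\<close>, as the subtraction
        requires.\<close>
      have "emeasure \<mu> {x<..t} \<noteq> \<infinity>" by simp
      moreover have "emeasure \<nu> {x<..t} \<noteq> \<infinity>" using left[OF 2] by (metis calculation)
      ultimately show ?thesis
        unfolding restrict I using 2 left[OF 2] L by (subst (1 2) emeasure_Diff) auto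
    next
      case 3
      then have "{..x} \<inter> {a<..<b} = {a<..t}" using \<open>t < b\<close> by auto
      then show ?thesis unfolding restrict using L by simp
    next
      case 4
      then have I: "{..x} \<inter> {a<..<b} = {a<..t} \<union> {t<..x}" using \<open>a < t\<close> by auto
      have "emeasure \<mu> ({a<..t} \<union> {t<..x}) = emeasure \<mu> {a<..t} + emeasure \<mu> {t<..x}"
        by (intro plus_emeasure[symmetric]) auto
      moreover have "emeasure \<nu> ({a<..t} \<union> {t<..x}) = emeasure \<nu> {a<..t} + emeasure \<nu> {t<..x}"
        by (intro plus_emeasure[symmetric]) auto
      ultimately show ?thesis unfolding restrict I using L right[OF 4] by simp
    next
      case 5
      then have I: "{..x} \<inter> {a<..<b} = {a<..t} \<union> {t<..<b}" using \<open>a < t\<close> \<open>t < b\<close> by auto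
      have "emeasure \<mu> ({a<..t} \<union> {t<..<b}) = emeasure \<mu> {a<..t} + emeasure \<mu> {t<..<b}"
        by (intro plus_emeasure[symmetric]) auto
      moreover have "emeasure \<nu> ({a<..t} \<union> {t<..<b}) = emeasure \<nu> {a<..t} + emeasure \<nu> {t<..<b}"
        by (intro plus_emeasure[symmetric]) auto
      ultimately show ?thesis unfolding restrict I using L R by simp
    qed
  qed
  show ?thesis
  proof (rule measure_eqI_generator_eq[where E="range atMost" and \<Omega>=UNIV and A="\<lambda>n. {..real n}"])
    show "Int_stable (range atMost :: real set set)"
      by (auto simp: Int_stable_def)
    show "(\<Union>n. {..real n}) = UNIV" using real_arch_simple by auto
    show "emeasure \<mu> {..real n} \<noteq> \<infinity>" for n by simp
  qed (auto simp: eq borel_eq_atMost assms(1,2))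
qed

section \<open>Measures and Lebesgue integrals on products\<close>

lemma pair_measure_eqI_rectangles:
  assumes "finite_measure \<mu>" and sets: "sets \<mu> = sets (S \<Otimes>\<^sub>M T)" "sets \<nu> = sets (S \<Otimes>\<^sub>M T)"
    and eq: "\<And>A B. A \<in> sets S \<Longrightarrow> B \<in> sets T \<Longrightarrow> emeasure \<mu> (A \<times> B) = emeasure \<nu> (A \<times> B)"
  shows "\<mu> = \<nu>"
proof (rule measure_eqI_generator_eq[OF Int_stable_pair_measure_generator[of S T]])
  interpret finite_measure \<mu> by fact
  show "{a \<times> b |a b. a \<in> sets S \<and> b \<in> sets T} \<subseteq> Pow (space S \<times> space T)"
    using sets.space_closed[of S] sets.space_closed[of T] by auto
  show "sets \<mu> = sigma_sets (space S \<times> space T) {a \<times> b |a b. a \<in> sets S \<and> b \<in> sets T}"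
    "sets \<nu> = sigma_sets (space S \<times> space T) {a \<times> b |a b. a \<in> sets S \<and> b \<in> sets T}"
    by (simp_all add: sets sets_pair_measure)
  show "range (\<lambda>n::nat. space S \<times> space T) \<subseteq> {a \<times> b |a b. a \<in> sets S \<and> b \<in> sets T}"
    "(\<Union>n::nat. space S \<times> space T) = space S \<times> space T" by auto
  show "emeasure \<mu> (space S \<times> space T) \<noteq> \<infinity>" by simp
qed (use eq in auto)

text \<open>Measurability of tuples is proved componentwise in product form, whereas
  \<open>lborel\<close> on tuples carries \<open>borel\<close>; the equations below pass between the
  two.\<close>

abbreviation borel3 :: "(real \<times> real \<times> real) measure" where
  "borel3 \<equiv> borel \<Otimes>\<^sub>M (borel \<Otimes>\<^sub>M borel)"

abbreviation borel4 :: "(real \<times> real \<times> real \<times> real) measure" where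
  "borel4 \<equiv> borel \<Otimes>\<^sub>M borel3"

lemma borel3: "borel3 = borel" and borel4: "borel4 = borel"
  by (simp_all add: borel_prod)

lemma nn_integral_lborel3:
  assumes [measurable]: "F \<in> borel_measurable borel3"
  shows "(\<integral>\<^sup>+v. F v \<partial>lborel) = (\<integral>\<^sup>+x. \<integral>\<^sup>+y. \<integral>\<^sup>+z. F (x, y, z) \<partial>lborel \<partial>lborel \<partial>lborel)"
proof -
  have "(\<integral>\<^sup>+v. F v \<partial>lborel) = (\<integral>\<^sup>+x. \<integral>\<^sup>+v. F (x, v) \<partial>lborel \<partial>lborel)"
  proof -
    have "F \<in> borel_measurable (lborel \<Otimes>\<^sub>M lborel)"
      using assms by (simp add: lborel_prod borel_prod)
    from lborel.nn_integral_fst[OF this] show ?thesis by (simp add: lborel_prod)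
  qed
  also have "\<dots> = (\<integral>\<^sup>+x. \<integral>\<^sup>+y. \<integral>\<^sup>+z. F (x, y, z) \<partial>lborel \<partial>lborel \<partial>lborel)"
  proof (intro nn_integral_cong)
    fix x
    have "(\<lambda>v. F (x, v)) \<in> borel_measurable (borel \<Otimes>\<^sub>M borel)" by measurable
    then have "(\<lambda>v. F (x, v)) \<in> borel_measurable (lborel \<Otimes>\<^sub>M lborel)"
      by (simp add: lborel_prod borel_prod)
    from lborel.nn_integral_fst[OF this]
    show "(\<integral>\<^sup>+v. F (x, v) \<partial>lborel) = (\<integral>\<^sup>+y. \<integral>\<^sup>+z. F (x, y, z) \<partial>lborel \<partial>lborel)"
      by (simp add: lborel_prod)
  qed
  finally show ?thesis .
qed

lemma nn_integral_lborel4: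
  assumes [measurable]: "F \<in> borel_measurable borel4"
  shows "(\<integral>\<^sup>+v. F v \<partial>lborel) = (\<integral>\<^sup>+x. \<integral>\<^sup>+y. \<integral>\<^sup>+z. \<integral>\<^sup>+w. F (x, y, z, w) \<partial>lborel \<partial>lborel \<partial>lborel \<partial>lborel)"
proof -
  have "(\<integral>\<^sup>+v. F v \<partial>lborel) = (\<integral>\<^sup>+x. \<integral>\<^sup>+v. F (x, v) \<partial>lborel \<partial>lborel)"
  proof -
    have "F \<in> borel_measurable (lborel \<Otimes>\<^sub>M lborel)"
      using assms by (simp add: lborel_prod borel_prod)
    from lborel.nn_integral_fst[OF this] show ?thesis by (simp add: lborel_prod)
  qed
  also have "\<dots> = (\<integral>\<^sup>+x. \<integral>\<^sup>+y. \<integral>\<^sup>+z. \<integral>\<^sup>+w. F (x, y, z, w) \<partial>lborel \<partial>lborel \<partial>lborel \<partial>lborel)"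
    by (intro nn_integral_cong nn_integral_lborel3) measurable
  finally show ?thesis .
qed

definition joint_law :: "real \<Rightarrow> (real \<times> real \<times> real \<times> real) measure" where
  "joint_law t = density lborel (\<lambda>(x, \<theta>, h, c). ennreal (joint_density t x \<theta> h c))"

lemma joint_density_measurable_tuple: "(\<lambda>(x, \<theta>, h, c). ennreal (joint_density t x \<theta> h c)) \<in> borel_measurable borel4"
  unfolding case_prod_unfold by measurable

lemma sets_joint_law [measurable_cong]: "sets (joint_law t) = sets borel4"
  unfolding joint_law_def by (simp only: sets_density sets_lborel borel4)

lemma nn_integral_joint_law:
  assumes [measurable]: "F \<in> borel_measurable borel4"
  shows "(\<integral>\<^sup>+v. F v \<partial>joint_law t) =
    (\<integral>\<^sup>+x. \<integral>\<^sup>+\<theta>. \<integral>\<^sup>+h. \<integral>\<^sup>+c. ennreal (joint_density t x \<theta> h c) * F (x, \<theta>, h, c) \<partial>lborel \<partial>lborel \<partial>lborel \<partial>lborel)"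
proof -
  note joint_density_measurable_tuple[measurable]
  have "(\<integral>\<^sup>+v. F v \<partial>joint_law t) = (\<integral>\<^sup>+v. (\<lambda>(x, \<theta>, h, c). ennreal (joint_density t x \<theta> h c)) v * F v \<partial>lborel)"
    unfolding joint_law_def
  proof (rule nn_integral_density)
    show "(\<lambda>(x, \<theta>, h, c). ennreal (joint_density t x \<theta> h c)) \<in> borel_measurable lborel"
      using joint_density_measurable_tuple[of t] by (simp add: borel4)
    show "F \<in> borel_measurable lborel" using assms by (simp add: borel4)
  qed
  also have "\<dots> = (\<integral>\<^sup>+x. \<integral>\<^sup>+\<theta>. \<integral>\<^sup>+h. \<integral>\<^sup>+c. ennreal (joint_density t x \<theta> h c) * F (x, \<theta>, h, c) \<partial>lborel \<partial>lborel \<partial>lborel \<partial>lborel)"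
    by (subst nn_integral_lborel4) simp_all
  finally show ?thesis .
qed

lemma AE_joint_law: "AE v in joint_law t. 0 < fst (snd v) \<and> fst (snd v) < 1"
proof -
  have "(\<lambda>(x, \<theta>, h, c). ennreal (joint_density t x \<theta> h c)) \<in> borel_measurable lborel"
    using joint_density_measurable_tuple[of t] by (simp add: borel4)
  then show ?thesis
    unfolding joint_law_def
    by (subst AE_density) (auto intro!: AE_I2 simp: joint_density_def split: if_splits)
qed

lemma distributed_AE_pos:
  assumes "distributed M N X f"
  shows "AE \<omega> in M. 0 < f (X \<omega>)"
proof (rule AE_distrD[of X M N])
  show "X \<in> measurable M N" using assms by (simp add: distributed_def)
  have "AE x in density N f. 0 < f x"
    using assms by (subst AE_density) (auto simp: distributed_def)
  then show "AE x in distr M N X. 0 < f x"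
    using distributed_distr_eq_density[OF assms] by metis
qed

context brownian
begin

text \<open>The density of (maximum, end value) lives on \<open>0 < m\<close> and
  \<open>z < m\<close>. Almost surely the maximum therefore exceeds both the initial and the final
  value and is attained at neither end.\<close>

lemma AE_first_argmax: "AE \<omega> in M. 0 < first_argmax B \<omega> \<and> first_argmax B \<omega> < 1"
proof -
  have "AE \<omega> in M. 0 < (\<lambda>(m, z). ennreal (max_end_density 1 m z)) (incr_max B 0 1 \<omega>, B 1 \<omega> - B 0 \<omega>)"
    using distributed_AE_pos[OF max_end_distributed[of 0 1]] by simp
  moreover have "AE \<omega> in M. \<omega> \<in> space M" by simp
  ultimately show ?thesis
  proof eventually_elim
    case (elim \<omega>)
    then have "0 < path_max B \<omega>" "B 1 \<omega> < path_max B \<omega>"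
      by (auto simp: max_end_density_def path_max_eq B_0 split: if_splits)
    then have "first_argmax B \<omega> \<noteq> 0" "first_argmax B \<omega> \<noteq> 1"
      using first_argmax(2)[OF elim(2)] B_0[OF elim(2)] by (metis less_irrefl)+
    then show ?case using first_argmax(1)[OF elim(2)] by simp
  qed
qed

text \<open>Fix a set \<open>D\<close> of values of (position at \<open>t\<close>, maximum, final
  value). The interval formulas show that the law of the argmax on the event \<open>D\<close> is the
  right one, and the rectangles \<open>D \<times> I\<close> then determine the joint law.\<close>

lemma distr_joint:
  assumes t: "0 < t" "t < 1"
  shows "distr M borel4 (\<lambda>\<omega>. (B t \<omega>, first_argmax B \<omega>, path_max B \<omega>, B 1 \<omega>)) = joint_law t"
proof -
  have [measurable]: "B t \<in> borel_measurable M" "B 1 \<in> borel_measurable M" using t by auto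
  define X where "X \<omega> = (B t \<omega>, first_argmax B \<omega>, path_max B \<omega>, B 1 \<omega>)" for \<omega>
  have X[measurable]: "X \<in> measurable M borel4" unfolding X_def by measurable
  define L where "L = distr M borel4 X"
  have sL[measurable_cong]: "sets L = sets borel4" by (simp add: L_def)
  interpret L: prob_space L unfolding L_def by (rule prob_space_distr[OF X])
  \<comment> \<open>Moves the argmax to the end, so that it can be separated from the other three
    coordinates; \<open>\<rho>\<close> moves it back.\<close>
  define \<pi> where "\<pi> = (\<lambda>(x, \<theta>, h, c). ((x, h, c), \<theta>) :: (real \<times> real \<times> real) \<times> real)"
  define \<rho> where "\<rho> v = (fst (fst v), snd v, fst (snd (fst v)), snd (snd (fst v)))" for v :: "(real \<times> real \<times> real) \<times> real"
  have \<pi>[measurable]: "\<pi> \<in> measurable borel4 (borel3 \<Otimes>\<^sub>M borel)" unfolding \<pi>_def by measurable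
  have \<rho>[measurable]: "\<rho> \<in> measurable (borel3 \<Otimes>\<^sub>M borel) borel4" unfolding \<rho>_def[abs_def] by measurable
  have "distr L (borel3 \<Otimes>\<^sub>M borel) \<pi> = distr (joint_law t) (borel3 \<Otimes>\<^sub>M borel) \<pi>"
  proof (rule pair_measure_eqI_rectangles)
    show "finite_measure (distr L (borel3 \<Otimes>\<^sub>M borel) \<pi>)"
      by (intro prob_space.finite_measure L.prob_space_distr) measurable
    fix D I assume [measurable]: "D \<in> sets borel3" "I \<in> sets (borel :: real measure)"
    define f where "f v = (indicator D (fst v, snd (snd v)) :: ennreal)" for v :: "real \<times> real \<times> real \<times> real"
    have [measurable]: "f \<in> borel_measurable borel4" unfolding f_def by measurable
    \<comment> \<open>The law of the argmax coordinate under \<open>K\<close> restricted to the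
      event given by \<open>D\<close>.\<close>
    define slice where "slice K = distr (density K f) borel (\<lambda>v. fst (snd v))" for K
    have slice: "emeasure (slice K) J = (\<integral>\<^sup>+v. f v * indicator J (fst (snd v)) \<partial>K)"
      if [measurable]: "J \<in> sets borel" and K[measurable_cong]: "sets K = sets borel4" for K J
    proof -
      have "emeasure (slice K) J = (\<integral>\<^sup>+x. indicator J x \<partial>slice K)"
        by (rule nn_integral_indicator[symmetric]) (simp add: slice_def)
      also have "\<dots> = (\<integral>\<^sup>+v. indicator J (fst (snd v)) \<partial>density K f)"
        unfolding slice_def by (subst nn_integral_distr) simp_all
      finally show ?thesis by (simp add: nn_integral_density)
    qed
    have slice_AE: "AE x in slice K. 0 < x \<and> x < 1"
      if [measurable_cong]: "sets K = sets borel4" and AE: "AE v in K. 0 < fst (snd v) \<and> fst (snd v) < 1" for K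
    proof -
      have "AE v in density K f. 0 < fst (snd v) \<and> fst (snd v) < 1"
        by (subst AE_density, simp) (rule eventually_mono[OF AE], simp)
      then show ?thesis
        unfolding slice_def by (subst AE_distr_iff) simp_all
    qed
    have sl: "emeasure (slice L) J = (\<integral>\<^sup>+\<omega>. indicator D (B t \<omega>, path_max B \<omega>, B 1 \<omega>) * indicator J (first_argmax B \<omega>) \<partial>M)"
      if [measurable]: "J \<in> sets borel" for J
      unfolding slice[OF that sL] unfolding L_def
      by (subst nn_integral_distr[OF X]) (simp_all add: X_def f_def)
    have sj: "emeasure (slice (joint_law t)) J =
       (\<integral>\<^sup>+x. \<integral>\<^sup>+h. \<integral>\<^sup>+c. \<integral>\<^sup>+\<theta>. ennreal (joint_density t x \<theta> h c) * (indicator D (x, h, c) * indicator J \<theta>) \<partial>lborel \<partial>lborel \<partial>lborel \<partial>lborel)"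
      if [measurable]: "J \<in> sets borel" for J
    proof -
      define W where "W x \<theta> h c = ennreal (joint_density t x \<theta> h c) * (indicator D (x, h, c) * indicator J \<theta>)" for x \<theta> h c
      have [measurable]: "(\<lambda>v. W (a v) (b v) (c v) (d v)) \<in> borel_measurable N"
        if [measurable]: "a \<in> borel_measurable N" "b \<in> borel_measurable N" "c \<in> borel_measurable N" "d \<in> borel_measurable N"
        for a b c d and N :: "'b measure"
        unfolding W_def by measurable
      have "emeasure (slice (joint_law t)) J = (\<integral>\<^sup>+x. \<integral>\<^sup>+\<theta>. \<integral>\<^sup>+h. \<integral>\<^sup>+c. W x \<theta> h c \<partial>lborel \<partial>lborel \<partial>lborel \<partial>lborel)"
        unfolding slice[OF that sets_joint_law] by (subst nn_integral_joint_law) (simp_all add: W_def[abs_def] f_def)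
      also have "\<dots> = (\<integral>\<^sup>+x. \<integral>\<^sup>+h. \<integral>\<^sup>+\<theta>. \<integral>\<^sup>+c. W x \<theta> h c \<partial>lborel \<partial>lborel \<partial>lborel \<partial>lborel)"
        by (intro nn_integral_cong nn_integral_lborel_swap) measurable
      also have "\<dots> = (\<integral>\<^sup>+x. \<integral>\<^sup>+h. \<integral>\<^sup>+c. \<integral>\<^sup>+\<theta>. W x \<theta> h c \<partial>lborel \<partial>lborel \<partial>lborel \<partial>lborel)"
        by (intro nn_integral_cong nn_integral_lborel_swap) measurable
      finally show ?thesis unfolding W_def .
    qed
    have [simp]: "sets (slice K) = sets borel" for K by (simp add: slice_def)
    have "slice L = slice (joint_law t)"
    proof (rule borel_measure_eqI_split[where a=0 and b=1 and t=t])
      have "emeasure (slice L) UNIV \<le> (\<integral>\<^sup>+\<omega>. 1 \<partial>M)"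
        by (subst sl, simp, intro nn_integral_mono) (simp split: split_indicator)
      then have "emeasure (slice L) UNIV \<le> 1"
        by (simp add: emeasure_space_1)
      then show "finite_measure (slice L)"
        by (intro finite_measureI) (auto simp: slice_def top_unique)
      show "emeasure (slice L) {s<..t} = emeasure (slice (joint_law t)) {s<..t}" if "0 < s" "s < t" for s
        using nn_integral_argmax_before[OF that t(2), of "indicator D"] by (simp add: sl sj)
      show "emeasure (slice L) {t<..s} = emeasure (slice (joint_law t)) {t<..s}" if "t < s" "s < 1" for s
        using nn_integral_argmax_after[OF t(1) that, of "indicator D"] by (simp add: sl sj)
      have "AE v in L. 0 < fst (snd v) \<and> fst (snd v) < 1"
        unfolding L_def using AE_first_argmax by (subst AE_distr_iff[OF X]) (simp_all add: X_def)
      then show "AE x in slice L. 0 < x \<and> x < 1"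
        by (rule slice_AE[OF sL])
      show "AE x in slice (joint_law t). 0 < x \<and> x < 1"
        by (rule slice_AE[OF sets_joint_law AE_joint_law])
    qed (use t in auto)
    moreover have "emeasure (distr K (borel3 \<Otimes>\<^sub>M borel) \<pi>) (D \<times> I) = emeasure (slice K) I" if [measurable_cong]: "sets K = sets borel4" for K
    proof -
      have "emeasure (distr K (borel3 \<Otimes>\<^sub>M borel) \<pi>) (D \<times> I) = (\<integral>\<^sup>+v. indicator (D \<times> I) (\<pi> v) \<partial>K)"
      proof -
        have DI[measurable]: "D \<times> I \<in> sets (borel3 \<Otimes>\<^sub>M borel)" by simp
        have "emeasure (distr K (borel3 \<Otimes>\<^sub>M borel) \<pi>) (D \<times> I) = (\<integral>\<^sup>+v. indicator (D \<times> I) v \<partial>distr K (borel3 \<Otimes>\<^sub>M borel) \<pi>)"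
          by (rule nn_integral_indicator[symmetric]) simp
        also have "\<dots> = (\<integral>\<^sup>+v. indicator (D \<times> I) (\<pi> v) \<partial>K)"
          by (rule nn_integral_distr) measurable
        finally show ?thesis .
      qed
      also have "\<dots> = (\<integral>\<^sup>+v. f v * indicator I (fst (snd v)) \<partial>K)"
        by (intro nn_integral_cong) (auto simp: \<pi>_def f_def case_prod_unfold split: split_indicator)
      finally show ?thesis using slice[of I K] that by simp
    qed
    ultimately show "emeasure (distr L (borel3 \<Otimes>\<^sub>M borel) \<pi>) (D \<times> I) = emeasure (distr (joint_law t) (borel3 \<Otimes>\<^sub>M borel) \<pi>) (D \<times> I)"
      using sL sets_joint_law[of t] by simp
  qed simp_all
  then have "distr (distr L (borel3 \<Otimes>\<^sub>M borel) \<pi>) borel4 \<rho> = distr (distr (joint_law t) (borel3 \<Otimes>\<^sub>M borel) \<pi>) borel4 \<rho>"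
    by simp
  moreover have "distr (distr K (borel3 \<Otimes>\<^sub>M borel) \<pi>) borel4 \<rho> = K" if [measurable_cong]: "sets K = sets borel4" for K
  proof -
    have "\<rho> \<circ> \<pi> = (\<lambda>v. v)" by (auto simp: fun_eq_iff \<rho>_def \<pi>_def)
    then show ?thesis using that by (subst distr_distr) (simp_all add: distr_id2)
  qed
  ultimately have "L = joint_law t" using sL sets_joint_law[of t] by simp
  then show ?thesis by (simp add: L_def X_def[abs_def])
qed

lemma joint_distributed:
  assumes "0 < t" "t < 1"
  shows "distributed M lborel (\<lambda>\<omega>. (B t \<omega>, first_argmax B \<omega>, path_max B \<omega>, B 1 \<omega>))
      (\<lambda>(x, \<theta>, h, c). ennreal (joint_density t x \<theta> h c))"
  unfolding distributed_def
proof (intro conjI)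
  have [measurable]: "B t \<in> borel_measurable M" "B 1 \<in> borel_measurable M" using assms by auto
  have "(\<lambda>\<omega>. (B t \<omega>, first_argmax B \<omega>, path_max B \<omega>, B 1 \<omega>)) \<in> measurable M borel4" by measurable
  then show "(\<lambda>\<omega>. (B t \<omega>, first_argmax B \<omega>, path_max B \<omega>, B 1 \<omega>)) \<in> measurable M lborel" by (simp add: borel4)
  show "(\<lambda>(x, \<theta>, h, c). ennreal (joint_density t x \<theta> h c)) \<in> borel_measurable lborel"
    using joint_density_measurable_tuple[of t] by (simp add: borel4)
  have "distr M lborel (\<lambda>\<omega>. (B t \<omega>, first_argmax B \<omega>, path_max B \<omega>, B 1 \<omega>)) =
      distr M borel4 (\<lambda>\<omega>. (B t \<omega>, first_argmax B \<omega>, path_max B \<omega>, B 1 \<omega>))"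
    by (intro distr_cong) (simp_all only: sets_lborel borel4)
  then show "distr M lborel (\<lambda>\<omega>. (B t \<omega>, first_argmax B \<omega>, path_max B \<omega>, B 1 \<omega>)) =
      density lborel (\<lambda>(x, \<theta>, h, c). ennreal (joint_density t x \<theta> h c))"
    using distr_joint[OF assms] by (simp add: joint_law_def)
qed

end

section \<open>The conditional law\<close>

text \<open>The prefactor with the positive exponential is the reciprocal of a passage density, up
  to the constant that cancels. In this form the density is that of a three-dimensional Bessel
  bridge: conditioned as here, the distance below the maximum runs from \<open>h\<close> to 0 before
  the argmax and from 0 to \<open>h - c\<close> after it.\<close>

lemma cond_density_eq:
  "cond_density t c \<theta> h x =
     (if argmax_domain \<theta> h c \<and> x < h then
        if t < \<theta> then g t (h - x) h * passage (h - x) (\<theta> - t) / passage h \<theta>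
        else if \<theta> < t then g (1 - t) (h - x) (h - c) * passage (h - x) (t - \<theta>) / passage (h - c) (1 - \<theta>)
        else 0
      else 0)"
proof -
  \<comment> \<open>Here \<open>r\<close> stands for the constant \<open>sqrt (2 * pi)\<close>
    shared by both passage densities.\<close>
  have alg: "y * (P * b / (Q * a)) * (1 / E1) * E2 = y * (b / (r * Q) * E2) / (a / (r * P) * E1)"
    if "r \<noteq> 0" for y P b Q a E1 E2 r :: real
  proof -
    have "y * (b / (r * Q) * E2) / (a / (r * P) * E1) = (r / r) * (y * (P * b / (Q * a)) * (1 / E1) * E2)"
      by (simp only: divide_inverse inverse_mult_distrib inverse_inverse_eq mult_ac mult_1_left)
    then show ?thesis using that by (simp only: divide_self mult_1_left simp_thms)
  qed
  have q: "y * (u powr (3/2) * b / (v powr (3/2) * a)) * exp (a\<^sup>2 / (2 * u)) * exp (- b\<^sup>2 / (2 * v)) = y * passage b v / passage a u"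
    if "0 < u" "0 < v" for a b u v y :: real
  proof -
    have e: "exp (a\<^sup>2 / (2 * u)) = 1 / exp (- a\<^sup>2 / (2 * u))"
      by (simp add: exp_minus inverse_eq_divide)
    show ?thesis
      unfolding passage_powr[OF that(1)] passage_powr[OF that(2)] e by (rule alg) simp
  qed
  have q': "y * (b * u powr (3/2) / (a * v powr (3/2))) * exp (- b\<^sup>2 / (2 * v)) * exp (a\<^sup>2 / (2 * u)) = y * passage b v / passage a u"
    if "0 < u" "0 < v" for a b u v y :: real
    using q[OF that, of y b a] by (simp only: mult_ac)
  show ?thesis
    using q[of \<theta> "\<theta> - t" "g t (h - x) h" "h - x" h] q'[of "1 - \<theta>" "t - \<theta>" "g (1 - t) (h - x) (h - c)" "h - x" "h - c"]
    by (auto simp: cond_density_def argmax_domain_def)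
qed

lemma cond_density_measurable [measurable]:
  assumes [measurable]: "x \<in> borel_measurable M" "\<theta> \<in> borel_measurable M" "h \<in> borel_measurable M" "c \<in> borel_measurable M"
  shows "(\<lambda>v. cond_density t (c v) (\<theta> v) (h v) (x v)) \<in> borel_measurable M"
  unfolding cond_density_eq argmax_domain_def by measurable

lemma nn_integral_g_passage:
  assumes "0 < v" "0 < q" "0 < d"
  shows "(\<integral>\<^sup>+x. ennreal (indicator {..<h} x * (g q (h - x) d * passage (h - x) v)) \<partial>lborel) = ennreal (passage d (v + q))"
proof -
  have "(\<integral>\<^sup>+x. ennreal (indicator {..<h} x * (g q (h - x) d * passage (h - x) v)) \<partial>lborel) =
      (\<integral>\<^sup>+b. ennreal (indicator {..<h} (h - b) * (g q (h - (h - b)) d * passage (h - (h - b)) v)) \<partial>lborel)"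
    by (rule nn_integral_lborel_reflect) simp
  also have "\<dots> = (\<integral>\<^sup>+b. ennreal (indicator {0<..} b * (passage b v * g q d b)) \<partial>lborel)"
    by (intro nn_integral_cong) (auto simp: g_commute[of q d] mult_ac split: split_indicator)
  finally show ?thesis using passage_through_position[OF assms] by simp
qed

lemma nn_integral_cond_density:
  assumes t: "0 < t" "t < 1" and dom: "argmax_domain \<theta> h c" "\<theta> \<noteq> t"
  shows "(\<integral>\<^sup>+x. ennreal (cond_density t c \<theta> h x) \<partial>lborel) = 1"
proof -
  have ratio: "(\<integral>\<^sup>+x. ennreal (indicator {..<h} x * (g q (h - x) d * passage (h - x) v) / passage d (v + q)) \<partial>lborel) = 1"
    if "0 < v" "0 < q" "0 < d" for v q d
  proof -
    have pos: "0 < passage d (v + q)" using that by (intro passage_pos) auto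
    have "(\<integral>\<^sup>+x. ennreal (indicator {..<h} x * (g q (h - x) d * passage (h - x) v) / passage d (v + q)) \<partial>lborel) =
        (\<integral>\<^sup>+x. ennreal (indicator {..<h} x * (g q (h - x) d * passage (h - x) v)) * ennreal (1 / passage d (v + q)) \<partial>lborel)"
      using pos by (simp add: ennreal_mult''[symmetric])
    also have "\<dots> = ennreal (passage d (v + q)) * ennreal (1 / passage d (v + q))"
      using that by (subst nn_integral_multc) (simp_all add: nn_integral_g_passage)
    finally show ?thesis using pos by (simp add: ennreal_mult''[symmetric])
  qed
  show ?thesis
  proof (cases "t < \<theta>")
    case True
    then have "cond_density t c \<theta> h x = indicator {..<h} x * (g t (h - x) h * passage (h - x) (\<theta> - t)) / passage h (\<theta> - t + t)" for x
      using dom by (auto simp: cond_density_eq split: split_indicator)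
    then show ?thesis using ratio[of "\<theta> - t" t h] True t dom by (simp add: argmax_domain_def)
  next
    case False
    then have "cond_density t c \<theta> h x = indicator {..<h} x * (g (1 - t) (h - x) (h - c) * passage (h - x) (t - \<theta>)) / passage (h - c) (t - \<theta> + (1 - t))" for x
      using dom by (auto simp: cond_density_eq split: split_indicator)
    then show ?thesis using ratio[of "t - \<theta>" "1 - t" "h - c"] False t dom by (simp add: argmax_domain_def)
  qed
qed

text \<open>The known density \<open>p(c, \<theta>, h)\<close> written with passage densities: the
  climb to \<open>h\<close> before the argmax and the reversed climb from \<open>c\<close> after it.
  The 2 turns \<open>1 / (2 * pi)\<close> into \<open>1 / pi\<close>.\<close>

definition argmax_density :: "real \<Rightarrow> real \<Rightarrow> real \<Rightarrow> real" where
  "argmax_density c \<theta> h = (if argmax_domain \<theta> h c then 2 * passage h \<theta> * passage (h - c) (1 - \<theta>) else 0)"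

lemma argmax_density_measurable [measurable]:
  assumes [measurable]: "\<theta> \<in> borel_measurable M" "h \<in> borel_measurable M" "c \<in> borel_measurable M"
  shows "(\<lambda>v. argmax_density (c v) (\<theta> v) (h v)) \<in> borel_measurable M"
  unfolding argmax_density_def argmax_domain_def by measurable

lemma argmax_density_pos: "argmax_domain \<theta> h c \<Longrightarrow> 0 < argmax_density c \<theta> h"
  by (auto simp: argmax_density_def argmax_domain_def intro!: mult_pos_pos passage_pos)

lemma argmax_density_nonneg: "0 \<le> argmax_density c \<theta> h"
  using argmax_density_pos[of \<theta> h c] by (cases "argmax_domain \<theta> h c") (auto simp: argmax_density_def)

text \<open>Of the two passage factors in \<open>argmax_density\<close>, the one for the side of the
  argmax containing \<open>t\<close> cancels against the denominator.\<close>

lemma joint_density_eq_mult: "joint_density t x \<theta> h c = argmax_density c \<theta> h * cond_density t c \<theta> h x"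
proof (cases "argmax_domain \<theta> h c")
  case True
  then have "passage h \<theta> \<noteq> 0" "passage (h - c) (1 - \<theta>) \<noteq> 0"
    using passage_pos[of \<theta> h] passage_pos[of "1 - \<theta>" "h - c"] by (auto simp: argmax_domain_def)
  then show ?thesis
    using True by (simp add: joint_density_eq cond_density_eq argmax_density_def)
qed (simp add: joint_density_eq argmax_density_def)

text \<open>Where the density formula degenerates to 0, including \<open>\<theta> = t\<close>, a
  point mass is put instead, so that every value is a probability measure as a kernel
  requires.\<close>

definition cond_kernel :: "real \<Rightarrow> real \<times> real \<times> real \<Rightarrow> real measure" where
  "cond_kernel t = (\<lambda>(c, \<theta>, h). if argmax_domain \<theta> h c \<and> \<theta> \<noteq> t
      then density lborel (\<lambda>x. ennreal (cond_density t c \<theta> h x)) else return borel 0)"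

lemma cond_kernel_measurable:
  assumes t: "0 < t" "t < 1"
  shows "cond_kernel t \<in> measurable borel (prob_algebra borel)"
proof -
  have prob: "prob_space (cond_kernel t y)" for y
  proof -
    have "prob_space (density lborel (\<lambda>x. ennreal (cond_density t c \<theta> h x)))" if "argmax_domain \<theta> h c" "\<theta> \<noteq> t" for c \<theta> h
      by (intro prob_spaceI) (simp add: emeasure_density nn_integral_cond_density[OF t that])
    then show ?thesis by (auto simp: cond_kernel_def prob_space_return split: prod.split)
  qed
  have "(\<lambda>y. emeasure (cond_kernel t y) A) \<in> borel_measurable borel3" if [measurable]: "A \<in> sets borel" for A
  proof -
    have eq: "emeasure (cond_kernel t y) A = (if argmax_domain (fst (snd y)) (snd (snd y)) (fst y) \<and> fst (snd y) \<noteq> t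
        then \<integral>\<^sup>+x. ennreal (cond_density t (fst y) (fst (snd y)) (snd (snd y)) x) * indicator A x \<partial>lborel else indicator A 0)" for y
      by (auto simp: cond_kernel_def case_prod_unfold emeasure_density)
    show ?thesis unfolding eq argmax_domain_def by measurable
  qed
  then show ?thesis
    using prob by (intro measurable_prob_algebraI measurable_subprob_algebra)
      (auto simp: borel3 prob_space_imp_subprob_space cond_kernel_def split: prod.split)
qed

text \<open>Distribution functions are right continuous, so rational points approached from the
  right decide. Countability is essential for collecting null sets in the next lemma.\<close>

lemma real_distribution_eqI_rat:
  assumes "real_distribution \<mu>" "real_distribution \<nu>"
    and eq: "\<And>q. q \<in> \<rat> \<Longrightarrow> emeasure \<mu> {..q} = emeasure \<nu> {..q}"
  shows "\<mu> = \<nu>"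
proof (rule cdf_unique[OF assms(1,2)], rule ext)
  fix x
  interpret \<mu>: real_distribution \<mu> by fact
  interpret \<nu>: real_distribution \<nu> by fact
  have "\<exists>q\<in>\<rat>. x < q \<and> q < x + inverse (real (Suc n))" for n
    by (rule Rats_dense_in_real) simp
  then obtain q where q: "\<And>n. q n \<in> \<rat>" "\<And>n. x < q n" "\<And>n. q n < x + inverse (real (Suc n))"
    by metis
  have lim0: "(\<lambda>n. x + inverse (real (Suc n))) \<longlonglongrightarrow> x"
    using tendsto_add[OF tendsto_const LIMSEQ_inverse_real_of_nat, of x] by simp
  have "q \<longlonglongrightarrow> x"
    by (rule tendsto_sandwich[OF _ _ tendsto_const lim0])
      (use q in \<open>auto intro!: always_eventually less_imp_le\<close>)
  then have lim: "filterlim q (at_right x) sequentially"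
    using q(2) by (auto simp: filterlim_at less_imp_neq[THEN not_sym])
  have "(cdf \<mu> \<longlongrightarrow> cdf \<mu> x) (at_right x)" "(cdf \<nu> \<longlongrightarrow> cdf \<nu> x) (at_right x)"
    using \<mu>.cdf_is_right_cont[of x] \<nu>.cdf_is_right_cont[of x] by (simp_all add: continuous_within)
  from this[THEN filterlim_compose, OF lim]
  have "(\<lambda>n. cdf \<mu> (q n)) \<longlonglongrightarrow> cdf \<mu> x" "(\<lambda>n. cdf \<nu> (q n)) \<longlonglongrightarrow> cdf \<nu> x" .
  moreover have "cdf \<mu> (q n) = cdf \<nu> (q n)" for n
    using eq[OF q(1)] by (simp add: cdf_def measure_def)
  ultimately show "cdf \<mu> x = cdf \<nu> x" by (auto intro: LIMSEQ_unique)
qed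

text \<open>For fixed \<open>q\<close> the masses of \<open>{..q}\<close> under both kernels are
  densities, with respect to the law of \<open>Y\<close>, of the same finite measure, so they agree
  almost everywhere. One null set per rational \<open>q\<close> is then discarded.\<close>

lemma regular_cond_distr_unique:
  assumes "prob_space M" and "regular_cond_distr M borel X N Y \<kappa>" and "regular_cond_distr M borel X N Y \<kappa>'"
  shows "AE y in distr M N Y. \<kappa> y = (\<kappa>' y :: real measure)"
proof -
  interpret prob_space M by fact
  have [measurable]: "Y \<in> measurable M N" "\<kappa> \<in> measurable N (prob_algebra borel)" "\<kappa>' \<in> measurable N (prob_algebra borel)"
    using assms by (auto simp: regular_cond_distr_def)
  interpret Y: prob_space "distr M N Y" by (rule prob_space_distr) measurable
  have [measurable]: "\<kappa> \<in> measurable N (subprob_algebra borel)" "\<kappa>' \<in> measurable N (subprob_algebra borel)"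
    by (auto intro: measurable_prob_algebraD)
  have "AE y in distr M N Y. emeasure (\<kappa> y) {..q} = emeasure (\<kappa>' y) {..q}" for q :: real
  proof (rule Y.density_unique_finite_measure)
    fix D assume "D \<in> sets (distr M N Y)"
    then have D: "D \<in> sets N" by simp
    have "(\<integral>\<^sup>+y\<in>D. emeasure (K y) {..q} \<partial>distr M N Y) = emeasure M {\<omega>\<in>space M. X \<omega> \<in> {..q} \<and> Y \<omega> \<in> D}"
      if "regular_cond_distr M borel X N Y K" for K
    proof -
      have "\<forall>A\<in>sets borel. \<forall>D\<in>sets N. emeasure M {\<omega>\<in>space M. X \<omega> \<in> A \<and> Y \<omega> \<in> D} = (\<integral>\<^sup>+y\<in>D. emeasure (K y) A \<partial>distr M N Y)"
        using that unfolding regular_cond_distr_def by blast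
      from this[rule_format, of "{..q}" D] D show ?thesis by (simp only: atMost_borel)
    qed
    from this[OF assms(2)] this[OF assms(3)]
    show "(\<integral>\<^sup>+y\<in>D. emeasure (\<kappa> y) {..q} \<partial>distr M N Y) = (\<integral>\<^sup>+y\<in>D. emeasure (\<kappa>' y) {..q} \<partial>distr M N Y)"
      by (simp only:)
  qed (simp_all add: measurable_emeasure_kernel)
  then have "AE y in distr M N Y. \<forall>q\<in>\<rat>. emeasure (\<kappa> y) {..q} = emeasure (\<kappa>' y) {..q}"
    by (subst AE_ball_countable) (auto simp: countable_rat)
  moreover have "AE y in distr M N Y. y \<in> space N"
    using AE_space[of "distr M N Y"] by simp
  ultimately show ?thesis
  proof eventually_elim
    case (elim y)
    have "real_distribution K" if "K \<in> space (prob_algebra borel)" for K :: "real measure"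
      using that by (auto simp: space_prob_algebra real_distribution_def real_distribution_axioms_def)
    then show ?case
      using elim measurable_space[of \<kappa> N "prob_algebra borel" y] measurable_space[of \<kappa>' N "prob_algebra borel" y]
      by (intro real_distribution_eqI_rat) auto
  qed
qed

context brownian
begin

lemma nn_integral_joint:
  assumes t: "0 < t" "t < 1" and F[measurable]: "F \<in> borel_measurable borel4"
  shows "(\<integral>\<^sup>+\<omega>. F (B t \<omega>, B 1 \<omega>, first_argmax B \<omega>, path_max B \<omega>) \<partial>M) =
    (\<integral>\<^sup>+c. \<integral>\<^sup>+\<theta>. \<integral>\<^sup>+h. \<integral>\<^sup>+x. ennreal (joint_density t x \<theta> h c) * F (x, c, \<theta>, h) \<partial>lborel \<partial>lborel \<partial>lborel \<partial>lborel)"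
proof -
  have [measurable]: "B t \<in> borel_measurable M" "B 1 \<in> borel_measurable M" using t by auto
  define W where "W x \<theta> h c = ennreal (joint_density t x \<theta> h c) * F (x, c, \<theta>, h)" for x \<theta> h c
  have [measurable]: "(\<lambda>v. W (a v) (b v) (c v) (d v)) \<in> borel_measurable N"
    if [measurable]: "a \<in> borel_measurable N" "b \<in> borel_measurable N" "c \<in> borel_measurable N" "d \<in> borel_measurable N"
    for a b c d and N :: "'b measure"
    unfolding W_def by measurable
  have "(\<integral>\<^sup>+\<omega>. F (B t \<omega>, B 1 \<omega>, first_argmax B \<omega>, path_max B \<omega>) \<partial>M) = (\<integral>\<^sup>+v. (\<lambda>(x, \<theta>, h, c). F (x, c, \<theta>, h)) v \<partial>joint_law t)"
    unfolding distr_joint[OF t, symmetric] by (subst nn_integral_distr) simp_all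
  also have "\<dots> = (\<integral>\<^sup>+x. \<integral>\<^sup>+\<theta>. \<integral>\<^sup>+h. \<integral>\<^sup>+c. W x \<theta> h c \<partial>lborel \<partial>lborel \<partial>lborel \<partial>lborel)"
    by (subst nn_integral_joint_law) (simp_all add: W_def[abs_def])
  also have "\<dots> = (\<integral>\<^sup>+x. \<integral>\<^sup>+\<theta>. \<integral>\<^sup>+c. \<integral>\<^sup>+h. W x \<theta> h c \<partial>lborel \<partial>lborel \<partial>lborel \<partial>lborel)"
    by (intro nn_integral_cong nn_integral_lborel_swap) measurable
  also have "\<dots> = (\<integral>\<^sup>+x. \<integral>\<^sup>+c. \<integral>\<^sup>+\<theta>. \<integral>\<^sup>+h. W x \<theta> h c \<partial>lborel \<partial>lborel \<partial>lborel \<partial>lborel)"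
    by (intro nn_integral_cong nn_integral_lborel_swap) measurable
  also have "\<dots> = (\<integral>\<^sup>+c. \<integral>\<^sup>+x. \<integral>\<^sup>+\<theta>. \<integral>\<^sup>+h. W x \<theta> h c \<partial>lborel \<partial>lborel \<partial>lborel \<partial>lborel)"
    by (intro nn_integral_cong nn_integral_lborel_swap) measurable
  also have "\<dots> = (\<integral>\<^sup>+c. \<integral>\<^sup>+\<theta>. \<integral>\<^sup>+x. \<integral>\<^sup>+h. W x \<theta> h c \<partial>lborel \<partial>lborel \<partial>lborel \<partial>lborel)"
    by (intro nn_integral_cong nn_integral_lborel_swap) measurable
  also have "\<dots> = (\<integral>\<^sup>+c. \<integral>\<^sup>+\<theta>. \<integral>\<^sup>+h. \<integral>\<^sup>+x. W x \<theta> h c \<partial>lborel \<partial>lborel \<partial>lborel \<partial>lborel)"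
    by (intro nn_integral_cong nn_integral_lborel_swap) measurable
  finally show ?thesis unfolding W_def .
qed

lemma nn_integral_joint_kernel:
  assumes t: "0 < t" "t < 1" and [measurable]: "A \<in> sets borel" and G[measurable]: "G \<in> borel_measurable borel3"
  shows "(\<integral>\<^sup>+\<omega>. indicator A (B t \<omega>) * G (B 1 \<omega>, first_argmax B \<omega>, path_max B \<omega>) \<partial>M) =
    (\<integral>\<^sup>+y. (\<lambda>(c, \<theta>, h). ennreal (argmax_density c \<theta> h)) y * (emeasure (cond_kernel t y) A * G y) \<partial>lborel)"
proof -
  have [measurable]: "(\<lambda>y. emeasure (cond_kernel t y) A) \<in> borel_measurable borel3"
    using measurable_emeasure_kernel[OF measurable_prob_algebraD[OF cond_kernel_measurable[OF t]], of A]
    by (simp add: borel3)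
  have "(\<integral>\<^sup>+\<omega>. indicator A (B t \<omega>) * G (B 1 \<omega>, first_argmax B \<omega>, path_max B \<omega>) \<partial>M) =
     (\<integral>\<^sup>+c. \<integral>\<^sup>+\<theta>. \<integral>\<^sup>+h. \<integral>\<^sup>+x. ennreal (joint_density t x \<theta> h c) * (indicator A x * G (c, \<theta>, h)) \<partial>lborel \<partial>lborel \<partial>lborel \<partial>lborel)"
    using nn_integral_joint[OF t, of "\<lambda>(x, y). indicator A x * G y"] by (simp add: case_prod_unfold)
  also have "\<dots> = (\<integral>\<^sup>+c. \<integral>\<^sup>+\<theta>. \<integral>\<^sup>+h. ennreal (argmax_density c \<theta> h) * (emeasure (cond_kernel t (c, \<theta>, h)) A * G (c, \<theta>, h)) \<partial>lborel \<partial>lborel \<partial>lborel)"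
  \<comment> \<open>The null set \<open>\<theta> = t\<close> has to go: there the kernel is a point
    mass although \<open>joint_density\<close> vanishes.\<close>
  proof (intro nn_integral_cong_AE[OF AE_mp[OF AE_lborel_singleton[of t]]] nn_integral_cong AE_I2 impI)
    fix c \<theta> h :: real assume "\<theta> \<noteq> t"
    have "(\<integral>\<^sup>+x. ennreal (joint_density t x \<theta> h c) * (indicator A x * G (c, \<theta>, h)) \<partial>lborel) =
      (\<integral>\<^sup>+x. (ennreal (argmax_density c \<theta> h) * G (c, \<theta>, h)) * (ennreal (cond_density t c \<theta> h x) * indicator A x) \<partial>lborel)"
      unfolding joint_density_eq_mult
      by (intro nn_integral_cong) (simp add: ennreal_mult' argmax_density_nonneg mult_ac)
    also have "\<dots> = (ennreal (argmax_density c \<theta> h) * G (c, \<theta>, h)) * (\<integral>\<^sup>+x. ennreal (cond_density t c \<theta> h x) * indicator A x \<partial>lborel)"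
      by (rule nn_integral_cmult) simp
    also have "\<dots> = ennreal (argmax_density c \<theta> h) * (emeasure (cond_kernel t (c, \<theta>, h)) A * G (c, \<theta>, h))"
      using \<open>\<theta> \<noteq> t\<close> by (cases "argmax_domain \<theta> h c") (simp_all add: cond_kernel_def emeasure_density argmax_density_def mult_ac)
    finally show "(\<integral>\<^sup>+x. ennreal (joint_density t x \<theta> h c) * (indicator A x * G (c, \<theta>, h)) \<partial>lborel) =
      ennreal (argmax_density c \<theta> h) * (emeasure (cond_kernel t (c, \<theta>, h)) A * G (c, \<theta>, h))" .
  qed
  also have "\<dots> = (\<integral>\<^sup>+y. (\<lambda>(c, \<theta>, h). ennreal (argmax_density c \<theta> h)) y * (emeasure (cond_kernel t y) A * G y) \<partial>lborel)"
    by (subst nn_integral_lborel3) simp_all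
  finally show ?thesis .
qed

text \<open>A marginal of the joint law with the position at a time in the interior integrated out;
  the time \<open>1/2\<close> is an arbitrary choice. Since the kernel has total mass 1,
  \<open>nn_integral_joint_kernel\<close> with \<open>A = UNIV\<close> leaves exactly
  \<open>argmax_density\<close>.\<close>

lemma argmax_distributed:
  "distributed M lborel (\<lambda>\<omega>. (B 1 \<omega>, first_argmax B \<omega>, path_max B \<omega>)) (\<lambda>(c, \<theta>, h). ennreal (argmax_density c \<theta> h))"
  unfolding distributed_def
proof (intro conjI)
  let ?Y = "\<lambda>\<omega>. (B 1 \<omega>, first_argmax B \<omega>, path_max B \<omega>)" and ?f = "\<lambda>(c, \<theta>, h). ennreal (argmax_density c \<theta> h)"
  have [measurable]: "B 1 \<in> borel_measurable M" by auto
  have "?Y \<in> measurable M borel3" by measurable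
  then show Y: "?Y \<in> measurable M lborel" by (simp add: borel3)
  have "?f \<in> borel_measurable borel3" unfolding case_prod_unfold by measurable
  then show f: "?f \<in> borel_measurable lborel" by (simp add: borel3)
  show "distr M lborel ?Y = density lborel ?f"
  proof (rule measure_eqI)
    fix D assume "D \<in> sets (distr M lborel ?Y)"
    then have D: "D \<in> sets borel" by simp
    then have D3: "D \<in> sets borel3" by (simp only: borel3)
    have k: "emeasure (cond_kernel (1/2) y) UNIV = 1" for y
    proof -
      have "cond_kernel (1/2) y \<in> space (prob_algebra borel)"
        by (rule measurable_space[OF cond_kernel_measurable]) auto
      then have "prob_space (cond_kernel (1/2) y)" and s: "sets (cond_kernel (1/2) y) = sets borel"
        by (auto simp: space_prob_algebra)
      then show ?thesis using prob_space.emeasure_space_1 sets_eq_imp_space_eq[OF s] by (metis space_borel)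
    qed
    have "emeasure (distr M lborel ?Y) D = (\<integral>\<^sup>+\<omega>. indicator UNIV (B (1/2) \<omega>) * indicator D (?Y \<omega>) \<partial>M)"
    proof -
      have "emeasure (distr M lborel ?Y) D = (\<integral>\<^sup>+y. indicator D y \<partial>distr M lborel ?Y)"
        using D by (intro nn_integral_indicator[symmetric]) simp
      also have "\<dots> = (\<integral>\<^sup>+\<omega>. indicator D (?Y \<omega>) \<partial>M)"
        using D by (intro nn_integral_distr[OF Y]) simp
      finally show ?thesis by simp
    qed
    also have "\<dots> = (\<integral>\<^sup>+y. ?f y * indicator D y \<partial>lborel)"
      using D3 by (subst nn_integral_joint_kernel) (simp_all add: k)
    finally show "emeasure (distr M lborel ?Y) D = emeasure (density lborel ?f) D"
      using f D by (simp add: emeasure_density)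
  qed simp
qed

lemma regular_cond_distr_cond_kernel:
  assumes t: "0 < t" "t < 1"
  shows "regular_cond_distr M borel (B t) borel (\<lambda>\<omega>. (B 1 \<omega>, first_argmax B \<omega>, path_max B \<omega>)) (cond_kernel t)"
  unfolding regular_cond_distr_def
proof (intro conjI ballI)
  let ?Y = "\<lambda>\<omega>. (B 1 \<omega>, first_argmax B \<omega>, path_max B \<omega>)" and ?f = "\<lambda>(c, \<theta>, h). ennreal (argmax_density c \<theta> h)"
  show Bt: "B t \<in> borel_measurable M" using t by auto
  show Y: "?Y \<in> borel_measurable M"
    using argmax_distributed by (simp add: distributed_def)
  show K: "cond_kernel t \<in> measurable borel (prob_algebra borel)"
    by (rule cond_kernel_measurable[OF t])
  fix A D assume A: "A \<in> sets (borel :: real measure)" and D: "D \<in> sets (borel :: (real \<times> real \<times> real) measure)"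
  have mK: "(\<lambda>y. emeasure (cond_kernel t y) A) \<in> borel_measurable borel"
    using measurable_emeasure_kernel[OF measurable_prob_algebraD[OF K] A] .
  have f: "?f \<in> borel_measurable lborel" using argmax_distributed by (simp add: distributed_def)
  have AD: "{\<omega>\<in>space M. B t \<omega> \<in> A \<and> ?Y \<omega> \<in> D} \<in> events"
    using measurable_sets[OF Bt A] measurable_sets[OF Y D] by (auto simp: vimage_def Int_def conj_ac intro: sets.sets_Collect_conj)
  have "emeasure M {\<omega>\<in>space M. B t \<omega> \<in> A \<and> ?Y \<omega> \<in> D} = (\<integral>\<^sup>+\<omega>. indicator A (B t \<omega>) * indicator D (?Y \<omega>) \<partial>M)"
    unfolding nn_integral_indicator[OF AD, symmetric]
    by (intro nn_integral_cong) (auto split: split_indicator)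
  also have "\<dots> = (\<integral>\<^sup>+y. ?f y * (emeasure (cond_kernel t y) A * indicator D y) \<partial>lborel)"
    using D by (intro nn_integral_joint_kernel[OF t A]) (simp add: borel3)
  also have "\<dots> = (\<integral>\<^sup>+y. emeasure (cond_kernel t y) A * indicator D y \<partial>density lborel ?f)"
    using mK D f by (intro nn_integral_density[symmetric]) auto
  also have "density lborel ?f = distr M borel ?Y"
  proof -
    have "distr M borel ?Y = distr M lborel ?Y" by (intro distr_cong) auto
    then show ?thesis using argmax_distributed by (simp add: distributed_def)
  qed
  finally show "emeasure M {\<omega>\<in>space M. B t \<omega> \<in> A \<and> ?Y \<omega> \<in> D} = (\<integral>\<^sup>+y\<in>D. emeasure (cond_kernel t y) A \<partial>distr M borel ?Y)" .
qed

text \<open>Uniqueness holds almost everywhere for the law of the conditioning triple. That law has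
  a strictly positive density on \<open>argmax_domain\<close>, so there the exceptional set is also
  null for Lebesgue measure.\<close>

lemma AE_regular_cond_distr_eq:
  assumes t: "0 < t" "t < 1"
    and \<kappa>: "regular_cond_distr M borel (B t) borel (\<lambda>\<omega>. (B 1 \<omega>, first_argmax B \<omega>, path_max B \<omega>)) \<kappa>"
  shows "AE (c, \<theta>, h) in lborel. argmax_domain \<theta> h c \<longrightarrow> \<kappa> (c, \<theta>, h) = cond_kernel t (c, \<theta>, h)"
proof -
  let ?Y = "\<lambda>\<omega>. (B 1 \<omega>, first_argmax B \<omega>, path_max B \<omega>)" and ?f = "\<lambda>(c, \<theta>, h). ennreal (argmax_density c \<theta> h)"
  have "distr M borel ?Y = distr M lborel ?Y" by (intro distr_cong) auto
  then have eq: "distr M borel ?Y = density lborel ?f" and f: "?f \<in> borel_measurable lborel"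
    using argmax_distributed by (simp_all add: distributed_def)
  have "AE y in distr M borel ?Y. \<kappa> y = cond_kernel t y"
    by (rule regular_cond_distr_unique[OF prob_space_axioms \<kappa> regular_cond_distr_cond_kernel[OF t]])
  then have "AE y in density lborel ?f. \<kappa> y = cond_kernel t y" unfolding eq .
  then have "AE y in lborel. 0 < ?f y \<longrightarrow> \<kappa> y = cond_kernel t y"
    by (subst (asm) AE_density[OF f])
  then show ?thesis
    by eventually_elim (auto simp: argmax_density_pos)
qed

end

theorem corollary4p2:
  fixes M :: "'a measure" and B :: "real \<Rightarrow> 'a \<Rightarrow> real" and t :: real
  assumes "brownian_motion01 M B"
    and "0 < t" and "t < 1"
  shows
    "(\<exists>\<kappa>. regular_cond_distr M borel (B t) borel
              (\<lambda>\<omega>. (B 1 \<omega>, first_argmax B \<omega>, path_max B \<omega>)) \<kappa> \<and>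
           (\<forall>c \<theta> h. 0 < \<theta> \<and> \<theta> < 1 \<and> \<theta> \<noteq> t \<and> h > max 0 c \<longrightarrow>
              \<kappa> (c, \<theta>, h) = density lborel (\<lambda>x. ennreal (cond_density t c \<theta> h x))))
     \<and> (\<forall>\<kappa>. regular_cond_distr M borel (B t) borel
              (\<lambda>\<omega>. (B 1 \<omega>, first_argmax B \<omega>, path_max B \<omega>)) \<kappa> \<longrightarrow>
           (AE (c, \<theta>, h) in (lborel :: (real \<times> real \<times> real) measure).
              0 < \<theta> \<and> \<theta> < 1 \<and> \<theta> \<noteq> t \<and> h > max 0 c \<longrightarrow>
              \<kappa> (c, \<theta>, h) = density lborel (\<lambda>x. ennreal (cond_density t c \<theta> h x))))
     \<and> distributed M (lborel :: (real \<times> real \<times> real \<times> real) measure)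
         (\<lambda>\<omega>. (B t \<omega>, first_argmax B \<omega>, path_max B \<omega>, B 1 \<omega>))
         (\<lambda>(x, \<theta>, h, c). ennreal (joint_density t x \<theta> h c))"
proof (intro conjI allI impI)
  interpret brownian M B by unfold_locales fact
  note t = \<open>0 < t\<close> \<open>t < 1\<close>
  have kernel: "cond_kernel t (c, \<theta>, h) = density lborel (\<lambda>x. ennreal (cond_density t c \<theta> h x))"
    if "0 < \<theta> \<and> \<theta> < 1 \<and> \<theta> \<noteq> t \<and> h > max 0 c" for c \<theta> h
    using that by (simp add: cond_kernel_def argmax_domain_def)
  then show "\<exists>\<kappa>. regular_cond_distr M borel (B t) borel
              (\<lambda>\<omega>. (B 1 \<omega>, first_argmax B \<omega>, path_max B \<omega>)) \<kappa> \<and>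
           (\<forall>c \<theta> h. 0 < \<theta> \<and> \<theta> < 1 \<and> \<theta> \<noteq> t \<and> h > max 0 c \<longrightarrow>
              \<kappa> (c, \<theta>, h) = density lborel (\<lambda>x. ennreal (cond_density t c \<theta> h x)))"
    using regular_cond_distr_cond_kernel[OF t] by blast
  show "distributed M (lborel :: (real \<times> real \<times> real \<times> real) measure)
         (\<lambda>\<omega>. (B t \<omega>, first_argmax B \<omega>, path_max B \<omega>, B 1 \<omega>))
         (\<lambda>(x, \<theta>, h, c). ennreal (joint_density t x \<theta> h c))"
    by (rule joint_distributed[OF t])
  fix \<kappa> assume "regular_cond_distr M borel (B t) borel (\<lambda>\<omega>. (B 1 \<omega>, first_argmax B \<omega>, path_max B \<omega>)) \<kappa>"
  from AE_regular_cond_distr_eq[OF t this]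
  show "AE (c, \<theta>, h) in (lborel :: (real \<times> real \<times> real) measure).
              0 < \<theta> \<and> \<theta> < 1 \<and> \<theta> \<noteq> t \<and> h > max 0 c \<longrightarrow>
              \<kappa> (c, \<theta>, h) = density lborel (\<lambda>x. ennreal (cond_density t c \<theta> h x))"
  proof eventually_elim
    case (elim y)
    then show ?case using kernel by (cases y) (auto simp: argmax_domain_def)
  qed
qed

end
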